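(* Let $M$ be a non-degenerate, path connected, $T_1$, Baire space with no path cut point, and let a countable group $G$ act by homeomorphisms on $M$. Let $\mathcal{D}$ be a $G$-finite, point-convergent collection of $G$-full divisions of $M$. Then there is a $G$-action on a $\mathrm{CAT}(0)$ cube complex $X=X(\mathcal{D})$ (the cube complex dual to the wallspace determined by $\mathcal{D}$) such that the set of hyperplane stabilizers $\{\mathrm{Stab}_G(H)\mid H \text{ a hyperplane of } X\}$ is equal to the set of division stabilizers $\{\mathrm{Stab}_G(D)\mid D\in\mathcal{D}\}$.
   Context: Divisions. A division of a topological space $M$ is a pair $D=(C_D,\{M_D^+,M_D^-\})$ such that (1) $C_D\subset M$ is closed and nowhere dense; (2) $M\setminus C_D=M_D^+\sqcup M_D^-$ with $M_D^+,M_D^-$ nonempty and clopen in $M\setminus C_D$; (3) $\overline{M_D^{\epsilon}}=M_D^{\epsilon}\cup C_D$ for each $\epsilon\in\{+,-\}$. If $G$ acts on $M$ by homeomorphisms, $gD=(gC_D,\{gM_D^+,gM_D^-\})$; $\mathrm{Stab}(D)$ is the stabilizer of $D$ for this action (its elements may exchange $M_D^+$ and $M_D^-$), $\mathrm{Stab}(C_D)$ is the setwise stabilizer of $C_D$, and $D$ is $G$-full if $\mathrm{Stab}(D)$ has finite index in $\mathrm{Stab}(C_D)$. A collection is $G$-finite if it is $G$-invariant and consists of finitely many $G$-orbits. A collection $\mathcal{C}$ of subsets of $M$ is point-convergent if for every sequence $(C_i)_{i\in\mathbb{N}}$ of distinct elements of $\mathcal{C}$ the set $\lim_{i\to\infty}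 C_i$, consisting of the points of $M$ that are limits of sequences $(x_i)$ with $x_i\in C_i$, has at most one point. A collection $\mathcal{D}$ of divisions is point-convergent if $\{D\in\mathcal{D}\mid C_D=C\}$ is finite for every $C\subset M$ and $\{C_D\mid D\in\mathcal{D}\}$ is point-convergent. A path cut point of a path connected space $Y$ is a point $p$ for which there exist $a,b\in Y\setminus\{p\}$ such that every path from $a$ to $b$ passes through $p$. Non-degenerate means having more than one point. The complex $X(\mathcal{D})$. Let $M_{\mathcal{D}}=M\setminus\bigcup_{D\in\mathcal{D}}C_D$ and let $\Theta_{\mathcal{D}}$ be the set of unordered triples of distinct points of $M_{\mathcal{D}}$. For $D\in\mathcal{D}$ let $W_D^{\pm}=\{t\in\Theta_{\mathcal{D}}\mid \#(t\cap M_D^{\pm})\ge 2\}$; these are the halfspaces, and $W_D=\{W_D^+,W_D^-\}$ is a wall ($\Theta_{\mathcal{D}}=W_D^+\sqcup W_D^-$). An ultrafilter is a set $\alpha$ of halfspaces containing exactly one of $W_D^+,W_D^-$ for each $D\in\mathcal{D}$ and such that $A\in\alpha$, $A\subseteq B$ with $B$ a halfspace implies $B\in\alpha$. It is DCC if every descending chain of its elements terminates. It is principal if it equals $\alpha_t=\{A\mid t\in A\}$ for some $t\in\Theta_{\mathcal{D}}$. Let $Z$ be the cube complex whose vertices are the DCC ultrafilters, with $\alpha,\alpha'$ joined by an edge iff $\alpha'=(\alpha\setminus\{A\})\cup\{\Theta_{\mathcal{D}}\setminus A\}$ for some $A$ minimal in $\alpha$ under inclusion, and with an $n$-cube ($n>1$)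 attached whenever the $(n-1)$-skeleton of an $n$-cube appears. $X(\mathcal{D})$ is the connected component of $Z$ containing the principal ultrafilters. $G$ acts by $g\alpha=\{gA\mid A\in\alpha\}$. A hyperplane of a $\mathrm{CAT}(0)$ cube complex is a minimal nonempty subset whose intersection with each cube is empty or a midcube of that cube. *)

theory Defs
  imports "HOL-Analysis.Analysis" "HOL-Algebra.Group_Action"
begin

section \<open>Topological notions\<close>

definition baire_space :: "'a topology \<Rightarrow> bool" where
  "baire_space M \<longleftrightarrow>
     (\<forall>\<U>. countable \<U> \<and> (\<forall>U\<in>\<U>. openin M U \<and> M closure_of U = topspace M) \<longrightarrow>
        M closure_of (topspace M \<inter> \<Inter>\<U>) = topspace M)"

definition path_cut_point :: "'a topology \<Rightarrow> 'a \<Rightarrow> bool" where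
  "path_cut_point M p \<longleftrightarrow>
     p \<in> topspace M \<and>
     (\<exists>a\<in>topspace M - {p}. \<exists>b\<in>topspace M - {p}.
        \<forall>c. pathin M c \<and> c 0 = a \<and> c 1 = b \<longrightarrow> p \<in> c ` {0..1})"

definition simply_connected_space :: "'a topology \<Rightarrow> bool" where
  "simply_connected_space M \<longleftrightarrow>
     topspace M \<noteq> {} \<and> path_connected_space M \<and>
     (\<forall>c. pathin M c \<and> c 1 = c 0 \<longrightarrow>
        homotopic_with (\<lambda>r. r 0 = c 0 \<and> r 1 = c 0) (top_of_set {0..1}) M c (\<lambda>_. c 0))"

definition lim_sets :: "'a topology \<Rightarrow> (nat \<Rightarrow> 'a set) \<Rightarrow> 'a set" where
  "lim_sets M C = {p. \<exists>x. (\<forall>i. x i \<in> C i) \<and> limitin M x p sequentially}"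

definition point_convergent_sets :: "'a topology \<Rightarrow> 'a set set \<Rightarrow> bool" where
  "point_convergent_sets M \<C> \<longleftrightarrow>
     (\<forall>C. inj C \<and> range C \<subseteq> \<C> \<longrightarrow>
        (\<forall>p\<in>lim_sets M C. \<forall>q\<in>lim_sets M C. p = q))"


section \<open>Divisions\<close>

text \<open>A division is encoded as the pair of its cut set and the unordered pair of its two sides.\<close>

type_synonym 'a division = "'a set \<times> 'a set set"

definition division :: "'a topology \<Rightarrow> 'a division \<Rightarrow> bool" where
  "division M D \<longleftrightarrow>
     (let C = fst D; R = subtopology M (topspace M - C) in
        closedin M C \<and> M interior_of (M closure_of C) = {} \<and>
        (\<exists>P N. snd D = {P, N} \<and> P \<noteq> {} \<and> N \<noteq> {} \<and> P \<inter> N = {} \<and> P \<union> N = topspace M - C) \<and>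
        (\<forall>P\<in>snd D. closedin R P \<and> openin R P \<and> M closure_of P = P \<union> C))"

definition division_act :: "('g \<Rightarrow> 'a \<Rightarrow> 'a) \<Rightarrow> 'g \<Rightarrow> 'a division \<Rightarrow> 'a division" where
  "division_act \<phi> g D = (\<phi> g ` fst D, (`) (\<phi> g) ` snd D)"

definition full_division ::
    "('g, 'm) monoid_scheme \<Rightarrow> ('g \<Rightarrow> 'a \<Rightarrow> 'a) \<Rightarrow> 'a division \<Rightarrow> bool" where
  "full_division G \<phi> D \<longleftrightarrow>
     finite (rcosets\<^bsub>G\<lparr>carrier := stabilizer G (\<lambda>g. (`) (\<phi> g)) (fst D)\<rparr>\<^esub>
               (stabilizer G (division_act \<phi>) D))"

definition finite_division_collection ::
    "('g, 'm) monoid_scheme \<Rightarrow> ('g \<Rightarrow> 'a \<Rightarrow> 'a) \<Rightarrow> 'a division set \<Rightarrow> bool" where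
  "finite_division_collection G \<phi> \<D> \<longleftrightarrow>
     (\<forall>g\<in>carrier G. \<forall>D\<in>\<D>. division_act \<phi> g D \<in> \<D>) \<and>
     finite (orbits G \<D> (division_act \<phi>))"

definition point_convergent_divisions :: "'a topology \<Rightarrow> 'a division set \<Rightarrow> bool" where
  "point_convergent_divisions M \<D> \<longleftrightarrow>
     (\<forall>C. finite {D\<in>\<D>. fst D = C}) \<and> point_convergent_sets M (fst ` \<D>)"


section \<open>Cube complexes\<close>

text \<open>
  A cube complex all of whose cubes are embedded is given by the set \<open>K\<close> of the vertex sets of its
  cubes, the vertices themselves being the singletons in \<open>K\<close>. The vertices of a cube with
  coordinate set \<open>S\<close> are labelled by the subsets of \<open>S\<close>; its faces are the images of
  the order intervals \<open>{A..B}\<close> with \<open>A \<subseteq> B \<subseteq> S\<close>.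
\<close>

definition cube_chart :: "'v set set \<Rightarrow> nat set \<Rightarrow> (nat set \<Rightarrow> 'v) \<Rightarrow> 'v set \<Rightarrow> bool" where
  "cube_chart K S f Q \<longleftrightarrow>
     finite S \<and> bij_betw f (Pow S) Q \<and>
     {F\<in>K. F \<subseteq> Q} = {f ` {A..B} | A B. A \<subseteq> B \<and> B \<subseteq> S}"

definition cube_complex :: "'v set set \<Rightarrow> bool" where
  "cube_complex K \<longleftrightarrow>
     (\<forall>Q\<in>K. \<exists>S f. cube_chart K S f Q) \<and>
     (\<forall>P\<in>K. \<forall>Q\<in>K. P \<inter> Q = {} \<or> P \<inter> Q \<in> K)"

text \<open>
  The point of a cube with coordinates \<open>t\<close> in \<open>[0,1]\<^sup>S\<close> is represented by its multilinear
  weights on the vertices of the cube. This does not depend on the chart, and it agrees with the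
  same construction on a face containing the point, so that the geometric realization is a union
  of sets of weight functions, with no quotient to take.
\<close>

definition cube_point ::
    "nat set \<Rightarrow> (nat set \<Rightarrow> 'v) \<Rightarrow> (nat \<Rightarrow> real) \<Rightarrow> 'v \<Rightarrow> real" where
  "cube_point S f t v = (\<Sum>A | A \<subseteq> S \<and> f A = v. (\<Prod>i\<in>A. t i) * (\<Prod>i\<in>S - A. 1 - t i))"

definition cube_points :: "'v set set \<Rightarrow> 'v set \<Rightarrow> ('v \<Rightarrow> real) set" where
  "cube_points K Q = {cube_point S f t | S f t. cube_chart K S f Q \<and> (\<forall>i\<in>S. 0 \<le> t i \<and> t i \<le> 1)}"

definition realization :: "'v set set \<Rightarrow> ('v \<Rightarrow> real) set" where
  "realization K = (\<Union>Q\<in>K. cube_points K Q)"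

text \<open>The weak topology: each closed cube carries its Euclidean topology, which is the one induced
  by pointwise convergence of the weights.\<close>

definition realization_topology :: "'v set set \<Rightarrow> ('v \<Rightarrow> real) topology" where
  "realization_topology K =
     topology (\<lambda>U. U \<subseteq> realization K \<and>
                   (\<forall>Q\<in>K. openin (top_of_set (cube_points K Q)) (U \<inter> cube_points K Q)))"

lemma openin_realization_topology:
  "openin (realization_topology K) U \<longleftrightarrow>
     U \<subseteq> realization K \<and>
     (\<forall>Q\<in>K. openin (top_of_set (cube_points K Q)) (U \<inter> cube_points K Q))"
proof -
  let ?O = "\<lambda>U. U \<subseteq> realization K \<and>
    (\<forall>Q\<in>K. openin (top_of_set (cube_points K Q)) (U \<inter> cube_points K Q))"
  have "?O (S \<inter> T)" if "?O S" "?O T" for S T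
  proof (intro conjI ballI)
    show "S \<inter> T \<subseteq> realization K"
      using that by blast
    fix Q
    assume "Q \<in> K"
    then have "openin (top_of_set (cube_points K Q))
                 ((S \<inter> cube_points K Q) \<inter> (T \<inter> cube_points K Q))"
      using that by (simp only: openin_Int)
    moreover have "(S \<inter> cube_points K Q) \<inter> (T \<inter> cube_points K Q) = S \<inter> T \<inter> cube_points K Q"
      by blast
    ultimately show "openin (top_of_set (cube_points K Q)) (S \<inter> T \<inter> cube_points K Q)"
      by simp
  qed
  moreover have "?O (\<Union>\<K>)" if "\<forall>U\<in>\<K>. ?O U" for \<K>
  proof (intro conjI ballI)
    show "\<Union>\<K> \<subseteq> realization K"
      using that by blast
    fix Q
    assume "Q \<in> K"
    then have "openin (top_of_set (cube_points K Q)) (\<Union>U\<in>\<K>. U \<inter> cube_points K Q)"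
      using that by (intro openin_Union) fast
    then show "openin (top_of_set (cube_points K Q)) (\<Union>\<K> \<inter> cube_points K Q)"
      by (simp only: Int_Union2)
  qed
  ultimately have "istopology ?O"
    unfolding istopology_def by meson
  then show ?thesis
    by (simp only: realization_topology_def topology_inverse')
qed

text \<open>Simplices of the link are represented by sets of edges at the vertex.\<close>

definition link :: "'v set set \<Rightarrow> 'v \<Rightarrow> 'v set set set" where
  "link K v = {{E\<in>K. card E = 2 \<and> v \<in> E \<and> E \<subseteq> Q} | Q. Q \<in> K \<and> v \<in> Q}"

definition flag :: "'e set set \<Rightarrow> bool" where
  "flag L \<longleftrightarrow>
     (\<forall>s. finite s \<and> s \<subseteq> \<Union>L \<and> (\<forall>x\<in>s. \<forall>y\<in>s. {x, y} \<in> L) \<longrightarrow> s \<in> L)"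

text \<open>
  The standard definition in the theory of cube complexes, which applies without any assumption of
  finite dimensionality: simply connected and nonpositively curved, that is, with flag vertex
  links. Links are simplicial complexes because two cubes meet in a common face.
\<close>

definition cat0_cube_complex :: "'v set set \<Rightarrow> bool" where
  "cat0_cube_complex K \<longleftrightarrow>
     cube_complex K \<and> simply_connected_space (realization_topology K) \<and>
     (\<forall>v\<in>\<Union>K. flag (link K v))"

definition midcube :: "'v set set \<Rightarrow> 'v set \<Rightarrow> ('v \<Rightarrow> real) set \<Rightarrow> bool" where
  "midcube K Q m \<longleftrightarrow>
     (\<exists>S f i. cube_chart K S f Q \<and> i \<in> S \<and>
        m = {cube_point S f t | t. (\<forall>j\<in>S. 0 \<le> t j \<and> t j \<le> 1) \<and> t i = 1/2})"

definition meets_in_midcubes :: "'v set set \<Rightarrow> ('v \<Rightarrow> real) set \<Rightarrow> bool" where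
  "meets_in_midcubes K H \<longleftrightarrow>
     H \<subseteq> realization K \<and> H \<noteq> {} \<and>
     (\<forall>Q\<in>K. H \<inter> cube_points K Q = {} \<or> midcube K Q (H \<inter> cube_points K Q))"

definition hyperplane :: "'v set set \<Rightarrow> ('v \<Rightarrow> real) set \<Rightarrow> bool" where
  "hyperplane K H \<longleftrightarrow>
     meets_in_midcubes K H \<and> (\<forall>H'. meets_in_midcubes K H' \<and> H' \<subseteq> H \<longrightarrow> H' = H)"

definition cubical_action ::
    "('g, 'm) monoid_scheme \<Rightarrow> 'v set set \<Rightarrow> ('g \<Rightarrow> 'v \<Rightarrow> 'v) \<Rightarrow> bool" where
  "cubical_action G K \<psi> \<longleftrightarrow>
     group_action G (\<Union>K) \<psi> \<and> (\<forall>g\<in>carrier G. \<forall>Q\<in>K. \<psi> g ` Q \<in> K)"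

text \<open>The extension of a vertex map to the realization, by pushing weights forward; on a cube that is
  mapped isomorphically onto a cube it is the induced isometry.\<close>

definition point_map :: "('v \<Rightarrow> 'v) \<Rightarrow> ('v \<Rightarrow> real) \<Rightarrow> 'v \<Rightarrow> real" where
  "point_map h w v = (\<Sum>u | w u \<noteq> 0 \<and> h u = v. w u)"

definition hyperplane_act ::
    "('g \<Rightarrow> 'v \<Rightarrow> 'v) \<Rightarrow> 'g \<Rightarrow> ('v \<Rightarrow> real) set \<Rightarrow> ('v \<Rightarrow> real) set" where
  "hyperplane_act \<psi> g H = point_map (\<psi> g) ` H"


section \<open>The dual cube complex\<close>

definition triples :: "'a topology \<Rightarrow> 'a division set \<Rightarrow> 'a set set" where
  "triples M \<D> = {t. t \<subseteq> topspace M - (\<Union>D\<in>\<D>. fst D) \<and> card t = 3}"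

definition halfspace :: "'a topology \<Rightarrow> 'a division set \<Rightarrow> 'a set \<Rightarrow> 'a set set" where
  "halfspace M \<D> P = {t \<in> triples M \<D>. card (t \<inter> P) \<ge> 2}"

definition wall :: "'a topology \<Rightarrow> 'a division set \<Rightarrow> 'a division \<Rightarrow> 'a set set set" where
  "wall M \<D> D = halfspace M \<D> ` snd D"

definition halfspaces :: "'a topology \<Rightarrow> 'a division set \<Rightarrow> 'a set set set" where
  "halfspaces M \<D> = (\<Union>D\<in>\<D>. wall M \<D> D)"

definition wall_ultrafilter :: "'a topology \<Rightarrow> 'a division set \<Rightarrow> 'a set set set \<Rightarrow> bool" where
  "wall_ultrafilter M \<D> \<alpha> \<longleftrightarrow>
     \<alpha> \<subseteq> halfspaces M \<D> \<and>
     (\<forall>D\<in>\<D>. \<exists>!A. A \<in> wall M \<D> D \<and> A \<in> \<alpha>) \<and>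
     (\<forall>A\<in>\<alpha>. \<forall>B\<in>halfspaces M \<D>. A \<subseteq> B \<longrightarrow> B \<in> \<alpha>)"

definition dcc :: "'b set set \<Rightarrow> bool" where
  "dcc \<alpha> \<longleftrightarrow>
     (\<forall>A :: nat \<Rightarrow> 'b set. (\<forall>i. A i \<in> \<alpha> \<and> A (Suc i) \<subseteq> A i) \<longrightarrow> (\<exists>n. \<forall>m\<ge>n. A m = A n))"

definition principal_ultrafilter ::
    "'a topology \<Rightarrow> 'a division set \<Rightarrow> 'a set \<Rightarrow> 'a set set set" where
  "principal_ultrafilter M \<D> t = {A \<in> halfspaces M \<D>. t \<in> A}"

definition Z_vertices :: "'a topology \<Rightarrow> 'a division set \<Rightarrow> 'a set set set set" where
  "Z_vertices M \<D> = {\<alpha>. wall_ultrafilter M \<D> \<alpha> \<and> dcc \<alpha>}"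

definition Z_edges :: "'a topology \<Rightarrow> 'a division set \<Rightarrow> 'a set set set set set" where
  "Z_edges M \<D> =
     {{\<alpha>, \<alpha>'} | \<alpha> \<alpha>'. \<alpha> \<in> Z_vertices M \<D> \<and> \<alpha>' \<in> Z_vertices M \<D> \<and>
        (\<exists>A\<in>\<alpha>. (\<forall>B\<in>\<alpha>. B \<subseteq> A \<longrightarrow> B = A) \<and> \<alpha>' = (\<alpha> - {A}) \<union> {triples M \<D> - A})}"

text \<open>
  Filling a graph with cubes by induction on dimension: an \<open>n\<close>-cube with \<open>n > 1\<close> is attached
  along every embedded \<open>(n-1)\<close>-skeleton, i.e. whenever its \<open>2n\<close> facets are present.
\<close>

inductive cube_map :: "'v set \<Rightarrow> 'v set set \<Rightarrow> nat set \<Rightarrow> (nat set \<Rightarrow> 'v) \<Rightarrow> bool"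
  for V E where
  vertex: "f {} \<in> V \<Longrightarrow> cube_map V E {} f"
| edge: "{f {}, f {i}} \<in> E \<Longrightarrow> cube_map V E {i} f"
| attach: "\<lbrakk>finite S; card S > 1; inj_on f (Pow S);
      \<And>i. i \<in> S \<Longrightarrow> cube_map V E (S - {i}) f;
      \<And>i. i \<in> S \<Longrightarrow> cube_map V E (S - {i}) (\<lambda>A. f (insert i A))\<rbrakk> \<Longrightarrow> cube_map V E S f"

definition Z_cubes :: "'a topology \<Rightarrow> 'a division set \<Rightarrow> 'a set set set set set" where
  "Z_cubes M \<D> = {f ` Pow S | S f. cube_map (Z_vertices M \<D>) (Z_edges M \<D>) S f}"

definition X_vertices :: "'a topology \<Rightarrow> 'a division set \<Rightarrow> 'a set set set set" where
  "X_vertices M \<D> =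
     {\<alpha> \<in> Z_vertices M \<D>. \<exists>t\<in>triples M \<D>.
        (principal_ultrafilter M \<D> t, \<alpha>) \<in> {(\<beta>, \<gamma>). {\<beta>, \<gamma>} \<in> Z_edges M \<D>}\<^sup>*}"

definition dual_complex :: "'a topology \<Rightarrow> 'a division set \<Rightarrow> 'a set set set set set" where
  "dual_complex M \<D> = {Q \<in> Z_cubes M \<D>. Q \<subseteq> X_vertices M \<D>}"

text \<open>Restricted to the vertices of the dual complex, since group actions are extensional.\<close>

definition dual_action ::
    "'a topology \<Rightarrow> 'a division set \<Rightarrow> ('g \<Rightarrow> 'a \<Rightarrow> 'a) \<Rightarrow> 'g \<Rightarrow> 'a set set set \<Rightarrow> 'a set set set" where
  "dual_action M \<D> \<phi> g = restrict (\<lambda>\<alpha>. (\<lambda>A. (`) (\<phi> g) ` A) ` \<alpha>) (\<Union>(dual_complex M \<D>))"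

end

(*
  Fix a triple t0 and let I be the family of halfspaces not containing it. A vertex of the dual complex
  is determined by the members of I that belong to it, and the sets so obtained are exactly the finite
  subfamilies of I that are upward closed and pairwise intersecting; these conditions involve two members
  at a time. In the resulting coordinates the complex is the set of all y : I -> [0,1] of finite support
  such that a < b implies y a = 0 or y b = 1, and disjoint a, b satisfy y a = 0 or y b = 0. Pairwise
  conditions make links flag, and scaling the coordinates down, smaller halfspaces first, is a contraction.
  The hyperplanes are the sets y a = 1/2.

  The topology of M enters in two places. By the Baire property every open set contains infinitely many
  points off the cut sets, so a division is recovered from its wall. If infinitely many walls separated two
  triples, two paths between them, the second avoiding a limit point of the cut sets on the first, would
  give two limit points of the cut sets.
*)

theory Submission
  imports Defs
begin

section \<open>Contractible spaces and the weak topology\<close>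

text \<open>Nothing bounds the dimension of the complex or makes it locally finite. Hence pointwise
  convergence of weights cannot simply replace its weak topology, and continuity is tested cube by
  cube, on a product with \<open>[0,1]\<close> through a quotient map. For the same reason the
  contraction has no bounded number of stages: a coordinate moves at a time depending only on the
  number of halfspaces of \<open>I\<close> above it, which is finite since finitely many walls
  separate two triples. A cube is then carried into finitely many cubes.

  A cube admits many charts. Before coordinates can be used, it is shown that a chart can only
  permute and reverse directions; this rests on opposite edges of an embedded square crossing the
  same wall.

  The base triple need not be fixed by the group. Equivariance is therefore expressed by
  ultrafilters and by the total weight of the vertices containing a halfspace, which makes sense on
  both sides of the base. Passing to the complement preserves the value 1/2, so a hyperplane belongs
  to a wall and not to one of its halfspaces.\<close>

lemma homotopic_with_rel_endpoints:
  fixes h :: "real \<times> 'a \<Rightarrow> 'a" and p q :: "real \<times> real \<Rightarrow> real"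
  assumes h: "continuous_map (prod_topology (top_of_set {0..1}) X) X h"
    and pq: "continuous_on ({0..1} \<times> {0..1}) p" "p ` ({0..1} \<times> {0..1}) \<subseteq> {0..1}"
      "continuous_on ({0..1} \<times> {0..1}) q" "q ` ({0..1} \<times> {0..1}) \<subseteq> {0..1}"
    and c: "pathin X c"
    and f: "\<And>s. s \<in> {0..1} \<Longrightarrow> f s = h (p (0, s), c (q (0, s)))"
    and g: "\<And>s. s \<in> {0..1} \<Longrightarrow> g s = h (p (1, s), c (q (1, s)))"
    and ends: "\<And>t. t \<in> {0..1} \<Longrightarrow> h (p (t, 0), c (q (t, 0))) = y"
      "\<And>t. t \<in> {0..1} \<Longrightarrow> h (p (t, 1), c (q (t, 1))) = y"
  shows "homotopic_with (\<lambda>r. r 0 = y \<and> r 1 = y) (top_of_set {0..1::real}) X f g"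
proof -
  let ?J = "top_of_set {0..1::real}"
  \<comment> \<open>Here \<open>p\<close> is the time spent in the contraction and \<open>q\<close>
    the position on the loop. Both homotopies of the next lemma have this shape, with different
    schedules.\<close>
  let ?k = "\<lambda>z. h (p z, c (q z))"
  have J: "prod_topology ?J ?J = top_of_set ({0..1} \<times> {0..1})"
    by (metis prod_topology_subtopology_eu)
  have "continuous_map (prod_topology ?J ?J) ?J p" "continuous_map (prod_topology ?J ?J) ?J q"
    using pq by (auto simp: J)
  then have "continuous_map (prod_topology ?J ?J) (prod_topology ?J X) (\<lambda>z. (p z, c (q z)))"
    using c unfolding pathin_def
    by (intro continuous_map_pairedI continuous_map_compose[of _ ?J q X c, unfolded o_def]) auto
  then have k: "continuous_map (prod_topology ?J ?J) X ?k"
    using continuous_map_compose[OF _ h] by (auto simp: o_def)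
  have "homotopic_with (\<lambda>r. r 0 = y \<and> r 1 = y) ?J X (\<lambda>s. ?k (0, s)) (\<lambda>s. ?k (1, s))"
    unfolding homotopic_with_def
    by (rule exI[of _ ?k]) (use k ends in auto)
  then show ?thesis
    by (rule homotopic_with_eq) (use f g in auto)
qed

text \<open>A free contraction moves the base point. The first homotopy slides the loop up the contraction
  while running along the track of the base point at both ends; after time \<open>1\<close> only the track
  remains, and it is retracted.\<close>

lemma simply_connected_space_of_contraction:
  fixes h :: "real \<times> 'a \<Rightarrow> 'a"
  assumes x0: "x0 \<in> topspace X"
    and h: "continuous_map (prod_topology (top_of_set {0..1}) X) X h"
    and h0: "\<And>x. x \<in> topspace X \<Longrightarrow> h (0, x) = x"
    and h1: "\<And>x. x \<in> topspace X \<Longrightarrow> h (1, x) = x0"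
  shows "simply_connected_space X"
proof -
  have track: "pathin X (\<lambda>t. h (t, x))" if "x \<in> topspace X" for x
    unfolding pathin_def
    by (rule continuous_map_compose[OF _ h, unfolded o_def])
      (use that in \<open>auto intro!: continuous_map_pairedI\<close>)
  have "path_component_of X x x0" if "x \<in> topspace X" for x
    unfolding path_component_of_def
    by (rule exI[of _ "\<lambda>t. h (t, x)"]) (use that track h0 h1 in auto)
  then have "path_connected_space X"
    by (metis path_component_of_sym path_component_of_trans path_connected_space_iff_path_component)
  moreover have "homotopic_with (\<lambda>r. r 0 = c 0 \<and> r 1 = c 0) (top_of_set {0..1}) X c (\<lambda>_. c 0)"
    if c: "pathin X c" and loop: "c 1 = c 0" for c
  proof -
    have cX: "c s \<in> topspace X" if "s \<in> {0..1}" for s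
      using c that path_image_subset_topspace by fastforce
    \<comment> \<open>The track of the base point, run upwards on the first third, resting at its
      end on the middle third and run back on the last third.\<close>
    let ?m = "\<lambda>s::real. min 1 (min (3 * s) (3 - 3 * s))"
    \<comment> \<open>At time \<open>t\<close> the loop has height \<open>t\<close> and is squeezed
      into the interval from \<open>t/3\<close> to \<open>1 - t/3\<close>; the two outer pieces join
      it to the base point along the track. Clamping \<open>?q\<close> holds the loop at its end
      points on these pieces.\<close>
    let ?p = "\<lambda>(t, s). min t (min (3 * s) (3 - 3 * s)) :: real"
    let ?q = "\<lambda>(t, s). min 1 (max 0 ((s - t/3) / (1 - 2*t/3))) :: real"
    have "homotopic_with (\<lambda>r. r 0 = c 0 \<and> r 1 = c 0) (top_of_set {0..1}) X
        c (\<lambda>s. h (?m s, c 0))"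
    proof (rule homotopic_with_rel_endpoints[OF h, of ?p ?q c])
      show "continuous_on ({0..1} \<times> {0..1}) ?p"
        by (auto simp: case_prod_unfold intro!: continuous_intros)
      show "continuous_on ({0..1} \<times> {0..1}) ?q"
        by (auto simp: case_prod_unfold intro!: continuous_intros)
      show "h (?m s, c 0) = h (?p (1, s), c (?q (1, s)))" if s: "s \<in> {0..1}" for s
      proof -
        consider "s \<le> 1/3" | "1/3 \<le> s" "s \<le> 2/3" | "2/3 \<le> s"
          by linarith
        then show ?thesis
        proof cases
          case 2
          then have "?m s = 1" by auto
          moreover have "?q (1, s) \<in> {0..1}" by auto
          ultimately show ?thesis
            using h1 cX[of 0] cX[of "?q (1, s)"] by simp
        qed (use loop in auto)
      qed
      show "h (?p (t, 0), c (?q (t, 0))) = c 0" "h (?p (t, 1), c (?q (t, 1))) = c 0"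
        if "t \<in> {0..1}" for t
        using that loop h0 cX[of 0] by (auto simp: field_simps min_def max_def)
      show "c s = h (?p (0, s), c (?q (0, s)))" if "s \<in> {0..1}" for s
        using that h0 cX[of s] by (auto simp: min_def)
    qed (use c in auto)
    moreover have "homotopic_with (\<lambda>r. r 0 = c 0 \<and> r 1 = c 0) (top_of_set {0..1}) X
        (\<lambda>s. h (?m s, c 0)) (\<lambda>_. c 0)"
    proof (rule homotopic_with_rel_endpoints[OF h, of "\<lambda>(t, s). (1 - t) * ?m s" "\<lambda>_. 0" c])
      show "continuous_on ({0..1} \<times> {0..1}) (\<lambda>(t, s). (1 - t) * ?m s)"
        by (auto simp: case_prod_unfold intro!: continuous_intros)
      show "(\<lambda>(t, s). (1 - t) * ?m s) ` ({0..1} \<times> {0..1}) \<subseteq> {0..1}"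
        by (auto intro!: mult_le_one)
    qed (use c h0 cX[of 0] in auto)
    ultimately show ?thesis
      by (rule homotopic_with_trans)
  qed
  ultimately show ?thesis
    unfolding simply_connected_space_def using x0 by blast
qed

section \<open>The weak topology of a cube complex\<close>

lemma compact_imp_closed_fun:
  fixes S :: "('v \<Rightarrow> 'a::t2_space) set"
  assumes "compact S"
  shows "closed S"
proof -
  have "Hausdorff_space (euclidean :: ('v \<Rightarrow> 'a) topology)"
    unfolding euclidean_product_topology[symmetric]
    by (simp only: Hausdorff_space_product_topology)
      (auto simp: Hausdorff_space_def disjnt_def dest!: hausdorff)
  then show ?thesis
    using assms compactin_imp_closedin[of euclidean S] by simp
qed

lemma topspace_realization_topology [simp]: "topspace (realization_topology K) = realization K"
proof -
  have "realization K \<inter> cube_points K Q = cube_points K Q" if "Q \<in> K" for Q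
    using that by (auto simp: realization_def)
  then have "openin (realization_topology K) (realization K)"
    by (auto simp: openin_realization_topology)
  then show ?thesis
    by (meson openin_realization_topology openin_subset openin_topspace subset_antisym)
qed

lemma closedin_realization_topology:
  assumes "C \<subseteq> realization K"
  shows "closedin (realization_topology K) C \<longleftrightarrow>
    (\<forall>Q\<in>K. closedin (top_of_set (cube_points K Q)) (C \<inter> cube_points K Q))"
proof -
  have "cube_points K Q - C \<inter> cube_points K Q = (realization K - C) \<inter> cube_points K Q" if "Q \<in> K" for Q
    using that by (auto simp: realization_def)
  then show ?thesis
    using assms by (auto simp: closedin_def openin_realization_topology)
qed

text \<open>A weakly closed set meets each of the finitely many compact cubes in a closed set, and
  the union of these is closed. For such a map the weak topology therefore tests no more than
  pointwise convergence does.\<close>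

lemma continuous_map_into_realization:
  assumes K: "finite \<F>" "\<F> \<subseteq> K" "\<And>Q. Q \<in> K \<Longrightarrow> compact (cube_points K Q)"
    and g: "continuous_map X euclidean g" "g ` topspace X \<subseteq> (\<Union>Q\<in>\<F>. cube_points K Q)"
  shows "continuous_map X (realization_topology K) g"
  unfolding continuous_map_closedin
proof (intro conjI ballI allI impI)
  show "g \<in> topspace X \<rightarrow> topspace (realization_topology K)"
    using g(2) K(2) by (fastforce simp: realization_def)
  show "closedin X {x \<in> topspace X. g x \<in> C}" if C: "closedin (realization_topology K) C" for C
  proof -
    have "closed (C \<inter> cube_points K Q)" if "Q \<in> \<F>" for Q
    proof -
      have "closedin (top_of_set (cube_points K Q)) (C \<inter> cube_points K Q)"
        using C closedin_subset[OF C] that K(2) by (auto simp: closedin_realization_topology)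
      moreover have "closed (cube_points K Q)"
        using K that by (auto intro: compact_imp_closed_fun)
      ultimately show ?thesis
        using closedin_closed_trans by blast
    qed
    then have "closed (\<Union>Q\<in>\<F>. C \<inter> cube_points K Q)"
      using K(1) by blast
    moreover have "{x \<in> topspace X. g x \<in> C} = {x \<in> topspace X. g x \<in> (\<Union>Q\<in>\<F>. C \<inter> cube_points K Q)}"
      using g(2) by auto
    ultimately show ?thesis
      using g(1) unfolding continuous_map_closedin by (simp only: closed_closedin)
  qed
qed

lemma quotient_map_realization:
  "quotient_map (sum_topology (\<lambda>Q. top_of_set (cube_points K Q)) K) (realization_topology K) snd"
  unfolding quotient_map_def
proof (intro conjI allI impI)
  show "snd ` topspace (sum_topology (\<lambda>Q. top_of_set (cube_points K Q)) K) = topspace (realization_topology K)"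
    by (force simp: realization_def)
  fix U
  assume U: "U \<subseteq> topspace (realization_topology K)"
  have "{x. (Q, x) \<in> topspace (sum_topology (\<lambda>Q. top_of_set (cube_points K Q)) K) \<and> x \<in> U}
      = U \<inter> cube_points K Q" if "Q \<in> K" for Q
    using that by auto
  then show "openin (sum_topology (\<lambda>Q. top_of_set (cube_points K Q)) K)
        {x \<in> topspace (sum_topology (\<lambda>Q. top_of_set (cube_points K Q)) K). snd x \<in> U} =
      openin (realization_topology K) U"
    using U by (auto simp: openin_sum_topology openin_realization_topology)
qed

text \<open>A homotopy may be checked over each cube separately, because the product of a quotient
  map with a locally compact Hausdorff space is again a quotient map.\<close>

lemma continuous_map_prod_realization:
  assumes Z: "locally_compact_space Z" "Hausdorff_space Z"
    and g: "\<And>Q. Q \<in> K \<Longrightarrow> continuous_map (prod_topology Z (top_of_set (cube_points K Q))) Y g"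
  shows "continuous_map (prod_topology Z (realization_topology K)) Y g"
proof -
  let ?S = "sum_topology (\<lambda>Q. top_of_set (cube_points K Q)) K"
  let ?r = "\<lambda>(z, w). (z, snd w)"
  have q: "quotient_map (prod_topology Z ?S) (prod_topology Z (realization_topology K)) ?r"
    by (rule quotient_map_prod_right) (use Z quotient_map_realization in auto)
  have "continuous_map (prod_topology Z ?S) Y (g \<circ> ?r)"
    unfolding continuous_map_def
  proof (intro conjI allI impI funcsetI)
    show "(g \<circ> ?r) x \<in> topspace Y" if "x \<in> topspace (prod_topology Z ?S)" for x
      using that continuous_map_funspace[OF g] by (fastforce simp: Pi_iff)
    fix U
    assume U: "openin Y U"
    show "openin (prod_topology Z ?S) {x \<in> topspace (prod_topology Z ?S). (g \<circ> ?r) x \<in> U}"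
    proof (subst openin_prod_topology_alt, intro allI impI)
      fix z w
      assume zw: "(z, w) \<in> {x \<in> topspace (prod_topology Z ?S). (g \<circ> ?r) x \<in> U}"
      then obtain Q u where w: "w = (Q, u)" "Q \<in> K" "u \<in> cube_points K Q" "z \<in> topspace Z" "g (z, u) \<in> U"
        by auto
      have "openin (prod_topology Z (top_of_set (cube_points K Q)))
          {x \<in> topspace (prod_topology Z (top_of_set (cube_points K Q))). g x \<in> U}"
        using openin_continuous_map_preimage[OF g[OF w(2)] U] .
      from this[unfolded openin_prod_topology_alt, rule_format, of z u]
      obtain A B where AB: "openin Z A" "openin (top_of_set (cube_points K Q)) B" "z \<in> A" "u \<in> B"
        "A \<times> B \<subseteq> {x \<in> topspace (prod_topology Z (top_of_set (cube_points K Q))). g x \<in> U}"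
        using w by auto
      \<comment> \<open>The summands are open in the sum, so a box over one cube is already a box in
        the product with the sum.\<close>
      have "openin ?S (Pair Q ` B)"
        using open_map_component_injection[OF w(2), of "\<lambda>Q. top_of_set (cube_points K Q)"] AB(2)
        unfolding open_map_def by blast
      moreover have "A \<times> Pair Q ` B \<subseteq> {x \<in> topspace (prod_topology Z ?S). (g \<circ> ?r) x \<in> U}"
        using AB(5) w(2) by auto
      ultimately show "\<exists>A B. openin Z A \<and> openin ?S B \<and> z \<in> A \<and> w \<in> B \<and>
          A \<times> B \<subseteq> {x \<in> topspace (prod_topology Z ?S). (g \<circ> ?r) x \<in> U}"
        using AB w(1) by blast
    qed
  qed
  then show ?thesis
    using continuous_compose_quotient_map[OF q] by blast
qed

section \<open>Cubes of finite sets\<close>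

lemma sym_diff_insert: "a \<notin> B \<Longrightarrow> sym_diff X (insert a B) = sym_diff (sym_diff X B) {a}"
  by blast

text \<open>The two routes across a square flip the same set of elements: \<open>{c, a}\<close> has
  two elements, so it equals \<open>{d, b}\<close>, and \<open>c\<close> is not
  \<open>d\<close>.\<close>

lemma sym_diff_square:
  assumes "a \<noteq> c" and eq: "sym_diff (sym_diff X {c}) {a} = sym_diff (sym_diff X {d}) {b}" and "c \<noteq> d"
  shows "a = d"
proof -
  have "(x = c) \<noteq> (x = a) \<longleftrightarrow> (x = d) \<noteq> (x = b)" for x
    using eq[THEN eqset_imp_iff, of x] by auto
  from this[of a] this[of c] show ?thesis
    using assms(1,3) by metis
qed

text \<open>Opposite edges of an embedded square flip the same element.\<close>

lemma cube_rigid: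
  fixes f :: "'i set \<Rightarrow> 'h set"
  assumes S: "finite S" and inj: "inj_on f (Pow S)"
    and edge: "\<And>A i. A \<subseteq> S \<Longrightarrow> i \<in> S - A \<Longrightarrow> \<exists>a. f (insert i A) = sym_diff (f A) {a}"
  obtains e where "inj_on e S" "\<And>A. A \<subseteq> S \<Longrightarrow> f A = sym_diff (f {}) (e ` A)"
proof -
  have "\<forall>i\<in>S. \<exists>a. f {i} = sym_diff (f {}) {a}"
    using edge[of "{}"] by auto
  then obtain e where e: "\<And>i. i \<in> S \<Longrightarrow> f {i} = sym_diff (f {}) {e i}"
    by metis
  have inj_e: "inj_on e S"
  proof (rule inj_onI)
    fix i j
    assume ij: "i \<in> S" "j \<in> S" "e i = e j"
    then have "f {i} = f {j}"
      using e by metis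
    then show "i = j"
      using inj_onD[OF inj, of "{i}" "{j}"] ij by simp
  qed
  have "f A = sym_diff (f {}) (e ` A)" if "A \<subseteq> S" for A
    using finite_subset[OF that S] that
  proof (induction A rule: finite_psubset_induct)
    case (psubset A)
    show ?case
    proof (cases "\<exists>i\<in>A. \<exists>j\<in>A. i \<noteq> j")
      case True
      then obtain i j where ij: "i \<in> A" "j \<in> A" "i \<noteq> j" by blast
      \<comment> \<open>The set \<open>?B\<close>, its extensions by \<open>i\<close> and by
        \<open>j\<close>, and \<open>A\<close> form a square whose top is the only corner not
        covered by the induction hypothesis.\<close>
      let ?B = "A - {i, j}"
      have S': "?B \<subseteq> S" "insert i ?B \<subseteq> S" "insert j ?B \<subseteq> S" "i \<in> S" "j \<in> S"
        using psubset.prems ij by auto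
      have A: "insert j (insert i ?B) = A" "insert i (insert j ?B) = A"
        using ij by auto
      have notin: "e i \<notin> e ` ?B" "e j \<notin> e ` ?B" "e i \<noteq> e j"
        using S' ij inj_on_eq_iff[OF inj_e] inj_on_image_mem_iff[OF inj_e] by simp_all
      have B: "f ?B = sym_diff (f {}) (e ` ?B)"
        by (rule psubset.IH) (use ij S' in auto)
      have "f (insert i ?B) = sym_diff (f {}) (e ` insert i ?B)"
        by (rule psubset.IH) (use ij S' in auto)
      also have "\<dots> = sym_diff (f ?B) {e i}"
        unfolding B image_insert by (rule sym_diff_insert[OF notin(1)])
      finally have Bi: "f (insert i ?B) = sym_diff (f ?B) {e i}" .
      have "f (insert j ?B) = sym_diff (f {}) (e ` insert j ?B)"
        by (rule psubset.IH) (use ij S' in auto)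
      also have "\<dots> = sym_diff (f ?B) {e j}"
        unfolding B image_insert by (rule sym_diff_insert[OF notin(2)])
      finally have Bj: "f (insert j ?B) = sym_diff (f ?B) {e j}" .
      obtain a where a: "f A = sym_diff (f (insert i ?B)) {a}"
        using edge[of "insert i ?B" j] S' ij unfolding A by auto
      obtain b where b: "f A = sym_diff (f (insert j ?B)) {b}"
        using edge[of "insert j ?B" i] S' ij unfolding A by auto
      \<comment> \<open>Injectivity forbids the second step along the square to undo the first
        one.\<close>
      have "f A \<noteq> f ?B"
        using inj_onD[OF inj, of A ?B] psubset.prems S' ij by auto
      then have "a \<noteq> e i"
        using a Bi by auto
      moreover have "sym_diff (sym_diff (f ?B) {e i}) {a} = sym_diff (sym_diff (f ?B) {e j}) {b}"
        using a b Bi Bj by simp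
      ultimately have "a = e j"
        using notin(3) by (rule sym_diff_square)
      have "e j \<notin> insert (e i) (e ` ?B)"
        using notin by simp
      moreover have "e ` A = insert (e j) (insert (e i) (e ` ?B))"
        using ij by auto
      ultimately show ?thesis
        unfolding a Bi B \<open>a = e j\<close> by (simp only: sym_diff_insert notin(1) not_False_eq_True)
    next
      case False
      then consider "A = {}" | i where "A = {i}" by auto
      then show ?thesis
        using e psubset.prems by cases auto
    qed
  qed
  then show ?thesis
    using inj_e that by blast
qed

text \<open>The inductive attachment produces exactly the embedded hypercube graphs: once there are
  two directions, every edge of the cube lies in some facet. The absence of loops makes the
  one-dimensional cubes embedded.\<close>

lemma cube_map_iff:
  assumes loop_free: "\<And>x. {x, x} \<notin> E" and E: "\<Union>E \<subseteq> V"
  shows "cube_map V E S f \<longleftrightarrow> finite S \<and> inj_on f (Pow S) \<and> f {} \<in> V \<and>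
    (\<forall>A i. A \<subseteq> S \<and> i \<in> S - A \<longrightarrow> {f A, f (insert i A)} \<in> E)"
    (is "_ \<longleftrightarrow> ?rhs S f")
proof
  show "?rhs S f" if "cube_map V E S f"
    using that
  proof (induction rule: cube_map.induct)
    case (vertex f)
    then show ?case by simp
  next
    case (edge f i)
    have "A \<subseteq> {i} \<and> j \<in> {i} - A \<longleftrightarrow> A = {} \<and> j = i" for A j
      by auto
    moreover have "f {} \<noteq> f {i}"
      using edge loop_free by metis
    ultimately show ?case
      using edge E by (auto simp: Pow_insert inj_on_def)
  next
    case (attach S f)
    have ex: "\<exists>j\<in>S. j \<noteq> i" for i
      using attach(1,2) by (metis card_le_Suc0_iff_eq not_less One_nat_def)
    have "{f A, f (insert i A)} \<in> E" if A: "A \<subseteq> S" "i \<in> S - A" for A i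
    proof -
      \<comment> \<open>The edge in direction \<open>i\<close> lies in one of the two facets
        orthogonal to \<open>j\<close>, according to whether \<open>A\<close> contains
        \<open>j\<close>.\<close>
      obtain j where j: "j \<in> S" "j \<noteq> i"
        using ex by blast
      show ?thesis
      proof (cases "j \<in> A")
        case True
        then have "{f (insert j (A - {j})), f (insert j (insert i (A - {j})))} \<in> E"
          using attach.IH(2)[OF j(1)] A j
          by (elim conjE allE[of _ "A - {j}"] allE[of _ i]) auto
        moreover have "insert j (A - {j}) = A" "insert j (insert i (A - {j})) = insert i A"
          using True by auto
        ultimately show ?thesis by simp
      next
        case False
        then show ?thesis
          using attach.IH(1)[OF j(1)] A j by auto
      qed
    qed
    moreover obtain j where "j \<in> S"
      using ex by blast
    ultimately show ?case
      using attach by blast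
  qed
next
  assume "?rhs S f"
  then show "cube_map V E S f"
  proof (induction "card S" arbitrary: S f rule: less_induct)
    case less
    have f: "finite S" "inj_on f (Pow S)" "f {} \<in> V"
      "\<And>A i. A \<subseteq> S \<Longrightarrow> i \<in> S - A \<Longrightarrow> {f A, f (insert i A)} \<in> E"
      using less.prems by auto
    consider "S = {}" | i where "S = {i}" | "card S > 1"
      using f(1) by (metis One_nat_def card_1_singletonE card_eq_0_iff less_one linorder_neqE_nat)
    then show ?case
    proof cases
      case 3
      show ?thesis
      proof (rule cube_map.attach)
        fix i
        assume i: "i \<in> S"
        have card: "card (S - {i}) < card S"
          using i f(1) by (meson card_Diff1_less)
        have "inj_on f (Pow (S - {i}))"
          by (rule inj_on_subset[OF f(2)]) auto
        then show "cube_map V E (S - {i}) f"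
          using f card by (intro less.hyps) auto
        have "inj_on (\<lambda>A. f (insert i A)) (Pow (S - {i}))"
        proof (rule inj_onI)
          fix A B
          assume AB: "A \<in> Pow (S - {i})" "B \<in> Pow (S - {i})" "f (insert i A) = f (insert i B)"
          then have "insert i A = insert i B"
            using i by (intro inj_onD[OF f(2)]) auto
          then show "A = B"
            using AB by auto
        qed
        moreover have "{f (insert i A), f (insert i (insert j A))} \<in> E" if "A \<subseteq> S - {i}" "j \<in> S - {i} - A" for A j
          using f(4)[of "insert i A" j] that i by (auto simp: insert_commute)
        moreover have "f {i} \<in> V"
          using f(4)[of "{}" i] i E by auto
        ultimately show "cube_map V E (S - {i}) (\<lambda>A. f (insert i A))"
          using f card by (intro less.hyps) auto
      qed (use f 3 in auto)
    qed (use f in \<open>auto intro: cube_map.intros\<close>)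
  qed
qed

section \<open>Complexes of finite consistent families\<close>

text \<open>An ultrafilter recorded by its members missing a base point. Upward closure between
  halfspaces on opposite sides of the base point becomes the condition that members meet:
  \<open>a\<close> is disjoint from \<open>b\<close> when it lies in the complement of
  \<open>b\<close>.\<close>

definition consistent_families :: "'b set set \<Rightarrow> 'b set set set" where
  "consistent_families I =
     {\<sigma>. finite \<sigma> \<and> \<sigma> \<subseteq> I \<and> (\<forall>a\<in>\<sigma>. \<forall>b\<in>I. a \<subseteq> b \<longrightarrow> b \<in> \<sigma>) \<and> (\<forall>a\<in>\<sigma>. \<forall>b\<in>\<sigma>. a \<inter> b \<noteq> {})}"

lemma consistent_families_iff:
  "\<sigma> \<in> consistent_families I \<longleftrightarrow>
     finite \<sigma> \<and> \<sigma> \<subseteq> I \<and> (\<forall>a\<in>\<sigma>. \<forall>b\<in>I. a \<subseteq> b \<longrightarrow> b \<in> \<sigma>) \<and> (\<forall>a\<in>\<sigma>. \<forall>b\<in>\<sigma>. a \<inter> b \<noteq> {})"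
  unfolding consistent_families_def mem_Collect_eq ..

lemma consistent_familiesD:
  assumes "\<sigma> \<in> consistent_families I"
  shows "finite \<sigma>" "a \<in> \<sigma> \<Longrightarrow> a \<in> I" "a \<in> \<sigma> \<Longrightarrow> b \<in> I \<Longrightarrow> a \<subseteq> b \<Longrightarrow> b \<in> \<sigma>"
    "a \<in> \<sigma> \<Longrightarrow> b \<in> \<sigma> \<Longrightarrow> a \<inter> b \<noteq> {}"
proof -
  note * = assms[unfolded consistent_families_iff]
  show "finite \<sigma>" "a \<in> \<sigma> \<Longrightarrow> a \<in> I"
    using * by blast+
  show "b \<in> \<sigma>" if "a \<in> \<sigma>" "b \<in> I" "a \<subseteq> b"
    using *[THEN conjunct2, THEN conjunct2, THEN conjunct1, rule_format, OF that] .
  show "a \<inter> b \<noteq> {}" if "a \<in> \<sigma>" "b \<in> \<sigma>"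
    using *[THEN conjunct2, THEN conjunct2, THEN conjunct2, THEN bspec, THEN bspec, OF that] .
qed

lemma consistent_familiesI:
  assumes "finite \<sigma>" "\<And>a. a \<in> \<sigma> \<Longrightarrow> a \<in> I" "\<And>a b. a \<in> \<sigma> \<Longrightarrow> b \<in> I \<Longrightarrow> a \<subseteq> b \<Longrightarrow> b \<in> \<sigma>"
    "\<And>a b. a \<in> \<sigma> \<Longrightarrow> b \<in> \<sigma> \<Longrightarrow> a \<inter> b \<noteq> {}"
  shows "\<sigma> \<in> consistent_families I"
  unfolding consistent_families_iff
  by (intro conjI ballI impI subsetI assms(1)) (fact assms(2-4))+

text \<open>All conditions on a consistent family involve at most two members.\<close>

lemma consistent_families_pairwise:
  assumes "finite \<tau>" and ex: "\<And>a b. \<exists>\<sigma>\<in>consistent_families I. \<sigma> \<inter> {a, b} = \<tau> \<inter> {a, b}"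
  shows "\<tau> \<in> consistent_families I"
proof (rule consistent_familiesI)
  fix a b
  obtain \<sigma> where \<sigma>: "\<sigma> \<in> consistent_families I" "\<sigma> \<inter> {a, b} = \<tau> \<inter> {a, b}"
    using ex[of a b] by (elim bexE)
  have a: "a \<in> \<sigma> \<longleftrightarrow> a \<in> \<tau>" and b: "b \<in> \<sigma> \<longleftrightarrow> b \<in> \<tau>"
    using \<sigma>(2) by blast+
  note \<sigma> = consistent_familiesD[OF \<sigma>(1), unfolded a b]
  show "a \<in> I" if "a \<in> \<tau>"
    using \<sigma>(2)[of a] a that by simp
  show "b \<in> \<tau>" if "a \<in> \<tau>" "b \<in> I" "a \<subseteq> b"
    using \<sigma>(3)[of a b] a b that by simp
  show "a \<inter> b \<noteq> {}" if "a \<in> \<tau>" "b \<in> \<tau>"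
    using \<sigma>(4)[of a b] a b that by simp
qed fact

text \<open>Only upward closure could fail, and it fails only if a member strictly below
  \<open>b\<close> stays behind. Families are dismantled by this step, one minimal member at a
  time.\<close>

lemma consistent_families_remove:
  assumes \<tau>: "\<tau> \<in> consistent_families I" and minimal: "\<And>c. c \<in> \<tau> \<Longrightarrow> \<not> c \<subset> b"
  shows "\<tau> - {b} \<in> consistent_families I"
proof (rule consistent_familiesI)
  fix a c
  assume a: "a \<in> \<tau> - {b}"
  then show "a \<in> I"
    using consistent_familiesD(2)[OF \<tau>] by simp
  show "c \<in> \<tau> - {b}" if "c \<in> I" "a \<subseteq> c"
    using consistent_familiesD(3)[OF \<tau>, of a c] minimal[of a] a that by auto
  show "a \<inter> c \<noteq> {}" if "c \<in> \<tau> - {b}"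
    using consistent_familiesD(4)[OF \<tau>, of a c] a that by simp
qed (use consistent_familiesD(1)[OF \<tau>] in simp)

lemma interval_insert: "{A..insert a A} = {A, insert a A}"
proof (intro subset_antisym subsetI)
  fix X
  assume X: "X \<in> {A..insert a A}"
  show "X \<in> {A, insert a A}"
  proof (cases "a \<in> X")
    case True
    then have "X = insert a A"
      using X by auto
    then show ?thesis by simp
  next
    case False
    then have "X = A"
      using X by auto
    then show ?thesis by simp
  qed
qed auto

text \<open>For any \<open>a\<close> in \<open>U - L\<close> the set \<open>insert a L\<close> lies
  in the interval and differs from \<open>L\<close>, so it must be \<open>U\<close>. Thus an edge of
  the complex flips exactly one member.\<close>

lemma interval_two_elements:
  assumes "{L..U} = {p, q}" "p \<noteq> q" "L \<subseteq> (U :: 'h set)"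
  obtains a where "a \<notin> L" "U = insert a L" "q = sym_diff p {a}"
proof -
  have pq: "r = p \<or> r = q" if "L \<subseteq> r" "r \<subseteq> U" for r
    using that assms(1) by (metis atLeastAtMost_iff insertE singletonD)
  have p: "L \<subseteq> p" "p \<subseteq> U" and q: "L \<subseteq> q" "q \<subseteq> U"
    using assms(1) by (metis atLeastAtMost_iff insertI1 insertI2)+
  have "L \<noteq> U"
    using p q assms(2) by (metis subset_antisym)
  then obtain a where a: "a \<in> U" "a \<notin> L"
    using assms(3) by blast
  have L: "L = p \<or> L = q" and U: "U = p \<or> U = q"
    using pq assms(3) by blast+
  have "insert a L = p \<or> insert a L = q"
    using pq[OF subset_insertI, of a] a(1) assms(3) by simp
  moreover have "insert a L \<noteq> L"
    using a(2) by (metis insertI1)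
  ultimately have iL: "U = insert a L"
    using L U \<open>L \<noteq> U\<close> by metis
  have "p = L \<and> q = insert a L \<or> p = insert a L \<and> q = L"
    using L U \<open>L \<noteq> U\<close> iL assms(2) by metis
  moreover have "insert a L = sym_diff L {a}" "L = sym_diff (insert a L) {a}"
    using a(2) by blast+
  ultimately have "q = sym_diff p {a}"
    by metis
  then show ?thesis
    by (rule that[OF a(2) iL])
qed

text \<open>The vertices stay abstract, with \<open>s\<close> reading off their families, so that
  the results apply directly to a complex whose vertices are ultrafilters. The assumption
  \<open>finite_above\<close> makes the smallest family containing \<open>a\<close> finite and
  supplies the time schedule of the contraction.\<close>

locale family_complex =
  fixes I :: "'b set set" and V :: "'v set" and s :: "'v \<Rightarrow> 'b set set"
  assumes nonempty: "{} \<notin> I"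
    and finite_above: "a \<in> I \<Longrightarrow> finite {b \<in> I. a \<subseteq> b}"
    and bij: "bij_betw s V (consistent_families I)"
begin

section \<open>Cubes as intervals of consistent families\<close>

definition spans :: "'b set set \<Rightarrow> 'b set set \<Rightarrow> bool" where
  "spans L U \<longleftrightarrow> L \<subseteq> U \<and> {L..U} \<subseteq> consistent_families I"

definition cell :: "'b set set \<Rightarrow> 'b set set \<Rightarrow> 'v set" where
  "cell L U = {x \<in> V. L \<subseteq> s x \<and> s x \<subseteq> U}"

definition cells :: "'v set set" where
  "cells = {cell L U | L U. spans L U}"

abbreviation vertex :: "'b set set \<Rightarrow> 'v" where
  "vertex \<equiv> the_inv_into V s"

lemma inj_s: "inj_on s V"
  using bij by (simp add: bij_betw_def)

lemma vertex: "\<sigma> \<in> consistent_families I \<Longrightarrow> vertex \<sigma> \<in> V" "\<sigma> \<in> consistent_families I \<Longrightarrow> s (vertex \<sigma>) = \<sigma>"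
  using bij the_inv_into_into[OF inj_s _ order_refl] f_the_inv_into_f[OF inj_s]
  by (simp_all add: bij_betw_def)

lemma s_in: "x \<in> V \<Longrightarrow> s x \<in> consistent_families I"
  using bij by (auto simp: bij_betw_def)

lemma finite_s: "x \<in> V \<Longrightarrow> finite (s x)"
  using s_in consistent_familiesD(1) by blast

lemma s_cell: "spans L U \<Longrightarrow> s ` cell L U = {L..U}"
proof (intro subset_antisym subsetI)
  fix \<tau>
  assume span: "spans L U" and \<tau>: "\<tau> \<in> {L..U}"
  then have "\<tau> \<in> consistent_families I"
    unfolding spans_def by blast
  then show "\<tau> \<in> s ` cell L U"
    using vertex[of \<tau>] \<tau> by (intro image_eqI[of _ _ "vertex \<tau>"]) (simp_all add: cell_def)
qed (auto simp: cell_def)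

lemma spans_finite: "spans L U \<Longrightarrow> finite U" "spans L U \<Longrightarrow> finite L"
proof -
  assume span: "spans L U"
  then have "U \<in> consistent_families I"
    unfolding spans_def by (meson atLeastAtMost_iff order_refl subsetD)
  then show "finite U"
    by (rule consistent_familiesD)
  then show "finite L"
    using span finite_subset unfolding spans_def by blast
qed

lemma spans_subset: "spans L U \<Longrightarrow> L \<subseteq> L' \<Longrightarrow> L' \<subseteq> U' \<Longrightarrow> U' \<subseteq> U \<Longrightarrow> spans L' U'"
  unfolding spans_def by (meson atLeastatMost_subset_iff order_trans)

lemma spans_le: "spans L U \<Longrightarrow> L \<subseteq> U"
  by (simp add: spans_def)

lemma spans_in: "spans L U \<Longrightarrow> L \<subseteq> \<tau> \<Longrightarrow> \<tau> \<subseteq> U \<Longrightarrow> \<tau> \<in> consistent_families I"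
  unfolding spans_def by (meson atLeastAtMost_iff subsetD)

lemma spans_singleton: "\<sigma> \<in> consistent_families I \<Longrightarrow> spans \<sigma> \<sigma>"
  by (simp add: spans_def)

text \<open>The family \<open>insert a L\<close> is a vertex of the cube, and upward closure puts
  \<open>b\<close> into it. In coordinates: if \<open>y a\<close> is nonzero, then
  \<open>y b\<close> is 1.\<close>

lemma spans_above:
  assumes "spans L U" "a \<in> U" "b \<in> I" "a \<subset> b"
  shows "b \<in> L"
proof -
  have "insert a L \<in> consistent_families I"
    using assms(1,2) spans_le[OF assms(1)] by (intro spans_in[OF assms(1)]) (simp_all add: subset_insertI)
  then have "b \<in> insert a L"
    by (rule consistent_familiesD(3)) (use assms(3,4) in auto)
  then show ?thesis
    using assms(4) by (metis insertE psubset_eq)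
qed

lemma cell_in_cells: "spans L U \<Longrightarrow> cell L U \<in> cells"
  by (auto simp: cells_def)

lemma cell_subset_V: "cell L U \<subseteq> V"
  by (auto simp: cell_def)

lemma cells_subset: "Q \<in> cells \<Longrightarrow> Q \<subseteq> V"
  by (auto simp: cells_def cell_def)

lemma cell_subset_cell_iff:
  assumes "spans L U" "spans L' U'"
  shows "cell L U \<subseteq> cell L' U' \<longleftrightarrow> L' \<subseteq> L \<and> U \<subseteq> U'"
proof
  assume "cell L U \<subseteq> cell L' U'"
  then have "{L..U} \<subseteq> {L'..U'}"
    using s_cell assms by (metis image_mono)
  then show "L' \<subseteq> L \<and> U \<subseteq> U'"
    using spans_le[OF assms(1)] by (simp add: atLeastatMost_subset_iff)
qed (auto simp: cell_def)

lemma finite_cell: "spans L U \<Longrightarrow> finite (cell L U)"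
proof (rule finite_imageD[of s])
  assume "spans L U"
  then have "s ` cell L U \<subseteq> Pow U" "finite (Pow U)"
    using spans_finite(1) by (auto simp: cell_def)
  then show "finite (s ` cell L U)"
    by (rule finite_subset)
  show "inj_on s (cell L U)"
    by (rule inj_on_subset[OF inj_s cell_subset_V])
qed

lemma Union_cells: "\<Union>cells = V"
proof -
  have "x \<in> cell (s x) (s x)" "spans (s x) (s x)" if "x \<in> V" for x
    using that s_in spans_singleton by (simp_all add: cell_def)
  then show ?thesis
    using cells_subset cell_in_cells by blast
qed

lemma eq_cellI: "Q \<subseteq> V \<Longrightarrow> spans L U \<Longrightarrow> s ` Q = {L..U} \<Longrightarrow> Q = cell L U"
  using inj_on_image_eq_iff[OF inj_s] s_cell cell_subset_V by metis

text \<open>The faces of an interval are its subintervals, and an enumeration of the free members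
  \<open>U - L\<close> turns them into intervals of index sets.\<close>

lemma chart_of_enumeration:
  assumes span: "spans L U" and S: "finite S" and e: "bij_betw e S (U - L)"
  shows "cube_chart cells S (\<lambda>A. vertex (L \<union> e ` A)) (cell L U)"
proof -
  let ?f = "\<lambda>A. vertex (L \<union> e ` A)"
  have eS: "e ` A \<subseteq> U - L" if "A \<subseteq> S" for A
    using e that by (auto simp: bij_betw_def)
  have in_V: "L \<union> e ` A \<in> consistent_families I" if "A \<subseteq> S" for A
    using eS[OF that] spans_le[OF span] by (intro spans_in[OF span]) auto
  have sf: "s (?f A) = L \<union> e ` A" "?f A \<in> V" if "A \<subseteq> S" for A
    using vertex in_V[OF that] by auto
  have spAB: "spans (L \<union> e ` A) (L \<union> e ` B)" if "A \<subseteq> B" "B \<subseteq> S" for A B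
    using eS[OF that(2)] spans_le[OF span] that by (intro spans_subset[OF span]) auto
  have img: "?f ` {A..B} = cell (L \<union> e ` A) (L \<union> e ` B)" if "A \<subseteq> B" "B \<subseteq> S" for A B
  proof (rule eq_cellI[OF _ spAB[OF that]])
    show "?f ` {A..B} \<subseteq> V"
      using sf(2) that by auto
    have "s ` ?f ` {A..B} = (\<lambda>C. L \<union> e ` C) ` {A..B}"
      unfolding image_image by (rule image_cong) (use sf(1) that in auto)
    also have "\<dots> = {L \<union> e ` A..L \<union> e ` B}"
    proof (intro subset_antisym subsetI)
      fix \<tau>
      assume \<tau>: "\<tau> \<in> {L \<union> e ` A..L \<union> e ` B}"
      let ?C = "{i \<in> B. e i \<in> \<tau>}"
      have "\<tau> = L \<union> e ` ?C" "?C \<in> {A..B}"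
        using \<tau> that by auto
      then show "\<tau> \<in> (\<lambda>C. L \<union> e ` C) ` {A..B}"
        by blast
    next
      fix \<tau>
      assume "\<tau> \<in> (\<lambda>C. L \<union> e ` C) ` {A..B}"
      then obtain C where C: "\<tau> = L \<union> e ` C" "C \<in> {A..B}"
        by (rule imageE)
      show "\<tau> \<in> {L \<union> e ` A..L \<union> e ` B}"
        unfolding C(1) using C(2) image_mono[of A C e] image_mono[of C B e] by auto
    qed
    finally show "s ` ?f ` {A..B} = {L \<union> e ` A..L \<union> e ` B}" .
  qed
  have inj: "inj_on ?f (Pow S)"
  proof (rule inj_onI)
    fix A B
    assume AB: "A \<in> Pow S" "B \<in> Pow S" "?f A = ?f B"
    then have "L \<union> e ` A = L \<union> e ` B"
      using sf(1) by (metis PowD)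
    moreover have "e ` C = (L \<union> e ` C) - L" if "C \<subseteq> S" for C
      using eS[OF that] by blast
    ultimately have "e ` A = e ` B"
      using AB(1,2) by (metis PowD)
    then show "A = B"
      using AB e by (auto simp: bij_betw_def inj_on_image_eq_iff)
  qed
  have LU: "L \<union> e ` S = U"
    using e spans_le[OF span] by (auto simp: bij_betw_def)
  have "{F \<in> cells. F \<subseteq> cell L U} = {?f ` {A..B} | A B. A \<subseteq> B \<and> B \<subseteq> S}"
  proof (intro subset_antisym subsetI)
    fix F
    assume "F \<in> {F \<in> cells. F \<subseteq> cell L U}"
    then obtain L' U' where F: "F = cell L' U'" "spans L' U'" "L \<subseteq> L'" "U' \<subseteq> U" "L' \<subseteq> U'"
      using cell_subset_cell_iff[OF _ span] spans_le by (fastforce simp: cells_def)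
    let ?A = "{i \<in> S. e i \<in> L'}" and ?B = "{i \<in> S. e i \<in> U'}"
    have "L' = L \<union> e ` ?A" "U' = L \<union> e ` ?B"
      using F LU by auto
    then have "F = ?f ` {?A..?B}"
      using F(1,5) by (subst img) auto
    then show "F \<in> {?f ` {A..B} | A B. A \<subseteq> B \<and> B \<subseteq> S}"
      using F(5) by blast
  next
    fix F
    assume "F \<in> {?f ` {A..B} | A B. A \<subseteq> B \<and> B \<subseteq> S}"
    then obtain A B where "F = ?f ` {A..B}" "A \<subseteq> B" "B \<subseteq> S"
      by blast
    moreover have "cell (L \<union> e ` A) (L \<union> e ` B) \<subseteq> cell L U" if "B \<subseteq> S"
      using that LU image_mono[OF that, of e] unfolding cell_def by blast
    ultimately show "F \<in> {F \<in> cells. F \<subseteq> cell L U}"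
      using img spAB cell_in_cells by auto
  qed
  moreover have "?f ` Pow S = cell L U"
    using img[of "{}" S] LU by (simp add: Pow_def atLeastAtMost_def atLeast_def atMost_def)
  ultimately show ?thesis
    using S inj by (simp add: cube_chart_def bij_betw_def)
qed

lemma ex_chart: "spans L U \<Longrightarrow> \<exists>S f. cube_chart cells S f (cell L U)"
  using chart_of_enumeration ex_bij_betw_nat_finite[of "U - L"] spans_finite(1)
  by (metis finite_Diff finite_atLeastLessThan)

lemma cube_complex_cells: "cube_complex cells"
  unfolding cube_complex_def
proof (intro conjI ballI)
  show "\<exists>S f. cube_chart cells S f Q" if "Q \<in> cells" for Q
    using that ex_chart by (auto simp: cells_def)
  fix P Q
  assume "P \<in> cells" "Q \<in> cells"
  then obtain L U L' U' where PQ: "P = cell L U" "Q = cell L' U'" "spans L U" "spans L' U'"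
    by (auto simp: cells_def)
  then have Int: "P \<inter> Q = cell (L \<union> L') (U \<inter> U')"
    by (auto simp: cell_def)
  show "P \<inter> Q = {} \<or> P \<inter> Q \<in> cells"
  proof (cases "L \<union> L' \<subseteq> U \<inter> U'")
    case True
    then have "spans (L \<union> L') (U \<inter> U')"
      using PQ(3) by (auto intro: spans_subset)
    then show ?thesis
      using Int cell_in_cells by auto
  qed (auto simp: Int cell_def)
qed

text \<open>The edges of a chart flip single members, so rigidity applies. What freedom remains is
  the bijection \<open>e\<close> of directions and the vertex \<sigma> serving as origin; a
  direction whose member lies in \<sigma> is traversed backwards.\<close>

lemma chart_coordinates:
  assumes span: "spans L U" and chart: "cube_chart cells S f (cell L U)"
  obtains e \<sigma> where "bij_betw e S (U - L)" "\<And>A. A \<subseteq> S \<Longrightarrow> s (f A) = sym_diff \<sigma> (e ` A)"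
    "L \<subseteq> \<sigma>" "\<sigma> \<subseteq> U"
proof -
  have S: "finite S" and bij_f: "bij_betw f (Pow S) (cell L U)"
    and faces: "{F \<in> cells. F \<subseteq> cell L U} = {f ` {A..B} | A B. A \<subseteq> B \<and> B \<subseteq> S}"
    using chart unfolding cube_chart_def by iprover+
  have fV: "f A \<in> cell L U" if "A \<subseteq> S" for A
    using bij_f that by (auto simp: bij_betw_def)
  have inj: "inj_on (\<lambda>A. s (f A)) (Pow S)"
    using comp_inj_on[OF bij_betw_imp_inj_on[OF bij_f], of s] bij_betw_imp_surj_on[OF bij_f]
      inj_on_subset[OF inj_s cell_subset_V] by (simp add: comp_def)
  have edge: "\<exists>a. s (f (insert i A)) = sym_diff (s (f A)) {a}" if A: "A \<subseteq> S" "i \<in> S - A" for A i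
  proof -
    have "{A..insert i A} = {A, insert i A}"
      using interval_insert[of A i] .
    then have img: "f ` {A..insert i A} = {f A, f (insert i A)}"
      by simp
    have "f ` {A..insert i A} \<in> {F \<in> cells. F \<subseteq> cell L U}"
      unfolding faces using A by blast
    then obtain L' U' where LU': "{f A, f (insert i A)} = cell L' U'" "spans L' U'"
      unfolding img cells_def by blast
    then have "{L'..U'} = {s (f A), s (f (insert i A))}"
      using s_cell[OF LU'(2)] by (metis image_insert image_empty)
    moreover have "s (f A) \<noteq> s (f (insert i A))"
      using inj_onD[OF inj, of A "insert i A"] A by auto
    ultimately show ?thesis
      using interval_two_elements[OF _ _ spans_le[OF LU'(2)]] by metis
  qed
  obtain e where e: "inj_on e S" "\<And>A. A \<subseteq> S \<Longrightarrow> s (f A) = sym_diff (s (f {})) (e ` A)"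
    using cube_rigid[OF S inj edge] by blast
  define \<sigma> where "\<sigma> = s (f {})"
  have sfA: "L \<subseteq> s (f A)" "s (f A) \<subseteq> U" if "A \<subseteq> S" for A
    using fV[OF that] by (auto simp: cell_def)
  have "e ` S = U - L"
  proof (intro subset_antisym subsetI)
    fix a
    assume "a \<in> e ` S"
    then obtain i where i: "i \<in> S" "a = e i" by blast
    then show "a \<in> U - L"
    proof -
      have "s (f {i}) = sym_diff \<sigma> {a}" "{i} \<subseteq> S"
        using e(2)[of "{i}"] i by (simp_all add: \<sigma>_def)
      then have "L \<subseteq> sym_diff \<sigma> {a}" "sym_diff \<sigma> {a} \<subseteq> U" "L \<subseteq> \<sigma>" "\<sigma> \<subseteq> U"
        using sfA[of "{i}"] sfA[of "{}"] by (simp_all add: \<sigma>_def)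
      then show ?thesis
        by blast
    qed
  next
    fix a
    assume a: "a \<in> U - L"
    \<comment> \<open>Flipping a free member \<open>a\<close> at \<sigma> stays inside the cube, so
      a vertex of the chart realizes it; comparing the two descriptions at \<open>a\<close> shows
      that \<open>a\<close> is in the image of \<open>e\<close>.\<close>
    have "sym_diff \<sigma> {a} \<in> {L..U}"
    proof -
      have "L \<subseteq> \<sigma>" "\<sigma> \<subseteq> U"
        using sfA[of "{}"] by (simp_all add: \<sigma>_def)
      then show ?thesis
        using a by auto
    qed
    then have "sym_diff \<sigma> {a} \<in> (\<lambda>A. s (f A)) ` Pow S"
      unfolding s_cell[OF span, symmetric] bij_betw_imp_surj_on[OF bij_f, symmetric] image_image .
    then obtain A where A: "A \<subseteq> S" "sym_diff \<sigma> {a} = s (f A)"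
      by blast
    have "a \<in> sym_diff \<sigma> {a} \<longleftrightarrow> a \<notin> \<sigma>" "a \<in> sym_diff \<sigma> (e ` A) \<longleftrightarrow> (a \<in> \<sigma>) \<noteq> (a \<in> e ` A)"
      by blast+
    then have "a \<in> e ` A"
      using A(2) e(2)[OF A(1)] unfolding \<sigma>_def by metis
    then show "a \<in> e ` S"
      using A(1) by blast
  qed
  then have "bij_betw e S (U - L)"
    using e(1) unfolding bij_betw_def by (intro conjI)
  then show ?thesis
    by (rule that[of e \<sigma>]) (unfold \<sigma>_def, fact e(2), (rule sfA, simp)+)
qed

text \<open>One formula covers both directions: if \<open>a\<close> belongs to \<open>s x\<close>,
  the edge leads down by removing it, otherwise it leads up by adding it.\<close>

lemma edge_iff:
  assumes x: "x \<in> V"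
  shows "E \<in> cells \<and> card E = 2 \<and> x \<in> E \<longleftrightarrow>
    (\<exists>a. spans (s x - {a}) (insert a (s x)) \<and> E = cell (s x - {a}) (insert a (s x)))"
proof
  assume E: "E \<in> cells \<and> card E = 2 \<and> x \<in> E"
  then obtain L U where LU: "E = cell L U" "spans L U"
    unfolding cells_def by blast
  obtain y z where yz: "E = {y, z}" "y \<noteq> z"
    using E unfolding card_2_iff by blast
  then obtain x' where x': "E = {x, x'}" "x \<noteq> x'"
    using E by (metis insertE insert_commute singletonD)
  then have "{L..U} = {s x, s x'}"
    using s_cell[OF LU(2)] LU(1) by (metis image_insert image_empty)
  moreover have "s x \<noteq> s x'"
    using inj_onD[OF inj_s, of x x'] x' cell_subset_V LU(1) by blast
  ultimately obtain a where a: "a \<notin> L" "U = insert a L"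
    using interval_two_elements[OF _ _ spans_le[OF LU(2)]] by metis
  moreover have "L \<subseteq> s x" "s x \<subseteq> U"
    using E LU by (auto simp: cell_def)
  ultimately have "L = s x - {a}" "U = insert a (s x)"
    by auto
  then show "\<exists>a. spans (s x - {a}) (insert a (s x)) \<and> E = cell (s x - {a}) (insert a (s x))"
    using LU by blast
next
  assume "\<exists>a. spans (s x - {a}) (insert a (s x)) \<and> E = cell (s x - {a}) (insert a (s x))"
  then obtain a where a: "spans (s x - {a}) (insert a (s x))" "E = cell (s x - {a}) (insert a (s x))"
    by blast
  have "{s x - {a}..insert a (s x)} = {s x - {a}, insert a (s x)}"
    using interval_insert[of "s x - {a}" a] by simp
  then have "card (s ` E) = 2"
    using s_cell[OF a(1)] a(2) card_2_iff[of "{s x - {a}, insert a (s x)}"] by auto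
  then have "card E = 2"
    using card_image[OF inj_on_subset[OF inj_s cell_subset_V]] a(2) by simp
  moreover have "x \<in> E"
    using x a(2) by (auto simp: cell_def)
  ultimately show "E \<in> cells \<and> card E = 2 \<and> x \<in> E"
    using a cell_in_cells by auto
qed

text \<open>Consistency of a vertex of the large cube is tested on two members at a time, and each
  such pair of choices already occurs at a vertex of one of the given smaller cubes.\<close>

lemma spans_of_pairs:
  assumes x: "x \<in> V" and B: "finite B"
    and pairs: "\<And>a b. a \<in> B \<Longrightarrow> b \<in> B \<Longrightarrow> spans (s x - {a, b}) (s x \<union> {a, b})"
  shows "spans (s x - B) (s x \<union> B)"
  unfolding spans_def
proof (intro conjI subsetI)
  fix \<tau>
  assume \<tau>: "\<tau> \<in> {s x - B..s x \<union> B}"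
  show "\<tau> \<in> consistent_families I"
  proof (rule consistent_families_pairwise)
    show "finite \<tau>"
      using \<tau> B finite_s[OF x] by (auto intro: finite_subset)
    fix a b
    \<comment> \<open>The family that follows \<tau> on \<open>a\<close> and \<open>b\<close> and
      agrees with \<open>s x\<close> elsewhere.\<close>
    let ?\<sigma> = "(s x - {a, b}) \<union> (\<tau> \<inter> {a, b})"
    have "?\<sigma> \<in> consistent_families I"
    proof (cases "{a, b} \<inter> B = {}")
      case True
      then have "?\<sigma> = s x"
        using \<tau> by auto
      then show ?thesis
        using s_in[OF x] by simp
    next
      case False
      then obtain c d where "c \<in> B" "d \<in> B" "{a, b} \<inter> B = {c, d}"
        by (cases "a \<in> B"; cases "b \<in> B") auto
      then show ?thesis
        by (intro spans_in[OF pairs[of c d]]) (use \<tau> in auto)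
    qed
    then show "\<exists>\<sigma>\<in>consistent_families I. \<sigma> \<inter> {a, b} = \<tau> \<inter> {a, b}"
      by (intro bexI[of _ ?\<sigma>]) auto
  qed
qed auto

text \<open>Each pair of the given edges lies in a common cube, so any two of their directions can
  be flipped independently at \<open>x\<close>. By pairwise consistency all of them can, and the
  resulting cube has exactly the given edges at \<open>x\<close>.\<close>

lemma flag_link:
  assumes x: "x \<in> V"
  shows "flag (link cells x)"
  unfolding flag_def
proof (intro allI impI, elim conjE)
  fix \<epsilon>
  assume fin: "finite \<epsilon>" and sub: "\<epsilon> \<subseteq> \<Union>(link cells x)"
    and pairs: "\<forall>E\<in>\<epsilon>. \<forall>F\<in>\<epsilon>. {E, F} \<in> link cells x"
  let ?P = "\<lambda>E a. spans (s x - {a}) (insert a (s x)) \<and> E = cell (s x - {a}) (insert a (s x))"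
  have "\<exists>a. ?P E a" if "E \<in> \<epsilon>" for E
  proof -
    have "E \<in> cells \<and> card E = 2 \<and> x \<in> E"
      using sub that by (auto simp: link_def)
    then show ?thesis
      using edge_iff[OF x] by blast
  qed
  then obtain d where d: "\<And>E. E \<in> \<epsilon> \<Longrightarrow> ?P E (d E)"
    by metis
  let ?B = "d ` \<epsilon>"
  have span: "spans (s x - ?B) (s x \<union> ?B)"
  proof (rule spans_of_pairs[OF x])
    fix a b
    assume "a \<in> ?B" "b \<in> ?B"
    then obtain E F where EF: "E \<in> \<epsilon>" "F \<in> \<epsilon>" "a = d E" "b = d F"
      by blast
    then have "{E, F} \<in> link cells x"
      using pairs by simp
    then obtain Q where Q: "{E, F} = {E \<in> cells. card E = 2 \<and> x \<in> E \<and> E \<subseteq> Q}" "Q \<in> cells" "x \<in> Q"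
      unfolding link_def by blast
    have "E \<subseteq> Q" "F \<subseteq> Q"
      using insertI1[of E "{F}"] insertI2[OF singletonI, of F E] unfolding Q(1) by simp_all
    moreover obtain L U where LU: "Q = cell L U" "spans L U"
      using Q(2) unfolding cells_def by blast
    moreover have "L \<subseteq> s x - {d G} \<and> insert (d G) (s x) \<subseteq> U" if "G \<in> \<epsilon>" "G \<subseteq> Q" for G
      using cell_subset_cell_iff[OF _ LU(2)] d[OF that(1)] that(2) LU(1) by metis
    ultimately have "L \<subseteq> s x - {a}" "insert a (s x) \<subseteq> U" "L \<subseteq> s x - {b}" "insert b (s x) \<subseteq> U"
      using EF by simp_all
    then show "spans (s x - {a, b}) (s x \<union> {a, b})"
      by (intro spans_subset[OF LU(2)]) auto
  qed (use fin in auto)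
  let ?Q = "cell (s x - ?B) (s x \<union> ?B)"
  have "\<epsilon> = {E \<in> cells. card E = 2 \<and> x \<in> E \<and> E \<subseteq> ?Q}"
  proof (intro subset_antisym subsetI)
    fix E
    assume E: "E \<in> \<epsilon>"
    then have "E \<subseteq> ?Q"
      using d[OF E] cell_subset_cell_iff[OF _ span] E by blast
    then show "E \<in> {E \<in> cells. card E = 2 \<and> x \<in> E \<and> E \<subseteq> ?Q}"
      using edge_iff[OF x, of E] d[OF E] by blast
  next
    fix E
    assume E: "E \<in> {E \<in> cells. card E = 2 \<and> x \<in> E \<and> E \<subseteq> ?Q}"
    then obtain a where a: "?P E a"
      using edge_iff[OF x, of E] by blast
    then have "s x - ?B \<subseteq> s x - {a}" "insert a (s x) \<subseteq> s x \<union> ?B"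
      using E cell_subset_cell_iff[OF _ span] by blast+
    then have "a \<in> ?B"
      by blast
    then obtain F where "F \<in> \<epsilon>" "a = d F"
      by blast
    then show "E \<in> \<epsilon>"
      using a d[of F] by simp
  qed
  moreover have "?Q \<in> cells" "x \<in> ?Q"
    using span x cell_in_cells by (auto simp: cell_def)
  ultimately show "\<epsilon> \<in> link cells x"
    unfolding link_def by blast
qed

subsection \<open>Coordinates\<close>

text \<open>The probability of the family \<open>s x\<close> when each \<open>a\<close> is included
  independently with probability \<open>y a\<close>. No cube is mentioned, so one formula serves all
  cubes containing the point; a zero coordinate contributes the factor 1 to a family without
  it.\<close>

definition weight :: "('b set \<Rightarrow> real) \<Rightarrow> 'v \<Rightarrow> real" where
  "weight y x = (if x \<in> V \<and> s x \<subseteq> {a. y a \<noteq> 0} then \<Prod>a | y a \<noteq> 0. if a \<in> s x then y a else 1 - y a else 0)"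

text \<open>The marginal probability that \<open>a\<close> is present, which recovers the
  coordinates from the weights.\<close>

definition coord :: "('v \<Rightarrow> real) \<Rightarrow> 'b set \<Rightarrow> real" where
  "coord w a = (\<Sum>x | w x \<noteq> 0 \<and> a \<in> s x. w x)"

definition coord_box :: "'b set set \<Rightarrow> 'b set set \<Rightarrow> ('b set \<Rightarrow> real) set" where
  "coord_box L U = {y. (\<forall>a. 0 \<le> y a \<and> y a \<le> 1) \<and> (\<forall>a\<in>L. y a = 1) \<and> (\<forall>a. a \<notin> U \<longrightarrow> y a = 0)}"

lemma boxD:
  assumes "y \<in> coord_box L U"
  shows "0 \<le> y a" "y a \<le> 1" "a \<in> L \<Longrightarrow> y a = 1" "a \<notin> U \<Longrightarrow> y a = 0" "{a. y a \<noteq> 0} \<subseteq> U"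
  using assms unfolding coord_box_def by blast+

text \<open>The product may run over any finite set containing the support: an additional coordinate
  is zero, so its factor is 1 if it is absent from \<open>s x\<close> and 0 otherwise.\<close>

lemma weight_eq:
  assumes "finite F" "{a. y a \<noteq> 0} \<subseteq> F" "x \<in> V"
  shows "weight y x = (if s x \<subseteq> F then \<Prod>a\<in>F. if a \<in> s x then y a else 1 - y a else 0)"
proof -
  let ?p = "\<lambda>a. if a \<in> s x then y a else 1 - y a"
  consider "s x \<subseteq> {a. y a \<noteq> 0}" | "s x \<subseteq> F" "\<not> s x \<subseteq> {a. y a \<noteq> 0}" | "\<not> s x \<subseteq> F"
    by blast
  then show ?thesis
  proof cases
    case 1
    have "prod ?p {a. y a \<noteq> 0} = prod ?p F"
      by (rule prod.mono_neutral_left) (use assms 1 in auto)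
    then show ?thesis
      using 1 assms by (simp add: weight_def)
  next
    case 2
    then obtain a where "a \<in> F" "a \<in> s x" "y a = 0"
      by blast
    then have "a \<in> F" "?p a = 0"
      by simp_all
    then have "prod ?p F = 0"
      using assms(1) by (intro prod_zero) blast+
    then show ?thesis
      using 2 by (simp add: weight_def)
  next
    case 3
    then have "\<not> s x \<subseteq> {a. y a \<noteq> 0}"
      using assms(2) by (metis subset_trans)
    then show ?thesis
      using 3 by (simp add: weight_def)
  qed
qed

lemma weight_box:
  assumes span: "spans L U" and y: "y \<in> coord_box L U"
  shows "weight y x = (if x \<in> cell L U then \<Prod>a\<in>U - L. if a \<in> s x then y a else 1 - y a else 0)"
proof (cases "x \<in> V \<and> s x \<subseteq> U")
  case True
  let ?p = "\<lambda>a. if a \<in> s x then y a else 1 - y a"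
  have eq: "weight y x = prod ?p U"
    using weight_eq[OF spans_finite(1)[OF span] boxD(5)[OF y], of x] True by simp
  show ?thesis
  proof (cases "L \<subseteq> s x")
    case L: True
    then have "prod ?p U = prod ?p (U - L)"
      using spans_finite[OF span] boxD(3)[OF y] spans_le[OF span]
      by (intro prod.mono_neutral_right) auto
    then show ?thesis
      using True L eq by (simp add: cell_def)
  next
    case False
    then obtain a where "a \<in> L" "a \<notin> s x"
      by blast
    then have "?p a = 0" "a \<in> U"
      using boxD(3)[OF y] spans_le[OF span] by auto
    then have "prod ?p U = 0"
      using spans_finite(1)[OF span] by (intro prod_zero) blast+
    then show ?thesis
      using False eq by (simp add: cell_def)
  qed
next
  case False
  then show ?thesis
    using boxD(5)[OF y] by (auto simp: weight_def cell_def)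
qed

text \<open>The vertices of the cube are the families \<open>L \<union> B\<close> with
  \<open>B\<close> a subset of \<open>U - L\<close>. In this form sums of weights are expansions of
  products, to which \<open>prod_add\<close> applies.\<close>

lemma sum_weight_cell:
  assumes span: "spans L U" and y: "y \<in> coord_box L U"
  shows "(\<Sum>x | weight y x \<noteq> 0 \<and> P (s x). weight y x) =
    (\<Sum>B\<in>Pow (U - L). if P (L \<union> B) then (\<Prod>a\<in>B. y a) * (\<Prod>a\<in>U - L - B. 1 - y a) else 0)"
proof -
  let ?w = "\<lambda>x. if P (s x) then weight y x else 0"
  let ?f = "\<lambda>B. vertex (L \<union> B)"
  have fin: "finite (U - L)"
    using spans_finite[OF span] by simp
  have in_V: "L \<union> B \<in> consistent_families I" if "B \<in> Pow (U - L)" for B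
    using that spans_le[OF span] by (intro spans_in[OF span]) auto
  have "(\<Sum>x | weight y x \<noteq> 0 \<and> P (s x). weight y x) = sum ?w (cell L U)"
  proof (rule sum.mono_neutral_cong_left)
    show "finite (cell L U)"
      by (rule finite_cell[OF span])
    show "{x. weight y x \<noteq> 0 \<and> P (s x)} \<subseteq> cell L U"
      using weight_box[OF span y] by auto
  qed auto
  also have "bij_betw ?f (Pow (U - L)) (cell L U)"
  proof (rule bij_betw_byWitness[where f' = "\<lambda>x. s x - L"])
    show "\<forall>B\<in>Pow (U - L). s (?f B) - L = B"
      using vertex(2)[OF in_V] by (simp add: Un_Diff Diff_triv Int_commute disjoint_eq_subset_Compl) blast
    show "\<forall>x\<in>cell L U. ?f (s x - L) = x"
      using the_inv_into_f_f[OF inj_s] by (simp add: cell_def Un_absorb1)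
    show "?f ` Pow (U - L) \<subseteq> cell L U"
    proof (rule image_subsetI)
      fix B
      assume B: "B \<in> Pow (U - L)"
      show "?f B \<in> cell L U"
        using vertex[OF in_V[OF B]] B spans_le[OF span] unfolding cell_def by blast
    qed
    show "(\<lambda>x. s x - L) ` cell L U \<subseteq> Pow (U - L)"
      by (auto simp: cell_def)
  qed
  then have "sum ?w (cell L U) = (\<Sum>B\<in>Pow (U - L). ?w (?f B))"
    by (rule sum.reindex_bij_betw[symmetric])
  also have "\<dots> = (\<Sum>B\<in>Pow (U - L). if P (L \<union> B) then (\<Prod>a\<in>B. y a) * (\<Prod>a\<in>U - L - B. 1 - y a) else 0)"
  proof (rule sum.cong[OF refl])
    fix B
    assume B: "B \<in> Pow (U - L)"
    have sf: "s (?f B) = L \<union> B" "?f B \<in> V"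
      using vertex in_V[OF B] by simp_all
    have "?f B \<in> cell L U"
      using sf B spans_le[OF span] unfolding cell_def by auto
    then have "weight y (?f B) = (\<Prod>a\<in>U - L. if a \<in> L \<union> B then y a else 1 - y a)"
      unfolding weight_box[OF span y] sf(1) by simp
    also have "\<dots> = (\<Prod>a\<in>U - L. if a \<in> B then y a else 1 - y a)"
      by (rule prod.cong) auto
    also have "\<dots> = (\<Prod>a\<in>(U - L) \<inter> {a. a \<in> B}. y a) * (\<Prod>a\<in>(U - L) \<inter> - {a. a \<in> B}. 1 - y a)"
      by (rule prod.If_cases[OF fin])
    also have "(U - L) \<inter> {a. a \<in> B} = B"
      using B by auto
    also have "(U - L) \<inter> - {a. a \<in> B} = U - L - B"
      by auto
    finally show "?w (?f B) = (if P (L \<union> B) then (\<Prod>a\<in>B. y a) * (\<Prod>a\<in>U - L - B. 1 - y a) else 0)"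
      unfolding sf(1) by simp
  qed
  finally show ?thesis .
qed

lemma sum_weight:
  assumes span: "spans L U" and y: "y \<in> coord_box L U"
  shows "(\<Sum>x | weight y x \<noteq> 0. weight y x) = 1"
  using sum_weight_cell[OF span y, of "\<lambda>_. True"] prod_add[of "U - L" y "\<lambda>a. 1 - y a"]
    spans_finite[OF span] by simp

lemma coord_weight:
  assumes span: "spans L U" and y: "y \<in> coord_box L U"
  shows "coord (weight y) a = y a"
proof (cases "a \<in> U")
  case True
  have fin: "finite (U - L)"
    using spans_finite[OF span] by simp
  \<comment> \<open>Replacing the summand \<open>1 - y a\<close> by 0 deletes from the expanded
    product exactly the subsets without \<open>a\<close>. If \<open>a\<close> is in
    \<open>L\<close>, no factor is affected and the product is 1.\<close>
  let ?g = "\<lambda>b. if b = a then 0 else 1 - y b"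
  have "y a = (\<Prod>b\<in>U - L. y b + ?g b)"
  proof (cases "a \<in> L")
    case True
    then have "(\<Prod>b\<in>U - L. y b + ?g b) = 1"
      by (intro prod.neutral) auto
    then show ?thesis
      using boxD(3)[OF y True] by simp
  next
    case False
    then have "(\<Prod>b\<in>U - L. y b + ?g b) = (\<Prod>b\<in>U - L. if b = a then y b else 1)"
      by (intro prod.cong) auto
    then show ?thesis
      using False True fin by (simp add: prod.delta)
  qed
  also have "\<dots> = (\<Sum>B\<in>Pow (U - L). (\<Prod>b\<in>B. y b) * (\<Prod>b\<in>U - L - B. ?g b))"
    by (rule prod_add[OF fin])
  also have "\<dots> = (\<Sum>B\<in>Pow (U - L). if a \<in> L \<union> B then (\<Prod>b\<in>B. y b) * (\<Prod>b\<in>U - L - B. 1 - y b) else 0)"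
  proof (rule sum.cong[OF refl])
    fix B
    assume B: "B \<in> Pow (U - L)"
    have "(\<Prod>b\<in>U - L - B. ?g b) = (if a \<in> L \<union> B then (\<Prod>b\<in>U - L - B. 1 - y b) else 0)"
    proof (cases "a \<in> L \<union> B")
      case True
      then show ?thesis
        by (simp, intro prod.cong) auto
    next
      case False
      then have "a \<in> U - L - B" "?g a = 0"
        using \<open>a \<in> U\<close> by auto
      then have "prod ?g (U - L - B) = 0"
        using fin by (intro prod_zero) blast+
      then show ?thesis
        using False by simp
    qed
    then show "(\<Prod>b\<in>B. y b) * (\<Prod>b\<in>U - L - B. ?g b) =
        (if a \<in> L \<union> B then (\<Prod>b\<in>B. y b) * (\<Prod>b\<in>U - L - B. 1 - y b) else 0)"
      by simp
  qed
  also have "\<dots> = coord (weight y) a"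
    unfolding coord_def by (rule sum_weight_cell[OF span y, symmetric])
  finally show ?thesis
    by simp
next
  case False
  have "x \<notin> cell L U" if "a \<in> s x" for x
    using that False by (auto simp: cell_def)
  then have "coord (weight y) a = 0"
    unfolding coord_def using weight_box[OF span y] by (intro sum.neutral) auto
  then show ?thesis
    using boxD(4)[OF y False] by simp
qed

lemma weight_inject:
  assumes "spans L U" "y \<in> coord_box L U" "spans L' U'" "y' \<in> coord_box L' U'" "weight y = weight y'"
  shows "y = y'"
  using coord_weight[OF assms(1,2)] coord_weight[OF assms(3,4)] assms(5) by auto

text \<open>In a direction whose member lies in the origin \<sigma>, the chart parameter measures
  the absence of that member, whence \<open>1 - t i\<close>.\<close>

lemma cube_point_eq_weight:
  assumes span: "spans L U" and S: "finite S" and f: "bij_betw f (Pow S) (cell L U)"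
    and e: "bij_betw e S (U - L)" and sf: "\<And>A. A \<subseteq> S \<Longrightarrow> s (f A) = sym_diff \<sigma> (e ` A)"
    and y: "y \<in> coord_box L U" and yt: "\<And>i. i \<in> S \<Longrightarrow> y (e i) = (if e i \<in> \<sigma> then 1 - t i else t i)"
  shows "cube_point S f t = weight y"
proof
  fix x
  show "cube_point S f t x = weight y x"
  proof (cases "x \<in> cell L U")
    case True
    then obtain A where A: "A \<subseteq> S" "x = f A"
      using bij_betw_imp_surj_on[OF f] by blast
    have "{A'. A' \<subseteq> S \<and> f A' = x} = {A}"
      using A inj_on_eq_iff[OF bij_betw_imp_inj_on[OF f]] by auto
    then have "cube_point S f t x = (\<Prod>i\<in>A. t i) * (\<Prod>i\<in>S - A. 1 - t i)"
      by (simp add: cube_point_def)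
    also have "\<dots> = (\<Prod>i\<in>S \<inter> {i. i \<in> A}. t i) * (\<Prod>i\<in>S \<inter> - {i. i \<in> A}. 1 - t i)"
      using A(1) by (simp add: Int_absorb1 Diff_eq)
    also have "\<dots> = (\<Prod>i\<in>S. if i \<in> A then t i else 1 - t i)"
      by (rule prod.If_cases[OF S, symmetric])
    also have "\<dots> = (\<Prod>i\<in>S. if e i \<in> s x then y (e i) else 1 - y (e i))"
    proof (rule prod.cong[OF refl])
      fix i
      assume i: "i \<in> S"
      have "e i \<in> e ` A \<longleftrightarrow> i \<in> A"
        using inj_on_image_mem_iff[OF bij_betw_imp_inj_on[OF e] i A(1)] .
      then have "e i \<in> s x \<longleftrightarrow> (e i \<in> \<sigma>) \<noteq> (i \<in> A)"
        unfolding A(2) sf[OF A(1)] by blast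
      then show "(if i \<in> A then t i else 1 - t i) = (if e i \<in> s x then y (e i) else 1 - y (e i))"
        using yt[OF i] by auto
    qed
    also have "\<dots> = (\<Prod>a\<in>U - L. if a \<in> s x then y a else 1 - y a)"
      by (rule prod.reindex_bij_betw[OF e])
    also have "\<dots> = weight y x"
      using True weight_box[OF span y, of x] by simp
    finally show ?thesis .
  next
    case False
    then have "{A'. A' \<subseteq> S \<and> f A' = x} = {}"
      using bij_betw_imp_surj_on[OF f] by blast
    then show ?thesis
      using False weight_box[OF span y, of x] unfolding cube_point_def by (simp only: sum.empty if_False)
  qed
qed

text \<open>Reversing a direction maps \<open>[0,1]\<close> onto itself and fixes 1/2. So neither
  the cube nor its family of midcubes depends on the chart; \<open>?y\<close> and \<open>?t\<close>
  translate between the two kinds of coordinates.\<close>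

lemma cube_chart_points:
  assumes span: "spans L U" and chart: "cube_chart cells S f (cell L U)"
  obtains e where "bij_betw e S (U - L)"
    "\<forall>i\<in>S. {cube_point S f t | t. (\<forall>j\<in>S. 0 \<le> t j \<and> t j \<le> 1) \<and> t i = 1/2} =
      weight ` {y \<in> coord_box L U. y (e i) = 1/2}"
    "{cube_point S f t | t. \<forall>j\<in>S. 0 \<le> t j \<and> t j \<le> 1} = weight ` coord_box L U"
proof -
  have S: "finite S" and f: "bij_betw f (Pow S) (cell L U)"
    using chart unfolding cube_chart_def by iprover+
  obtain e \<sigma> where e: "bij_betw e S (U - L)" and sf: "\<And>A. A \<subseteq> S \<Longrightarrow> s (f A) = sym_diff \<sigma> (e ` A)"
    using chart_coordinates[OF span chart] by metis
  note point = cube_point_eq_weight[OF span S f e sf]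
  let ?e' = "the_inv_into S e"
  let ?y = "\<lambda>t a. if a \<in> U - L then if a \<in> \<sigma> then 1 - t (?e' a) else t (?e' a)
      else if a \<in> L then 1 else 0 :: real"
  let ?t = "\<lambda>y i. if e i \<in> \<sigma> then 1 - y (e i) else y (e i) :: real"
  have e': "?e' (e i) = i" "e i \<in> U - L" if "i \<in> S" for i
    using that e by (auto simp: bij_betw_def the_inv_into_f_f)
  have e'': "?e' a \<in> S" "e (?e' a) = a" if "a \<in> U - L" for a
    using that bij_betwE[OF bij_betw_the_inv_into[OF e]] f_the_inv_into_f_bij_betw[OF e] by auto
  have forward: "?y t \<in> coord_box L U \<and> cube_point S f t = weight (?y t) \<and> (\<forall>i\<in>S. t i = 1/2 \<longrightarrow> ?y t (e i) = 1/2)"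
    if t: "\<forall>j\<in>S. 0 \<le> t j \<and> t j \<le> 1" for t
  proof -
    have box: "?y t \<in> coord_box L U"
      using t e''(1) spans_le[OF span] by (auto simp: coord_box_def)
    have "cube_point S f t = weight (?y t)"
      by (rule point[OF _ box]) (use e' in auto)
    then show ?thesis
      using box e' by auto
  qed
  have backward: "(\<forall>j\<in>S. 0 \<le> ?t y j \<and> ?t y j \<le> 1) \<and> cube_point S f (?t y) = weight y \<and>
      (\<forall>i\<in>S. y (e i) = 1/2 \<longrightarrow> ?t y i = 1/2)"
    if y: "y \<in> coord_box L U" for y
  proof -
    have "cube_point S f (?t y) = weight y"
      by (rule point[OF _ y]) auto
    then show ?thesis
      using boxD(1,2)[OF y] by auto
  qed
  show ?thesis
  proof (rule that[OF e])
    show "{cube_point S f t | t. \<forall>j\<in>S. 0 \<le> t j \<and> t j \<le> 1} = weight ` coord_box L U"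
    proof (intro subset_antisym subsetI)
      fix w
      assume "w \<in> {cube_point S f t | t. \<forall>j\<in>S. 0 \<le> t j \<and> t j \<le> 1}"
      then obtain t where t: "w = cube_point S f t" "\<forall>j\<in>S. 0 \<le> t j \<and> t j \<le> 1"
        by blast
      have "?y t \<in> coord_box L U" "w = weight (?y t)"
        using forward[OF t(2)] t(1) by simp_all
      then show "w \<in> weight ` coord_box L U"
        by (intro image_eqI)
    next
      fix w
      assume "w \<in> weight ` coord_box L U"
      then obtain y where "w = weight y" "y \<in> coord_box L U"
        by blast
      then show "w \<in> {cube_point S f t | t. \<forall>j\<in>S. 0 \<le> t j \<and> t j \<le> 1}"
        using backward[of y] by (intro CollectI exI[of _ "?t y"]) simp
    qed
    show "\<forall>i\<in>S. {cube_point S f t | t. (\<forall>j\<in>S. 0 \<le> t j \<and> t j \<le> 1) \<and> t i = 1/2} =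
      weight ` {y \<in> coord_box L U. y (e i) = 1/2}"
    proof (intro ballI subset_antisym subsetI)
      fix i w
      assume i: "i \<in> S"
      assume "w \<in> {cube_point S f t | t. (\<forall>j\<in>S. 0 \<le> t j \<and> t j \<le> 1) \<and> t i = 1/2}"
      then obtain t where t: "w = cube_point S f t" "\<forall>j\<in>S. 0 \<le> t j \<and> t j \<le> 1" "t i = 1/2"
        by blast
      then have "?y t \<in> {y \<in> coord_box L U. y (e i) = 1/2}" "w = weight (?y t)"
        using forward[OF t(2)] i by simp_all
      then show "w \<in> weight ` {y \<in> coord_box L U. y (e i) = 1/2}"
        by (intro image_eqI)
    next
      fix i w
      assume i: "i \<in> S"
      assume "w \<in> weight ` {y \<in> coord_box L U. y (e i) = 1/2}"
      then obtain y where "w = weight y" "y \<in> coord_box L U" "y (e i) = 1/2"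
        by blast
      then show "w \<in> {cube_point S f t | t. (\<forall>j\<in>S. 0 \<le> t j \<and> t j \<le> 1) \<and> t i = 1/2}"
        using backward[of y] i by (intro CollectI exI[of _ "?t y"]) simp
    qed
  qed
qed

lemma cube_points_cell:
  assumes span: "spans L U"
  shows "cube_points cells (cell L U) = weight ` coord_box L U"
proof -
  have "{cube_point S f t | t. \<forall>i\<in>S. 0 \<le> t i \<and> t i \<le> 1} = weight ` coord_box L U"
    if "cube_chart cells S f (cell L U)" for S f
    using that by (rule cube_chart_points[OF span])
  moreover obtain S f where "cube_chart cells S f (cell L U)"
    using ex_chart[OF span] by blast
  ultimately show ?thesis
    unfolding cube_points_def by blast
qed

lemma midcube_cell_iff:
  assumes span: "spans L U"
  shows "midcube cells (cell L U) m \<longleftrightarrow> (\<exists>a\<in>U - L. m = weight ` {y \<in> coord_box L U. y a = 1/2})"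
proof
  assume "midcube cells (cell L U) m"
  then obtain S f i where chart: "cube_chart cells S f (cell L U)" and i: "i \<in> S"
    and m: "m = {cube_point S f t | t. (\<forall>j\<in>S. 0 \<le> t j \<and> t j \<le> 1) \<and> t i = 1/2}"
    unfolding midcube_def by blast
  obtain e where e: "bij_betw e S (U - L)" "\<forall>i\<in>S.
      {cube_point S f t | t. (\<forall>j\<in>S. 0 \<le> t j \<and> t j \<le> 1) \<and> t i = 1/2} = weight ` {y \<in> coord_box L U. y (e i) = 1/2}"
    "{cube_point S f t | t. \<forall>j\<in>S. 0 \<le> t j \<and> t j \<le> 1} = weight ` coord_box L U"
    by (rule cube_chart_points[OF span chart])
  have "e i \<in> U - L"
    using bij_betwE[OF e(1)] i by blast
  then show "\<exists>a\<in>U - L. m = weight ` {y \<in> coord_box L U. y a = 1/2}"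
    using m unfolding e(2)[rule_format, OF i] by (rule rev_bexI)
next
  assume "\<exists>a\<in>U - L. m = weight ` {y \<in> coord_box L U. y a = 1/2}"
  then obtain a where a: "a \<in> U - L" "m = weight ` {y \<in> coord_box L U. y a = 1/2}"
    by blast
  obtain S f where chart: "cube_chart cells S f (cell L U)"
    using ex_chart[OF span] by blast
  obtain e where e: "bij_betw e S (U - L)" "\<forall>i\<in>S.
      {cube_point S f t | t. (\<forall>j\<in>S. 0 \<le> t j \<and> t j \<le> 1) \<and> t i = 1/2} = weight ` {y \<in> coord_box L U. y (e i) = 1/2}"
    "{cube_point S f t | t. \<forall>j\<in>S. 0 \<le> t j \<and> t j \<le> 1} = weight ` coord_box L U"
    by (rule cube_chart_points[OF span chart])
  obtain i where i: "i \<in> S" "a = e i"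
    using a(1) unfolding bij_betw_imp_surj_on[OF e(1), symmetric] by (elim imageE)
  show "midcube cells (cell L U) m"
    unfolding midcube_def using chart i(1) a(2) unfolding i(2) e(2)[rule_format, OF i(1), symmetric]
    by (intro exI conjI)
qed

lemma realization_cells: "realization cells = (\<Union>(L, U)\<in>{(L, U). spans L U}. weight ` coord_box L U)"
proof -
  have "realization cells = (\<Union>(L, U)\<in>{(L, U). spans L U}. cube_points cells (cell L U))"
    unfolding realization_def cells_def by blast
  also have "\<dots> = (\<Union>(L, U)\<in>{(L, U). spans L U}. weight ` coord_box L U)"
    by (rule SUP_cong[OF refl]) (use cube_points_cell in auto)
  finally show ?thesis .
qed

lemma realizationE:
  assumes "w \<in> realization cells"
  obtains L U y where "spans L U" "y \<in> coord_box L U" "w = weight y"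
  using assms unfolding realization_cells by blast

lemma realizationI: "spans L U \<Longrightarrow> y \<in> coord_box L U \<Longrightarrow> weight y \<in> realization cells"
  unfolding realization_cells by blast

subsection \<open>Contractibility\<close>

lemma coord_box_eq_PiE:
  assumes "spans L U"
  shows "coord_box L U = PiE UNIV (\<lambda>a. if a \<in> L then {1} else if a \<in> U then {0..1} else {0})"
proof (intro subset_antisym subsetI)
  fix y
  assume y: "y \<in> coord_box L U"
  show "y \<in> PiE UNIV (\<lambda>a. if a \<in> L then {1} else if a \<in> U then {0..1} else {0})"
    unfolding PiE_UNIV_domain using boxD(1-4)[OF y] by auto
next
  fix y :: "'b set \<Rightarrow> real"
  assume "y \<in> PiE UNIV (\<lambda>a. if a \<in> L then {1} else if a \<in> U then {0..1} else {0})"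
  then have y: "y a \<in> (if a \<in> L then {1} else if a \<in> U then {0..1} else {0})" for a
    by (simp add: PiE_UNIV_domain Pi_iff)
  have "0 \<le> y a \<and> y a \<le> 1" "a \<in> L \<Longrightarrow> y a = 1" "a \<notin> U \<Longrightarrow> y a = 0" for a
    using y[of a] spans_le[OF assms] by (auto split: if_splits)
  then show "y \<in> coord_box L U"
    unfolding coord_box_def by blast
qed

lemma compact_coord_box:
  assumes "spans L U"
  shows "compact (coord_box L U)"
proof -
  have "compactin (product_topology (\<lambda>_. euclidean) UNIV) (coord_box L U)"
    unfolding coord_box_eq_PiE[OF assms] by (subst compactin_PiE) auto
  then show ?thesis
    by (simp add: euclidean_product_topology)
qed

lemma continuous_on_weight:
  assumes "finite F"
  shows "continuous_on {y :: 'b set \<Rightarrow> real. {a. y a \<noteq> 0} \<subseteq> F} weight"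
proof (rule continuous_on_coordinatewise_then_product)
  fix x
  show "continuous_on {y :: 'b set \<Rightarrow> real. {a. y a \<noteq> 0} \<subseteq> F} (\<lambda>y. weight y x)"
  proof (cases "x \<in> V \<and> s x \<subseteq> F")
    case True
    have "continuous_on {y :: 'b set \<Rightarrow> real. {a. y a \<noteq> 0} \<subseteq> F} (\<lambda>y. \<Prod>a\<in>F. if a \<in> s x then y a else 1 - y a)"
    proof (rule Limits.continuous_on_prod)
      fix a
      have "continuous_on {y :: 'b set \<Rightarrow> real. {a. y a \<noteq> 0} \<subseteq> F} (\<lambda>y. y a)"
        by (rule continuous_on_subset[OF continuous_on_product_coordinates]) simp
      then show "continuous_on {y :: 'b set \<Rightarrow> real. {a. y a \<noteq> 0} \<subseteq> F} (\<lambda>y. if a \<in> s x then y a else 1 - y a)"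
        by (cases "a \<in> s x") (auto intro!: continuous_intros)
    qed
    then show ?thesis
      by (rule continuous_on_eq) (use True weight_eq[OF assms] in auto)
  next
    case False
    have "continuous_on {y :: 'b set \<Rightarrow> real. {a. y a \<noteq> 0} \<subseteq> F} (\<lambda>y. 0 :: real)"
      by (rule continuous_on_const)
    then show ?thesis
      by (rule continuous_on_eq) (use False in \<open>auto simp: weight_def\<close>)
  qed
qed

lemma compact_cube_points:
  assumes "Q \<in> cells"
  shows "compact (cube_points cells Q)"
proof -
  obtain L U where Q: "Q = cell L U" "spans L U"
    using assms unfolding cells_def by blast
  have "continuous_on (coord_box L U) weight"
    by (rule continuous_on_subset[OF continuous_on_weight[OF spans_finite(1)[OF Q(2)]]])
      (use boxD(5) in blast)
  then show ?thesis
    unfolding Q(1) cube_points_cell[OF Q(2)] by (rule compact_continuous_image[OF _ compact_coord_box[OF Q(2)]])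
qed

text \<open>The index set in \<open>coord\<close> varies with the point. On one cube it can be
  enlarged to a fixed finite set of vertices, since the added weights vanish.\<close>

lemma continuous_on_coord:
  assumes span: "spans L U"
  shows "continuous_on (cube_points cells (cell L U)) (\<lambda>w. coord w a)"
proof -
  have "continuous_on (cube_points cells (cell L U)) (\<lambda>w. \<Sum>x\<in>{x \<in> cell L U. a \<in> s x}. w x)"
    by (rule continuous_on_sum) (rule continuous_on_subset[OF continuous_on_product_coordinates], simp)
  moreover have "(\<Sum>x\<in>{x \<in> cell L U. a \<in> s x}. w x) = coord w a"
    if w: "w \<in> cube_points cells (cell L U)" for w
  proof -
    obtain y where y: "w = weight y" "y \<in> coord_box L U"
      using w unfolding cube_points_cell[OF span] by blast
    show ?thesis
      unfolding coord_def
      by (rule sum.mono_neutral_right)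
        (use finite_cell[OF span] weight_box[OF span y(2)] y(1) in auto)
  qed
  ultimately show ?thesis
    by (rule continuous_on_eq)
qed

text \<open>Rounding the fractional coordinates to 0 or 1 in any way preserves the two pairwise
  conditions. Hence all families between the coordinates equal to 1 and the nonzero ones are
  consistent.\<close>

lemma point_of_coordinates:
  assumes "finite {a. y a \<noteq> 0}" and I: "\<And>a. y a \<noteq> 0 \<Longrightarrow> a \<in> I" and y: "\<And>a. 0 \<le> y a \<and> y a \<le> 1"
    and up: "\<And>a b. y a \<noteq> 0 \<Longrightarrow> b \<in> I \<Longrightarrow> a \<subset> b \<Longrightarrow> y b = 1"
    and meet: "\<And>a b. y a \<noteq> 0 \<Longrightarrow> y b \<noteq> 0 \<Longrightarrow> a \<inter> b \<noteq> {}"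
  shows "spans {a. y a = 1} {a. y a \<noteq> 0}" "y \<in> coord_box {a. y a = 1} {a. y a \<noteq> 0}"
proof -
  show "spans {a. y a = 1} {a. y a \<noteq> 0}"
    unfolding spans_def
  proof (intro conjI subsetI)
    fix \<tau>
    assume "\<tau> \<in> {{a. y a = 1}..{a. y a \<noteq> 0}}"
    then have \<tau>: "a \<in> \<tau> \<Longrightarrow> y a \<noteq> 0" "y a = 1 \<Longrightarrow> a \<in> \<tau>" for a
      by auto
    show "\<tau> \<in> consistent_families I"
    proof (rule consistent_familiesI)
      show "finite \<tau>"
        by (rule finite_subset[OF _ assms(1)]) (use \<tau>(1) in blast)
      fix a b
      assume a: "a \<in> \<tau>"
      show "a \<in> I"
        using I \<tau>(1)[OF a] .
      show "b \<in> \<tau>" if "b \<in> I" "a \<subseteq> b"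
        using up[OF \<tau>(1)[OF a] that(1)] \<tau>(2) a that(2) by (cases "a = b") auto
      show "a \<inter> b \<noteq> {}" if "b \<in> \<tau>"
        using meet[OF \<tau>(1)[OF a] \<tau>(1)[OF that]] .
    qed
  qed auto
  show "y \<in> coord_box {a. y a = 1} {a. y a \<noteq> 0}"
    using y unfolding coord_box_def by simp
qed

definition depth :: "'b set \<Rightarrow> nat" where
  "depth a = card {b \<in> I. a \<subseteq> b}"

lemma depth_less:
  assumes "a \<in> I" "b \<in> I" "a \<subset> b"
  shows "depth b < depth a"
  unfolding depth_def
proof (rule psubset_card_mono[OF finite_above[OF assms(1)]], rule psubsetI)
  show "{c \<in> I. b \<subseteq> c} \<subseteq> {c \<in> I. a \<subseteq> c}"
    using assms(3) by auto
  have "a \<in> {c \<in> I. a \<subseteq> c}" "a \<notin> {c \<in> I. b \<subseteq> c}"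
    using assms by auto
  then show "{c \<in> I. b \<subseteq> c} \<noteq> {c \<in> I. a \<subseteq> c}"
    by metis
qed

text \<open>The coordinate of depth \<open>n\<close> is scaled down during the time interval from \<open>1/(n+2)\<close> to \<open>1/(n+1)\<close>.
  A larger set, having smaller depth, begins to move only after all smaller sets have been pushed to
  \<open>0\<close>, so the order relations between the coordinates are preserved.\<close>

definition fade :: "nat \<Rightarrow> real \<Rightarrow> real" where
  "fade n t = max 0 (min 1 ((real n + 2) * (1 - (real n + 1) * t)))"

lemma fade_range: "0 \<le> fade n t" "fade n t \<le> 1"
  by (auto simp: fade_def)

lemma fade_0: "fade n 0 = 1"
  by (simp add: fade_def)

lemma fade_1: "fade n 1 = 0"
proof -
  have "(real n + 2) * (1 - (real n + 1) * 1) \<le> 0"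
    by (intro mult_nonneg_nonpos) auto
  then show ?thesis
    unfolding fade_def by linarith
qed

text \<open>The coordinate of depth \<open>n\<close> reaches 0 at time \<open>1/(n+1)\<close>, and
  that of depth \<open>m\<close> starts at \<open>1/(m+2)\<close>, which is not earlier because
  \<open>m + 2 \<le> n + 1\<close>.\<close>

lemma fade_order:
  assumes "m < n"
  shows "fade n t = 0 \<or> fade m t = 1"
proof (cases "1 \<le> (real n + 1) * t")
  case True
  then have "(real n + 2) * (1 - (real n + 1) * t) \<le> 0"
    by (intro mult_nonneg_nonpos) auto
  then show ?thesis
    by (simp add: fade_def)
next
  case False
  have "(real m + 2) * t \<le> 1"
  proof (cases "0 \<le> t")
    case True
    have "(real m + 2) * t \<le> (real n + 1) * t"
      using assms True by (intro mult_right_mono) auto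
    then show ?thesis
      using False by simp
  next
    case False
    then have "(real m + 2) * t \<le> 0"
      by (intro mult_nonneg_nonpos) auto
    then show ?thesis
      by simp
  qed
  then have "(real m + 1) * ((real m + 2) * t) \<le> (real m + 1) * 1"
    by (intro mult_left_mono) auto
  then have "1 \<le> (real m + 2) * (1 - (real m + 1) * t)"
    by (simp add: algebra_simps)
  then show ?thesis
    by (simp add: fade_def)
qed

definition contract :: "real \<times> ('v \<Rightarrow> real) \<Rightarrow> 'v \<Rightarrow> real" where
  "contract z = weight (\<lambda>a. fade (depth a) (fst z) * coord (snd z) a)"

text \<open>Scaling creates no new nonzero coordinates, so meeting is inherited. If a scaled
  coordinate is still nonzero, those of all larger sets have not begun to move and keep the value
  1.\<close>

lemma contract_point:
  assumes span: "spans L U" and y: "y \<in> coord_box L U"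
  shows "\<exists>L' U'. U' \<subseteq> U \<and> spans L' U' \<and> contract (t, weight y) \<in> cube_points cells (cell L' U')"
    "{a. fade (depth a) t * coord (weight y) a \<noteq> 0} \<subseteq> U"
proof -
  let ?y = "\<lambda>a. fade (depth a) t * y a"
  have eq: "(\<lambda>a. fade (depth a) t * coord (weight y) a) = ?y"
    using coord_weight[OF span y] by auto
  have sub: "{a. ?y a \<noteq> 0} \<subseteq> U"
    using boxD(5)[OF y] by auto
  then show "{a. fade (depth a) t * coord (weight y) a \<noteq> 0} \<subseteq> U"
    unfolding coord_weight[OF span y] .
  have U: "U \<in> consistent_families I"
    using spans_in[OF span spans_le[OF span]] by simp
  have I: "a \<in> I" "y a \<noteq> 0" "a \<in> U" if "?y a \<noteq> 0" for a
    using consistent_familiesD(2)[OF U] sub that by auto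
  have range: "0 \<le> ?y a \<and> ?y a \<le> 1" for a
    using fade_range boxD(1,2)[OF y] by (auto intro: mult_le_one)
  have up: "?y b = 1" if a: "?y a \<noteq> 0" and b: "b \<in> I" "a \<subset> b" for a b
  proof -
    have "fade (depth b) t = 1"
      using fade_order[OF depth_less[OF I(1)[OF a] b], of t] a by auto
    moreover have "y b = 1"
      using boxD(3)[OF y spans_above[OF span I(3)[OF a] b]] .
    ultimately show ?thesis
      by simp
  qed
  have meet: "a \<inter> b \<noteq> {}" if "?y a \<noteq> 0" "?y b \<noteq> 0" for a b
    using consistent_familiesD(4)[OF U I(3)[OF that(1)] I(3)[OF that(2)]] .
  have fin: "finite {a. ?y a \<noteq> 0}"
    by (rule finite_subset[OF sub spans_finite(1)[OF span]])
  have *: "spans {a. ?y a = 1} {a. ?y a \<noteq> 0}" "?y \<in> coord_box {a. ?y a = 1} {a. ?y a \<noteq> 0}"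
    by (rule point_of_coordinates; fact fin I(1) range up meet)+
  have "contract (t, weight y) = weight ?y"
    unfolding contract_def fst_conv snd_conv eq ..
  then have "contract (t, weight y) \<in> cube_points cells (cell {a. ?y a = 1} {a. ?y a \<noteq> 0})"
    unfolding cube_points_cell[OF *(1)] using *(2) by (intro image_eqI)
  then show "\<exists>L' U'. U' \<subseteq> U \<and> spans L' U' \<and> contract (t, weight y) \<in> cube_points cells (cell L' U')"
    using *(1) sub by (intro exI conjI)
qed

lemma continuous_contract:
  "continuous_map (prod_topology (top_of_set {0..1}) (realization_topology cells)) (realization_topology cells) contract"
proof (rule continuous_map_prod_realization)
  show "locally_compact_space (top_of_set {0..1::real})"
    by (simp add: compact_imp_locally_compact_space compact_space_subtopology)
  show "Hausdorff_space (top_of_set {0..1::real})"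
    by (simp add: Hausdorff_space_subtopology)
  fix Q
  assume "Q \<in> cells"
  then obtain L U where Q: "Q = cell L U" "spans L U"
    unfolding cells_def by blast
  let ?X = "{0..1} \<times> cube_points cells Q"
  \<comment> \<open>The whole homotopy keeps \<open>Q\<close> inside these finitely many cubes, so
    continuity can be checked on weights.\<close>
  let ?F = "(\<lambda>(L, U). cell L U) ` {(L', U'). U' \<subseteq> U \<and> spans L' U'}"
  have "{(L', U'). U' \<subseteq> U \<and> spans L' U'} \<subseteq> Pow U \<times> Pow U"
    using spans_le by blast
  then have fin: "finite ?F"
    using spans_finite(1)[OF Q(2)] by (intro finite_imageI) (rule finite_subset, auto intro!: finite_cartesian_product)
  have sub: "(\<lambda>(z :: real \<times> ('v \<Rightarrow> real)) a. fade (depth a) (fst z) * coord (snd z) a) ` ?X \<subseteq> {y. {a. y a \<noteq> 0} \<subseteq> U}"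
  proof (rule image_subsetI)
    fix z :: "real \<times> ('v \<Rightarrow> real)"
    assume "z \<in> ?X"
    then obtain y where "snd z = weight y" "y \<in> coord_box L U"
      unfolding Q(1) cube_points_cell[OF Q(2)] by auto
    then show "(\<lambda>a. fade (depth a) (fst z) * coord (snd z) a) \<in> {y :: 'b set \<Rightarrow> real. {a. y a \<noteq> 0} \<subseteq> U}"
      using contract_point(2)[OF Q(2), of y "fst z"] by simp
  qed
  have "continuous_on ?X (\<lambda>z a. fade (depth a) (fst z) * coord (snd z) a)"
  proof (rule continuous_on_coordinatewise_then_product)
    fix a
    have "continuous_on ?X (\<lambda>z. coord (snd z) a)"
      by (rule continuous_on_compose2[OF continuous_on_coord[OF Q(2)]]) (auto simp: Q(1) intro: continuous_on_snd[OF continuous_on_id])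
    then show "continuous_on ?X (\<lambda>z. fade (depth a) (fst z) * coord (snd z) a)"
      unfolding fade_def by (intro continuous_intros)
  qed
  then have "continuous_on ?X contract"
    unfolding contract_def
    by (rule continuous_on_compose2[OF continuous_on_weight[OF spans_finite(1)[OF Q(2)]] _ sub])
  then have "continuous_map (top_of_set ?X) euclidean contract"
    by simp
  moreover have "contract ` ?X \<subseteq> (\<Union>Q\<in>?F. cube_points cells Q)"
  proof (rule image_subsetI)
    fix z :: "real \<times> ('v \<Rightarrow> real)"
    assume "z \<in> ?X"
    then obtain y where z: "z = (fst z, weight y)" "y \<in> coord_box L U"
      unfolding Q(1) cube_points_cell[OF Q(2)] by auto
    obtain L' U' where "U' \<subseteq> U" "spans L' U'" "contract z \<in> cube_points cells (cell L' U')"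
      using contract_point(1)[OF Q(2) z(2), of "fst z"] unfolding z(1)[symmetric] by blast
    then show "contract z \<in> (\<Union>Q\<in>?F. cube_points cells Q)"
      by blast
  qed
  ultimately have "continuous_map (top_of_set ?X) (realization_topology cells) contract"
    using fin by (intro continuous_map_into_realization[of ?F]) (auto intro: cell_in_cells compact_cube_points)
  moreover have "prod_topology (top_of_set {0..1}) (top_of_set (cube_points cells Q)) = top_of_set ?X"
    by (metis prod_topology_subtopology_eu)
  ultimately show "continuous_map (prod_topology (top_of_set {0..1}) (top_of_set (cube_points cells Q)))
      (realization_topology cells) contract"
    by simp
qed

lemma simply_connected_cells: "simply_connected_space (realization_topology cells)"
proof (rule simply_connected_space_of_contraction[OF _ continuous_contract])
  have "{} \<in> consistent_families I"
    by (rule consistent_familiesI) auto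
  then have "weight (\<lambda>_. 0) \<in> realization cells"
    by (intro realizationI[OF spans_singleton]) (auto simp: coord_box_def)
  then show "weight (\<lambda>_. 0) \<in> topspace (realization_topology cells)"
    by simp
  fix w
  assume "w \<in> topspace (realization_topology cells)"
  then have "w \<in> realization cells"
    by simp
  then obtain L U y where y: "spans L U" "y \<in> coord_box L U" "w = weight y"
    by (rule realizationE)
  show "contract (0, w) = w"
    unfolding contract_def using coord_weight[OF y(1,2)] y(3) by (simp add: fade_0)
  show "contract (1, w) = weight (\<lambda>_. 0)"
    unfolding contract_def by (simp add: fade_1)
qed

lemma cat0_cells: "cat0_cube_complex cells"
  unfolding cat0_cube_complex_def Union_cells
  using cube_complex_cells simply_connected_cells flag_link by blast

subsection \<open>Hyperplanes\<close>

definition hyper :: "'b set \<Rightarrow> ('v \<Rightarrow> real) set" where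
  "hyper a = {w \<in> realization cells. coord w a = 1/2}"

lemma hyper_Int_cell:
  assumes span: "spans L U"
  shows "hyper a \<inter> cube_points cells (cell L U) = weight ` {y \<in> coord_box L U. y a = 1/2}"
proof (intro subset_antisym subsetI)
  fix w
  assume w: "w \<in> hyper a \<inter> cube_points cells (cell L U)"
  then obtain y where y: "w = weight y" "y \<in> coord_box L U"
    unfolding cube_points_cell[OF span] by blast
  have "y a = 1/2"
    using w coord_weight[OF span y(2)] unfolding hyper_def y(1) by simp
  then show "w \<in> weight ` {y \<in> coord_box L U. y a = 1/2}"
    using y by blast
next
  fix w
  assume "w \<in> weight ` {y \<in> coord_box L U. y a = 1/2}"
  then obtain y where y: "w = weight y" "y \<in> coord_box L U" "y a = 1/2"
    by blast
  then show "w \<in> hyper a \<inter> cube_points cells (cell L U)"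
    using realizationI[OF span y(2)] coord_weight[OF span y(2)]
    unfolding cube_points_cell[OF span] hyper_def by simp
qed

text \<open>For \<open>a\<close> in \<open>I\<close>, the smallest consistent family containing
  \<open>a\<close>; it is the upper end of the lowest edge crossing the hyperplane of
  \<open>a\<close>.\<close>

definition up_closure :: "'b set \<Rightarrow> 'b set set" where
  "up_closure a = {b \<in> I. a \<subseteq> b}"

lemma up_closure_in:
  assumes "a \<in> I"
  shows "up_closure a \<in> consistent_families I"
proof (rule consistent_familiesI)
  show "finite (up_closure a)"
    unfolding up_closure_def by (rule finite_above[OF assms])
  have "a \<noteq> {}"
    using assms nonempty by blast
  then show "b \<inter> c \<noteq> {}" if "b \<in> up_closure a" "c \<in> up_closure a" for b c
    using that unfolding up_closure_def by blast
qed (auto simp: up_closure_def)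

lemma up_closure_subset: "\<tau> \<in> consistent_families I \<Longrightarrow> a \<in> \<tau> \<Longrightarrow> up_closure a \<subseteq> \<tau>"
  unfolding up_closure_def using consistent_familiesD(3) by blast

text \<open>An edge crossing the hyperplane of \<open>a\<close>, named by its end that contains
  \<open>a\<close>.\<close>

definition dual_edge :: "'b set \<Rightarrow> 'b set set \<Rightarrow> bool" where
  "dual_edge a \<tau> \<longleftrightarrow> a \<in> \<tau> \<and> spans (\<tau> - {a}) \<tau>"

lemma dual_edge_iff:
  "dual_edge a \<tau> \<longleftrightarrow> a \<in> \<tau> \<and> \<tau> \<in> consistent_families I \<and> \<tau> - {a} \<in> consistent_families I"
proof
  assume "dual_edge a \<tau>"
  then show "a \<in> \<tau> \<and> \<tau> \<in> consistent_families I \<and> \<tau> - {a} \<in> consistent_families I"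
    unfolding dual_edge_def by (meson Diff_subset order_refl spans_in)
next
  assume *: "a \<in> \<tau> \<and> \<tau> \<in> consistent_families I \<and> \<tau> - {a} \<in> consistent_families I"
  then have "{\<tau> - {a}..\<tau>} = {\<tau> - {a}, \<tau>}"
    using interval_insert[of "\<tau> - {a}" a] by (simp add: insert_absorb)
  then show "dual_edge a \<tau>"
    using * unfolding dual_edge_def spans_def by simp
qed

lemma dual_edge_up_closure:
  assumes "a \<in> I"
  shows "dual_edge a (up_closure a)"
  unfolding dual_edge_iff
proof (intro conjI)
  show "a \<in> up_closure a"
    using assms by (simp add: up_closure_def)
  show "up_closure a - {a} \<in> consistent_families I"
    by (rule consistent_families_remove[OF up_closure_in[OF assms]]) (auto simp: up_closure_def)
qed (rule up_closure_in[OF assms])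

text \<open>Minimality of \<open>b\<close> allows its removal from both ends of the edge, so the
  edge and its translate are opposite sides of a square.\<close>

lemma dual_edge_square:
  assumes edge: "dual_edge a \<tau>" and b: "b \<in> \<tau>" "b \<noteq> a" and minimal: "\<And>c. c \<in> \<tau> \<Longrightarrow> \<not> c \<subset> b"
  shows "dual_edge a (\<tau> - {b})" "spans (\<tau> - {a, b}) \<tau>"
proof -
  have a: "a \<in> \<tau>" and \<tau>: "\<tau> \<in> consistent_families I" "\<tau> - {a} \<in> consistent_families I"
    using edge unfolding dual_edge_iff by iprover+
  have \<tau>b: "\<tau> - {b} \<in> consistent_families I"
    by (rule consistent_families_remove[OF \<tau>(1) minimal])
  have \<tau>ab: "\<tau> - {a} - {b} \<in> consistent_families I"
    by (rule consistent_families_remove[OF \<tau>(2)]) (use minimal in blast)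
  show "dual_edge a (\<tau> - {b})"
    unfolding dual_edge_iff using a b(2) \<tau>b \<tau>ab by (simp add: Diff_insert2[symmetric] insert_commute)
  show "spans (\<tau> - {a, b}) \<tau>"
    unfolding spans_def
  proof (intro conjI subsetI)
    fix \<sigma>
    assume \<sigma>: "\<sigma> \<in> {\<tau> - {a, b}..\<tau>}"
    consider "\<sigma> = \<tau>" | "\<sigma> = \<tau> - {a}" | "\<sigma> = \<tau> - {b}" | "\<sigma> = \<tau> - {a} - {b}"
    proof -
      have "\<tau> - {a, b} \<subseteq> \<sigma>" "\<sigma> \<subseteq> \<tau>"
        using \<sigma> by simp_all
      then have "\<sigma> = \<tau> - ({a, b} - \<sigma>)"
        by blast
      moreover have "{a, b} - \<sigma> = {} \<or> {a, b} - \<sigma> = {a} \<or> {a, b} - \<sigma> = {b} \<or> {a, b} - \<sigma> = {a, b}"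
        by (cases "a \<in> \<sigma>"; cases "b \<in> \<sigma>") auto
      ultimately show thesis
        using that by (metis Diff_empty Diff_insert2)
    qed
    then show "\<sigma> \<in> consistent_families I"
      using \<tau> \<tau>b \<tau>ab by cases simp_all
  qed auto
qed

text \<open>The midpoint of an edge lies in a midcube of a larger cube only if the midcube is parallel to that
  edge's dual direction, because its other coordinates are \<open>0\<close> or \<open>1\<close>.\<close>

lemma midcube_extend:
  assumes H: "meets_in_midcubes cells H" and edge: "dual_edge a \<tau>"
    and half: "weight ` {y \<in> coord_box (\<tau> - {a}) \<tau>. y a = 1/2} \<subseteq> H"
    and span: "spans L U" and sub: "L \<subseteq> \<tau> - {a}" "\<tau> \<subseteq> U"
  shows "H \<inter> cube_points cells (cell L U) = weight ` {y \<in> coord_box L U. y a = 1/2}"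
proof -
  let ?y = "\<lambda>c. if c = a then 1/2 else if c \<in> \<tau> then 1 else 0 :: real"
  have a: "a \<in> \<tau>"
    using edge unfolding dual_edge_def by iprover
  have "?y \<in> coord_box (\<tau> - {a}) \<tau>"
    using a unfolding coord_box_def by auto
  then have "weight ?y \<in> H"
    by (intro subsetD[OF half] imageI CollectI conjI) simp_all
  moreover have y: "?y \<in> coord_box L U"
    using a sub unfolding coord_box_def by auto
  then have "weight ?y \<in> cube_points cells (cell L U)"
    unfolding cube_points_cell[OF span] by (rule imageI)
  ultimately have mem: "weight ?y \<in> H \<inter> cube_points cells (cell L U)"
    by (rule IntI)
  moreover have "H \<inter> cube_points cells (cell L U) = {} \<or> midcube cells (cell L U) (H \<inter> cube_points cells (cell L U))"
    using H cell_in_cells[OF span] unfolding meets_in_midcubes_def by blast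
  ultimately have "midcube cells (cell L U) (H \<inter> cube_points cells (cell L U))"
    by (elim disjE) (simp_all only: empty_iff)
  then obtain b where b: "b \<in> U - L"
    "H \<inter> cube_points cells (cell L U) = weight ` {y \<in> coord_box L U. y b = 1/2}"
    unfolding midcube_cell_iff[OF span] by (elim bexE)
  obtain y' where y': "weight ?y = weight y'" "y' \<in> coord_box L U" "y' b = 1/2"
    using mem unfolding b(2) by (elim imageE CollectE conjE)
  have "?y b = 1/2"
    using fun_cong[OF weight_inject[OF span y span y'(2) y'(1)], of b] y'(3) by (rule trans)
  then have "b = a"
    by (auto split: if_splits)
  then show ?thesis
    using b(2) by simp
qed

lemma coord_box_mono: "L \<subseteq> L' \<Longrightarrow> U' \<subseteq> U \<Longrightarrow> coord_box L' U' \<subseteq> coord_box L U"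
  unfolding coord_box_def by blast

lemma midcube_restrict:
  assumes "weight ` {y \<in> coord_box L U. y a = 1/2} \<subseteq> H" "L \<subseteq> L'" "U' \<subseteq> U"
  shows "weight ` {y \<in> coord_box L' U'. y a = 1/2} \<subseteq> H"
  using assms(1) coord_box_mono[OF assms(2,3)] by blast

text \<open>Hyperplanes are connected through squares: removing minimal members leads from any edge dual to
  \<open>a\<close> to the lowest one.\<close>

lemma dual_edge_propagate:
  assumes H: "meets_in_midcubes cells H" and edge: "dual_edge a \<tau>"
  shows "weight ` {y \<in> coord_box (\<tau> - {a}) \<tau>. y a = 1/2} \<subseteq> H \<longleftrightarrow>
    weight ` {y \<in> coord_box (up_closure a - {a}) (up_closure a). y a = 1/2} \<subseteq> H"
  using edge
proof (induction "card (\<tau> - up_closure a)" arbitrary: \<tau> rule: less_induct)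
  case less
  have a: "a \<in> \<tau>" and \<tau>: "\<tau> \<in> consistent_families I" "\<tau> - {a} \<in> consistent_families I"
    using less.prems unfolding dual_edge_iff by iprover+
  have up: "up_closure a \<subseteq> \<tau>"
    by (rule up_closure_subset[OF \<tau>(1) a])
  show ?case
  proof (cases "\<tau> = up_closure a")
    case False
    have fin: "finite (\<tau> - up_closure a)"
      using consistent_familiesD(1)[OF \<tau>(1)] by simp
    moreover have "\<tau> - up_closure a \<noteq> {}"
      using False up by blast
    ultimately obtain b where b: "b \<in> \<tau> - up_closure a"
      and min: "\<And>c. c \<in> \<tau> - up_closure a \<Longrightarrow> c \<le> b \<Longrightarrow> b = c"
      using finite_has_minimal by metis
    \<comment> \<open>Minimality outside \<open>up_closure a\<close> implies minimality in \<tau>: a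
      member of \<open>up_closure a\<close> below \<open>b\<close> would put \<open>b\<close> into
      \<open>up_closure a\<close> as well.\<close>
    have "\<not> c \<subset> b" if c: "c \<in> \<tau>" for c
    proof
      assume cb: "c \<subset> b"
      have "b \<in> I"
        using b consistent_familiesD(2)[OF \<tau>(1)] by simp
      then have "c \<notin> up_closure a"
        using b cb unfolding up_closure_def by auto
      then show False
        using min[of c] c cb by blast
    qed
    moreover have "b \<noteq> a" "b \<in> \<tau>"
      using b a consistent_familiesD(2)[OF \<tau>(1) a] by (auto simp: up_closure_def)
    ultimately have sq: "dual_edge a (\<tau> - {b})" "spans (\<tau> - {a, b}) \<tau>"
      using dual_edge_square[OF less.prems] by metis+
    have "\<tau> - {b} - up_closure a \<subset> \<tau> - up_closure a"
      using b by blast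
    then have "card (\<tau> - {b} - up_closure a) < card (\<tau> - up_closure a)"
      by (rule psubset_card_mono[OF fin])
    note IH = less.hyps[OF this sq(1)]
    let ?sq = "weight ` {y \<in> coord_box (\<tau> - {a, b}) \<tau>. y a = 1/2}"
    have "weight ` {y \<in> coord_box (\<tau> - {b} - {a}) (\<tau> - {b}). y a = 1/2} \<subseteq> H \<longleftrightarrow> ?sq \<subseteq> H"
    proof
      assume "weight ` {y \<in> coord_box (\<tau> - {b} - {a}) (\<tau> - {b}). y a = 1/2} \<subseteq> H"
      from midcube_extend[OF H sq(1) this sq(2)] show "?sq \<subseteq> H"
        by blast
    next
      assume "?sq \<subseteq> H"
      then show "weight ` {y \<in> coord_box (\<tau> - {b} - {a}) (\<tau> - {b}). y a = 1/2} \<subseteq> H"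
        by (rule midcube_restrict) blast+
    qed
    moreover have "weight ` {y \<in> coord_box (\<tau> - {a}) \<tau>. y a = 1/2} \<subseteq> H \<longleftrightarrow> ?sq \<subseteq> H"
    proof
      assume "weight ` {y \<in> coord_box (\<tau> - {a}) \<tau>. y a = 1/2} \<subseteq> H"
      from midcube_extend[OF H less.prems this sq(2)] show "?sq \<subseteq> H"
        by blast
    next
      assume "?sq \<subseteq> H"
      then show "weight ` {y \<in> coord_box (\<tau> - {a}) \<tau>. y a = 1/2} \<subseteq> H"
        by (rule midcube_restrict) blast+
    qed
    ultimately show ?thesis
      using IH by iprover
  qed simp
qed

lemma meets_hyper:
  assumes "a \<in> I"
  shows "meets_in_midcubes cells (hyper a)"
  unfolding meets_in_midcubes_def
proof (intro conjI ballI)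
  show "hyper a \<subseteq> realization cells"
    unfolding hyper_def by blast
  let ?U = "up_closure a"
  let ?y = "\<lambda>c. if c = a then 1/2 else if c \<in> ?U then 1 else 0 :: real"
  have edge: "a \<in> ?U" "spans (?U - {a}) ?U"
    using dual_edge_up_closure[OF assms] unfolding dual_edge_def by iprover+
  have "?y \<in> {y \<in> coord_box (?U - {a}) ?U. y a = 1/2}"
    using edge(1) unfolding coord_box_def by auto
  then have "weight ?y \<in> hyper a \<inter> cube_points cells (cell (?U - {a}) ?U)"
    unfolding hyper_Int_cell[OF edge(2)] by (rule imageI)
  then show "hyper a \<noteq> {}"
    by blast
  fix Q
  assume "Q \<in> cells"
  then obtain L U where Q: "Q = cell L U" "spans L U"
    unfolding cells_def by blast
  show "hyper a \<inter> cube_points cells Q = {} \<or> midcube cells Q (hyper a \<inter> cube_points cells Q)"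
  proof (cases "a \<in> U - L")
    case True
    then show ?thesis
      unfolding Q(1) hyper_Int_cell[OF Q(2)] midcube_cell_iff[OF Q(2)] by blast
  next
    case False
    then have "{y \<in> coord_box L U. y a = 1/2} = {}"
      using boxD(3,4) by fastforce
    then show ?thesis
      unfolding Q(1) hyper_Int_cell[OF Q(2)] by simp
  qed
qed

text \<open>A point of \<open>H\<close> lies in a midcube of some direction \<open>a\<close>.
  Through squares \<open>H\<close> then crosses the lowest edge dual to \<open>a\<close>, from there
  all edges dual to \<open>a\<close>, and hence fills the midcube of direction \<open>a\<close> in
  every cube that has this direction.\<close>

lemma hyper_subset:
  assumes H: "meets_in_midcubes cells H"
  shows "\<exists>a\<in>I. hyper a \<subseteq> H"
proof -
  obtain w where w: "w \<in> H" "w \<in> realization cells"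
    using H unfolding meets_in_midcubes_def by blast
  then obtain L U y where "spans L U" "y \<in> coord_box L U" "w = weight y"
    by (elim realizationE)
  then have LU: "spans L U" "w \<in> cube_points cells (cell L U)"
    using cube_points_cell by auto
  have "H \<inter> cube_points cells (cell L U) = {} \<or> midcube cells (cell L U) (H \<inter> cube_points cells (cell L U))"
    using H cell_in_cells[OF LU(1)] unfolding meets_in_midcubes_def by blast
  then have "midcube cells (cell L U) (H \<inter> cube_points cells (cell L U))"
    using w(1) LU(2) by blast
  then obtain a where a: "a \<in> U - L"
    and mid: "H \<inter> cube_points cells (cell L U) = weight ` {y \<in> coord_box L U. y a = 1/2}"
    unfolding midcube_cell_iff[OF LU(1)] by (elim bexE)
  have edge: "dual_edge a (insert a L')" "insert a L' - {a} = L'"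
    if "spans L' U'" "a \<in> U' - L'" for L' U'
  proof -
    show "insert a L' - {a} = L'"
      using that(2) by simp
    moreover have "spans L' (insert a L')"
      by (rule spans_subset[OF that(1)]) (use that(2) spans_le[OF that(1)] in auto)
    ultimately show "dual_edge a (insert a L')"
      unfolding dual_edge_def by simp
  qed
  have "a \<in> I"
    using a consistent_familiesD(2)[OF spans_in[OF LU(1) spans_le[OF LU(1)] order_refl]] by simp
  moreover have "hyper a \<subseteq> H"
  proof
    fix w'
    assume w': "w' \<in> hyper a"
    then have "w' \<in> realization cells" and half: "coord w' a = 1/2"
      unfolding hyper_def by simp_all
    then obtain L' U' y where y: "spans L' U'" "y \<in> coord_box L' U'" "w' = weight y"
      by (elim realizationE)
    have ya: "y a = 1/2"
      using half coord_weight[OF y(1,2)] y(3) by simp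
    then have a': "a \<in> U' - L'"
      using boxD(3,4)[OF y(2), of a] by auto
    have "weight ` {y \<in> coord_box (insert a L - {a}) (insert a L). y a = 1/2} \<subseteq> H"
      by (rule midcube_restrict[of L U]) (use mid a spans_le[OF LU(1)] in auto)
    then have "weight ` {y \<in> coord_box (insert a L' - {a}) (insert a L'). y a = 1/2} \<subseteq> H"
      using dual_edge_propagate[OF H edge(1)[OF LU(1) a]] dual_edge_propagate[OF H edge(1)[OF y(1) a']]
      by iprover
    then have "H \<inter> cube_points cells (cell L' U') = weight ` {y \<in> coord_box L' U'. y a = 1/2}"
      by (rule midcube_extend[OF H edge(1)[OF y(1) a'] _ y(1)]) (use a' spans_le[OF y(1)] in auto)
    moreover have "w' \<in> weight ` {y \<in> coord_box L' U'. y a = 1/2}"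
      using y(2,3) ya by blast
    ultimately show "w' \<in> H"
      by blast
  qed
  ultimately show ?thesis
    by blast
qed

text \<open>At the midpoint of the lowest edge dual to \<open>a\<close>, every other coordinate is 0
  or 1.\<close>

lemma hyper_inject:
  assumes "a \<in> I" and sub: "hyper a \<subseteq> hyper b"
  shows "a = b"
proof -
  let ?U = "up_closure a"
  let ?y = "\<lambda>c. if c = a then 1/2 else if c \<in> ?U then 1 else 0 :: real"
  have edge: "a \<in> ?U" "spans (?U - {a}) ?U"
    using dual_edge_up_closure[OF assms(1)] unfolding dual_edge_def by iprover+
  have y: "?y \<in> coord_box (?U - {a}) ?U"
    using edge(1) unfolding coord_box_def by auto
  have "weight ?y \<in> hyper a"
    using realizationI[OF edge(2) y] coord_weight[OF edge(2) y] unfolding hyper_def by simp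
  then have "coord (weight ?y) b = 1/2"
    using sub unfolding hyper_def by blast
  then have "?y b = 1/2"
    unfolding coord_weight[OF edge(2) y] .
  then show ?thesis
    by (auto split: if_splits)
qed

text \<open>Every set meeting the cubes in midcubes contains some \<open>hyper a\<close>, and these
  sets are pairwise incomparable, so they are the minimal ones.\<close>

lemma hyperplane_cells_iff: "hyperplane cells H \<longleftrightarrow> (\<exists>a\<in>I. H = hyper a)"
proof
  assume H: "hyperplane cells H"
  then obtain a where a: "a \<in> I" "hyper a \<subseteq> H"
    using hyper_subset unfolding hyperplane_def by blast
  then show "\<exists>a\<in>I. H = hyper a"
    using H meets_hyper[OF a(1)] unfolding hyperplane_def by metis
next
  assume "\<exists>a\<in>I. H = hyper a"
  then obtain a where a: "a \<in> I" "H = hyper a"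
    by (elim bexE)
  have "H' = H" if H': "meets_in_midcubes cells H'" "H' \<subseteq> H" for H'
  proof -
    obtain b where b: "b \<in> I" "hyper b \<subseteq> H'"
      using hyper_subset[OF H'(1)] by (elim bexE)
    then have "b = a"
      using hyper_inject[OF b(1), of a] H'(2) a(2) by (metis subset_trans)
    then show ?thesis
      using b(2) H'(2) a(2) by (metis subset_antisym)
  qed
  then show "hyperplane cells H"
    using meets_hyper[OF a(1)] a(2) unfolding hyperplane_def by metis
qed

end

section \<open>The dual complex as a complex of consistent families\<close>

locale wallspace =
  fixes M :: "'a topology" and \<D> :: "'a division set" and t\<^sub>0 :: "'a set"
  assumes base: "t\<^sub>0 \<in> triples M \<D>"
    and wall_pair: "D \<in> \<D> \<Longrightarrow> \<exists>A. wall M \<D> D = {A, triples M \<D> - A} \<and> A \<subseteq> triples M \<D> \<and> A \<noteq> {} \<and> A \<noteq> triples M \<D>"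
    and finite_separating: "t \<in> triples M \<D> \<Longrightarrow> u \<in> triples M \<D> \<Longrightarrow> finite {A \<in> halfspaces M \<D>. t \<in> A \<and> u \<notin> A}"
begin

abbreviation T :: "'a set set" where
  "T \<equiv> triples M \<D>"

abbreviation \<H> :: "'a set set set" where
  "\<H> \<equiv> halfspaces M \<D>"

definition away :: "'a set set set" where
  "away = {A \<in> \<H>. t\<^sub>0 \<notin> A}"

definition trace :: "'a set set set \<Rightarrow> 'a set set set" where
  "trace \<alpha> = {A \<in> \<alpha>. t\<^sub>0 \<notin> A}"

section \<open>Ultrafilters and their traces away from the base triple\<close>

lemma halfspaceE:
  assumes "A \<in> \<H>"
  obtains D where "D \<in> \<D>" "wall M \<D> D = {A, T - A}" "A \<subseteq> T" "A \<noteq> {}" "A \<noteq> T"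
proof -
  obtain D where D: "D \<in> \<D>" "A \<in> wall M \<D> D"
    using assms unfolding halfspaces_def by blast
  obtain B where B: "wall M \<D> D = {B, T - B}" "B \<subseteq> T" "B \<noteq> {}" "B \<noteq> T"
    using wall_pair[OF D(1)] by (elim exE conjE)
  have TB: "T - (T - B) = B" "T - B \<noteq> {}" "T - B \<noteq> T"
    using B(2-4) by blast+
  have "A = B \<or> A = T - B"
    using D(2) unfolding B(1) by simp
  then show thesis
  proof
    assume "A = B"
    then show thesis
      using that[OF D(1)] B by simp
  next
    assume A: "A = T - B"
    show thesis
    proof (rule that[OF D(1)])
      show "wall M \<D> D = {A, T - A}"
        unfolding A B(1) TB(1) by (rule insert_commute)
    qed (unfold A, rule Diff_subset, fact TB(2), fact TB(3))
  qed
qed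

lemma halfspace_subset: "A \<in> \<H> \<Longrightarrow> A \<subseteq> T" "A \<in> \<H> \<Longrightarrow> A \<noteq> {}" "A \<in> \<H> \<Longrightarrow> A \<noteq> T"
  by (erule halfspaceE, assumption)+

lemma halfspace_compl: "A \<in> \<H> \<Longrightarrow> T - A \<in> \<H>"
  by (erule halfspaceE) (auto simp: halfspaces_def)

lemma compl_compl: "A \<in> \<H> \<Longrightarrow> T - (T - A) = A"
  using halfspace_subset(1) by blast

lemma ultrafilter_iff:
  "wall_ultrafilter M \<D> \<alpha> \<longleftrightarrow> \<alpha> \<subseteq> \<H> \<and> (\<forall>A\<in>\<H>. T - A \<in> \<alpha> \<longleftrightarrow> A \<notin> \<alpha>) \<and> (\<forall>A\<in>\<alpha>. \<forall>B\<in>\<H>. A \<subseteq> B \<longrightarrow> B \<in> \<alpha>)"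
proof -
  have one: "(\<exists>!B. B \<in> {A, T - A} \<and> B \<in> \<alpha>) \<longleftrightarrow> (T - A \<in> \<alpha> \<longleftrightarrow> A \<notin> \<alpha>)" if "A \<in> \<H>" for A
  proof -
    have "A \<noteq> T - A"
      using halfspace_subset[OF that] by blast
    then show ?thesis
      unfolding insert_iff empty_iff by metis
  qed
  have "(\<forall>D\<in>\<D>. \<exists>!A. A \<in> wall M \<D> D \<and> A \<in> \<alpha>) \<longleftrightarrow> (\<forall>A\<in>\<H>. T - A \<in> \<alpha> \<longleftrightarrow> A \<notin> \<alpha>)"
  proof
    assume D: "\<forall>D\<in>\<D>. \<exists>!A. A \<in> wall M \<D> D \<and> A \<in> \<alpha>"
    show "\<forall>A\<in>\<H>. T - A \<in> \<alpha> \<longleftrightarrow> A \<notin> \<alpha>"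
    proof
      fix A
      assume A: "A \<in> \<H>"
      then obtain D' where D': "D' \<in> \<D>" "wall M \<D> D' = {A, T - A}"
        by (rule halfspaceE)
      have "\<exists>!B. B \<in> {A, T - A} \<and> B \<in> \<alpha>"
        using D[rule_format, OF D'(1)] unfolding D'(2) .
      then show "T - A \<in> \<alpha> \<longleftrightarrow> A \<notin> \<alpha>"
        unfolding one[OF A] .
    qed
  next
    assume *: "\<forall>A\<in>\<H>. T - A \<in> \<alpha> \<longleftrightarrow> A \<notin> \<alpha>"
    show "\<forall>D\<in>\<D>. \<exists>!A. A \<in> wall M \<D> D \<and> A \<in> \<alpha>"
    proof
      fix D
      assume D: "D \<in> \<D>"
      then obtain A where A: "wall M \<D> D = {A, T - A}"
        using wall_pair by blast
      then have "A \<in> \<H>"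
        using D unfolding halfspaces_def by blast
      then show "\<exists>!A. A \<in> wall M \<D> D \<and> A \<in> \<alpha>"
        unfolding A one[OF \<open>A \<in> \<H>\<close>] using * by blast
    qed
  qed
  then show ?thesis
    unfolding wall_ultrafilter_def by simp
qed

lemma ultrafilterD:
  assumes "wall_ultrafilter M \<D> \<alpha>"
  shows "A \<in> \<alpha> \<Longrightarrow> A \<in> \<H>" "A \<in> \<H> \<Longrightarrow> T - A \<in> \<alpha> \<longleftrightarrow> A \<notin> \<alpha>" "A \<in> \<alpha> \<Longrightarrow> B \<in> \<H> \<Longrightarrow> A \<subseteq> B \<Longrightarrow> B \<in> \<alpha>"
  using assms unfolding ultrafilter_iff by blast+

lemma trace_iff: "A \<in> trace \<alpha> \<longleftrightarrow> A \<in> \<alpha> \<and> t\<^sub>0 \<notin> A"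
  by (simp add: trace_def)

lemma away_iff: "A \<in> away \<longleftrightarrow> A \<in> \<H> \<and> t\<^sub>0 \<notin> A"
  by (simp add: away_def)

lemma compl_away: "A \<in> \<H> \<Longrightarrow> t\<^sub>0 \<in> A \<Longrightarrow> T - A \<in> away" "t\<^sub>0 \<notin> A \<Longrightarrow> t\<^sub>0 \<in> T - A"
  using halfspace_compl base by (simp_all add: away_iff)

lemma trace_inject:
  assumes "wall_ultrafilter M \<D> \<alpha>" "wall_ultrafilter M \<D> \<beta>" "trace \<alpha> = trace \<beta>"
  shows "\<alpha> = \<beta>"
proof -
  have away: "A \<in> \<alpha> \<longleftrightarrow> A \<in> \<beta>" if "t\<^sub>0 \<notin> A" for A
    using that assms(3) by (metis trace_iff)
  have "A \<in> \<alpha> \<longleftrightarrow> A \<in> \<beta>" if "A \<in> \<H>" for A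
    using away[of A] away[of "T - A"] ultrafilterD(2)[OF assms(1) that] ultrafilterD(2)[OF assms(2) that]
    by (cases "t\<^sub>0 \<in> A") auto
  then show ?thesis
    using ultrafilterD(1)[OF assms(1)] ultrafilterD(1)[OF assms(2)] by blast
qed

lemma trace_consistent:
  assumes \<alpha>: "wall_ultrafilter M \<D> \<alpha>" and fin: "finite (trace \<alpha>)"
  shows "trace \<alpha> \<in> consistent_families away"
proof (rule consistent_familiesI[OF fin])
  fix a
  assume "a \<in> trace \<alpha>"
  then have a: "a \<in> \<alpha>" "t\<^sub>0 \<notin> a" "a \<in> \<H>"
    using ultrafilterD(1)[OF \<alpha>] by (simp_all add: trace_iff)
  then show "a \<in> away"
    by (simp add: away_iff)
  fix b
  show "b \<in> trace \<alpha>" if "b \<in> away" "a \<subseteq> b"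
    using that ultrafilterD(3)[OF \<alpha> a(1)] by (simp add: away_iff trace_iff)
  show "a \<inter> b \<noteq> {}" if b: "b \<in> trace \<alpha>"
  proof
    assume "a \<inter> b = {}"
    then have "a \<subseteq> T - b"
      using halfspace_subset(1)[OF a(3)] by blast
    moreover have b': "b \<in> \<alpha>" "b \<in> \<H>"
      using b ultrafilterD(1)[OF \<alpha>] by (simp_all add: trace_iff)
    ultimately have "T - b \<in> \<alpha>"
      by (intro ultrafilterD(3)[OF \<alpha> a(1)] halfspace_compl)
    then show False
      using ultrafilterD(2)[OF \<alpha> b'(2)] b'(1) by simp
  qed
qed

text \<open>The ultrafilter is forced: a halfspace containing \<open>t\<^sub>0\<close> belongs to it
  exactly if its complement is not in \<sigma>. Upward closure is inherited from \<sigma> except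
  from a halfspace missing \<open>t\<^sub>0\<close> to one containing it, where it amounts to
  members of \<sigma> meeting.\<close>

lemma ultrafilter_of_family:
  assumes \<sigma>: "\<sigma> \<in> consistent_families away"
  shows "\<exists>\<alpha>. wall_ultrafilter M \<D> \<alpha> \<and> trace \<alpha> = \<sigma>"
proof -
  define \<alpha> where "\<alpha> = {A \<in> \<H>. if t\<^sub>0 \<in> A then T - A \<notin> \<sigma> else A \<in> \<sigma>}"
  have mem: "A \<in> \<alpha> \<longleftrightarrow> A \<in> \<H> \<and> (if t\<^sub>0 \<in> A then T - A \<notin> \<sigma> else A \<in> \<sigma>)" for A
    by (simp add: \<alpha>_def)
  have \<sigma>_away: "A \<in> \<H>" "t\<^sub>0 \<notin> A" if "A \<in> \<sigma>" for A
    using consistent_familiesD(2)[OF \<sigma> that] by (simp_all add: away_iff)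
  have up: "B \<in> \<alpha>" if A: "A \<in> \<alpha>" and B: "B \<in> \<H>" and AB: "A \<subseteq> B" for A B
  proof (cases "t\<^sub>0 \<in> B")
    case True
    have "T - B \<notin> \<sigma>"
    proof
      assume TB: "T - B \<in> \<sigma>"
      show False
      proof (cases "t\<^sub>0 \<in> A")
        case True
        then have "T - A \<in> away" "T - B \<subseteq> T - A"
          using A AB compl_away(1) by (auto simp: mem)
        then have "T - A \<in> \<sigma>"
          by (rule consistent_familiesD(3)[OF \<sigma> TB])
        then show False
          using A True by (simp add: mem)
      next
        case False
        then have "A \<inter> (T - B) \<noteq> {}"
          using A TB by (intro consistent_familiesD(4)[OF \<sigma>]) (simp_all add: mem)
        then show False
          using AB by blast
      qed
    qed
    then show ?thesis
      using True B by (simp add: mem)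
  next
    case False
    then have "t\<^sub>0 \<notin> A"
      using AB by blast
    then have "A \<in> \<sigma>"
      using A by (simp add: mem)
    then have "B \<in> \<sigma>"
      by (rule consistent_familiesD(3)[OF \<sigma>]) (use B False AB in \<open>simp_all add: away_iff\<close>)
    then show ?thesis
      using B False by (simp add: mem)
  qed
  have compl: "T - A \<in> \<alpha> \<longleftrightarrow> A \<notin> \<alpha>" if "A \<in> \<H>" for A
    using that halfspace_compl[OF that] base compl_compl[OF that] by (simp add: mem)
  have "wall_ultrafilter M \<D> \<alpha>"
    unfolding ultrafilter_iff using compl up by (intro conjI ballI impI subsetI) (simp_all add: mem)
  moreover have "trace \<alpha> = \<sigma>"
  proof (intro subset_antisym subsetI)
    show "A \<in> \<sigma>" if "A \<in> trace \<alpha>" for A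
      using that by (simp add: trace_iff mem)
    show "A \<in> trace \<alpha>" if "A \<in> \<sigma>" for A
      using that \<sigma>_away[OF that] by (simp add: trace_iff mem)
  qed
  ultimately show ?thesis
    by blast
qed

text \<open>A descending chain that once loses \<open>t\<^sub>0\<close> continues inside the finite
  trace. Otherwise all its members contain \<open>t\<^sub>0\<close> and miss a triple outside the
  first one, and only finitely many halfspaces separate these two triples.\<close>

lemma dcc_of_finite_trace:
  assumes \<alpha>: "wall_ultrafilter M \<D> \<alpha>" and fin: "finite (trace \<alpha>)"
  shows "dcc \<alpha>"
  unfolding dcc_def
proof (intro allI impI)
  fix A :: "nat \<Rightarrow> 'a set set"
  assume A: "\<forall>i. A i \<in> \<alpha> \<and> A (Suc i) \<subseteq> A i"
  then have AH: "A i \<in> \<H>" for i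
    using ultrafilterD(1)[OF \<alpha>] by blast
  have mono: "A j \<subseteq> A i" if "i \<le> j" for i j
    using lift_Suc_antimono_le[of A i j] A that by blast
  have "finite (range A)"
  proof (cases "\<exists>k. t\<^sub>0 \<notin> A k")
    case True
    then obtain k where k: "t\<^sub>0 \<notin> A k"
      by blast
    have "A i \<in> A ` {..<k} \<union> trace \<alpha>" for i
    proof (cases "i < k")
      case False
      then have "t\<^sub>0 \<notin> A i"
        using mono[of k i] k by auto
      then show ?thesis
        using A by (simp add: trace_iff)
    qed simp
    then have "range A \<subseteq> A ` {..<k} \<union> trace \<alpha>"
      by blast
    then show ?thesis
      by (rule finite_subset) (use fin in simp)
  next
    case False
    obtain t where t: "t \<in> T" "t \<notin> A 0"
      using halfspace_subset[OF AH[of 0]] by blast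
    let ?F = "{B \<in> \<H>. t \<in> B \<and> t\<^sub>0 \<notin> B}"
    have "A i \<in> (\<lambda>B. T - B) ` ?F" for i
    proof (rule image_eqI)
      show "A i = T - (T - A i)"
        using compl_compl[OF AH] by simp
      have "t \<notin> A i"
        using mono[of 0 i] t(2) by blast
      then show "T - A i \<in> ?F"
        using t(1) False halfspace_compl[OF AH] by simp
    qed
    then have "range A \<subseteq> (\<lambda>B. T - B) ` ?F"
      by blast
    then show ?thesis
      by (rule finite_subset) (rule finite_imageI[OF finite_separating[OF t(1) base]])
  qed
  then obtain n where n: "\<And>B. B \<in> range A \<Longrightarrow> B \<le> A n \<Longrightarrow> A n = B"
    using finite_has_minimal[of "range A"] by blast
  have "A m = A n" if "n \<le> m" for m
    using n[of "A m"] mono[OF that] by simp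
  then show "\<exists>n. \<forall>m\<ge>n. A m = A n"
    by blast
qed

lemma principal_ultrafilter:
  assumes t: "t \<in> T"
  shows "wall_ultrafilter M \<D> (principal_ultrafilter M \<D> t)" "finite (trace (principal_ultrafilter M \<D> t))"
proof -
  show "wall_ultrafilter M \<D> (principal_ultrafilter M \<D> t)"
    unfolding ultrafilter_iff principal_ultrafilter_def using t halfspace_compl by auto
  have "trace (principal_ultrafilter M \<D> t) = {A \<in> \<H>. t \<in> A \<and> t\<^sub>0 \<notin> A}"
    unfolding trace_def principal_ultrafilter_def by blast
  then show "finite (trace (principal_ultrafilter M \<D> t))"
    using finite_separating[OF t base] by simp
qed

lemma trace_flip:
  assumes \<alpha>: "wall_ultrafilter M \<D> \<alpha>" and A: "A \<in> \<alpha>"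
  shows "\<exists>a. trace ((\<alpha> - {A}) \<union> {T - A}) = sym_diff (trace \<alpha>) {a}"
proof (cases "t\<^sub>0 \<in> A")
  case True
  have "T - A \<notin> \<alpha>"
    using ultrafilterD(2)[OF \<alpha> ultrafilterD(1)[OF \<alpha> A]] A by simp
  then have "B \<in> trace ((\<alpha> - {A}) \<union> {T - A}) \<longleftrightarrow> B \<in> sym_diff (trace \<alpha>) {T - A}" for B
    using True by (auto simp: trace_iff)
  then show ?thesis
    by blast
next
  case False
  then have "B \<in> trace ((\<alpha> - {A}) \<union> {T - A}) \<longleftrightarrow> B \<in> sym_diff (trace \<alpha>) {A}" for B
    using A base by (auto simp: trace_iff)
  then show ?thesis
    by blast
qed

text \<open>A member of \<alpha> strictly inside \<open>a\<close> misses \<open>t\<^sub>0\<close>,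
  hence survives in \<beta> and would force \<open>a\<close> into \<beta>. So \<open>a\<close> is
  minimal in \<alpha>, and flipping it is an edge of the graph.\<close>

lemma edge_of_trace:
  assumes Z: "\<alpha> \<in> Z_vertices M \<D>" "\<beta> \<in> Z_vertices M \<D>" and a: "a \<in> trace \<alpha>" "trace \<beta> = trace \<alpha> - {a}"
  shows "{\<alpha>, \<beta>} \<in> Z_edges M \<D>"
proof -
  have \<alpha>: "wall_ultrafilter M \<D> \<alpha>" and \<beta>: "wall_ultrafilter M \<D> \<beta>"
    using Z by (simp_all add: Z_vertices_def)
  have a': "a \<in> \<alpha>" "t\<^sub>0 \<notin> a" "a \<in> \<H>"
    using a(1) ultrafilterD(1)[OF \<alpha>] by (simp_all add: trace_iff)
  have \<beta>_iff: "B \<in> \<beta> \<longleftrightarrow> B \<in> \<alpha> \<and> B \<noteq> a" if "t\<^sub>0 \<notin> B" for B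
    using that a(2) by (metis DiffE DiffI singletonD singletonI trace_iff)
  have min: "B = a" if B: "B \<in> \<alpha>" "B \<subseteq> a" for B
  proof (rule ccontr)
    assume "B \<noteq> a"
    then have "B \<in> \<beta>"
      using B a'(2) \<beta>_iff[of B] by blast
    then have "a \<in> \<beta>"
      using ultrafilterD(3)[OF \<beta> _ a'(3) B(2)] by blast
    then show False
      using \<beta>_iff[OF a'(2)] by simp
  qed
  have "B \<in> \<beta> \<longleftrightarrow> B \<in> (\<alpha> - {a}) \<union> {T - a}" if B: "B \<in> \<H>" for B
  proof (cases "t\<^sub>0 \<in> B")
    case True
    have "B \<in> \<beta> \<longleftrightarrow> T - B \<notin> \<beta>"
      using ultrafilterD(2)[OF \<beta> B] by simp
    also have "\<dots> \<longleftrightarrow> T - B \<notin> \<alpha> \<or> T - B = a"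
      using \<beta>_iff[of "T - B"] True by simp
    also have "\<dots> \<longleftrightarrow> B \<in> \<alpha> \<or> B = T - a"
      using ultrafilterD(2)[OF \<alpha> B] compl_compl[OF B] compl_compl[OF a'(3)] by metis
    finally show ?thesis
      using True a'(2) by auto
  next
    case False
    then show ?thesis
      using \<beta>_iff[OF False] base a'(2) by auto
  qed
  moreover have "T - a \<in> \<H>"
    using halfspace_compl[OF a'(3)] .
  ultimately have "\<beta> = (\<alpha> - {a}) \<union> {T - a}"
    using ultrafilterD(1)[OF \<beta>] ultrafilterD(1)[OF \<alpha>] by blast
  then have "\<exists>A\<in>\<alpha>. (\<forall>B\<in>\<alpha>. B \<subseteq> A \<longrightarrow> B = A) \<and> \<beta> = (\<alpha> - {A}) \<union> {T - A}"
    using a'(1) min by (intro bexI[of _ a] conjI ballI impI)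
  then show ?thesis
    unfolding Z_edges_def using Z by (intro CollectI exI conjI) simp_all
qed

lemma Z_edges_iff:
  "{\<alpha>, \<beta>} \<in> Z_edges M \<D> \<longleftrightarrow> \<alpha> \<in> Z_vertices M \<D> \<and> \<beta> \<in> Z_vertices M \<D> \<and> (\<exists>a. trace \<beta> = sym_diff (trace \<alpha>) {a})"
proof
  assume "{\<alpha>, \<beta>} \<in> Z_edges M \<D>"
  then obtain \<gamma> A where \<gamma>: "{\<alpha>, \<beta>} = {\<gamma>, (\<gamma> - {A}) \<union> {T - A}}" "\<gamma> \<in> Z_vertices M \<D>" "A \<in> \<gamma>"
    "(\<gamma> - {A}) \<union> {T - A} \<in> Z_vertices M \<D>"
    unfolding Z_edges_def by blast
  have "wall_ultrafilter M \<D> \<gamma>"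
    using \<gamma>(2) by (simp add: Z_vertices_def)
  then obtain a where a: "trace ((\<gamma> - {A}) \<union> {T - A}) = sym_diff (trace \<gamma>) {a}"
    using trace_flip \<gamma>(3) by blast
  have cancel: "sym_diff (sym_diff (trace \<gamma>) {a}) {a} = trace \<gamma>"
    by blast
  have "\<alpha> = \<gamma> \<and> \<beta> = (\<gamma> - {A}) \<union> {T - A} \<or> \<alpha> = (\<gamma> - {A}) \<union> {T - A} \<and> \<beta> = \<gamma>"
    using \<gamma>(1) unfolding doubleton_eq_iff .
  then show "\<alpha> \<in> Z_vertices M \<D> \<and> \<beta> \<in> Z_vertices M \<D> \<and> (\<exists>a. trace \<beta> = sym_diff (trace \<alpha>) {a})"
  proof (elim disjE conjE)
    assume "\<alpha> = \<gamma>" "\<beta> = (\<gamma> - {A}) \<union> {T - A}"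
    then show ?thesis
      using \<gamma>(2,4) a by metis
  next
    assume "\<alpha> = (\<gamma> - {A}) \<union> {T - A}" "\<beta> = \<gamma>"
    then show ?thesis
      using \<gamma>(2,4) a cancel by metis
  qed
next
  assume "\<alpha> \<in> Z_vertices M \<D> \<and> \<beta> \<in> Z_vertices M \<D> \<and> (\<exists>a. trace \<beta> = sym_diff (trace \<alpha>) {a})"
  then obtain a where Z: "\<alpha> \<in> Z_vertices M \<D>" "\<beta> \<in> Z_vertices M \<D>" and a: "trace \<beta> = sym_diff (trace \<alpha>) {a}"
    by (elim conjE exE)
  show "{\<alpha>, \<beta>} \<in> Z_edges M \<D>"
  proof (cases "a \<in> trace \<alpha>")
    case True
    have "trace \<beta> = trace \<alpha> - {a}"
      unfolding a using True by blast
    then show ?thesis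
      by (rule edge_of_trace[OF Z True])
  next
    case False
    have "a \<in> trace \<beta>" "trace \<alpha> = trace \<beta> - {a}"
      unfolding a using False by blast+
    then have "{\<beta>, \<alpha>} \<in> Z_edges M \<D>"
      by (rule edge_of_trace[OF Z(2,1)])
    then show ?thesis
      by (simp add: insert_commute)
  qed
qed

lemma Z_vertices_of_finite_trace:
  "wall_ultrafilter M \<D> \<alpha> \<Longrightarrow> finite (trace \<alpha>) \<Longrightarrow> \<alpha> \<in> Z_vertices M \<D>"
  using dcc_of_finite_trace by (simp add: Z_vertices_def)

text \<open>An edge changes the trace by one member and principal ultrafilters have finite traces,
  so finiteness persists along paths. Conversely, removing minimal members one by one leads to the
  empty trace, which belongs to \<open>t\<^sub>0\<close>.\<close>

lemma X_vertices_eq: "X_vertices M \<D> = {\<alpha>. wall_ultrafilter M \<D> \<alpha> \<and> finite (trace \<alpha>)}"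
proof (intro subset_antisym subsetI)
  fix \<alpha>
  assume \<alpha>: "\<alpha> \<in> X_vertices M \<D>"
  then obtain t where t: "t \<in> T"
    and path: "(principal_ultrafilter M \<D> t, \<alpha>) \<in> {(\<beta>, \<gamma>). {\<beta>, \<gamma>} \<in> Z_edges M \<D>}\<^sup>*"
    unfolding X_vertices_def by blast
  from path have "finite (trace \<alpha>)"
  proof (induction rule: rtrancl_induct)
    case base
    show ?case
      by (rule principal_ultrafilter(2)[OF t])
  next
    case (step \<beta> \<gamma>)
    then obtain a where "trace \<gamma> = sym_diff (trace \<beta>) {a}"
      using Z_edges_iff by blast
    then show ?case
      using step.IH by simp
  qed
  moreover have "wall_ultrafilter M \<D> \<alpha>"
    using \<alpha> by (simp add: X_vertices_def Z_vertices_def)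
  ultimately show "\<alpha> \<in> {\<alpha>. wall_ultrafilter M \<D> \<alpha> \<and> finite (trace \<alpha>)}"
    by simp
next
  fix \<alpha>
  assume \<alpha>: "\<alpha> \<in> {\<alpha>. wall_ultrafilter M \<D> \<alpha> \<and> finite (trace \<alpha>)}"
  let ?R = "{(\<beta>, \<gamma>). {\<beta>, \<gamma>} \<in> Z_edges M \<D>}"
  have "wall_ultrafilter M \<D> \<alpha> \<Longrightarrow> finite (trace \<alpha>) \<Longrightarrow> (principal_ultrafilter M \<D> t\<^sub>0, \<alpha>) \<in> ?R\<^sup>*" for \<alpha>
  proof (induction "card (trace \<alpha>)" arbitrary: \<alpha> rule: less_induct)
    case less
    show ?case
    proof (cases "trace \<alpha> = {}")
      case True
      have "trace (principal_ultrafilter M \<D> t\<^sub>0) = {}"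
        unfolding trace_def principal_ultrafilter_def by blast
      then have "\<alpha> = principal_ultrafilter M \<D> t\<^sub>0"
        using True by (intro trace_inject[OF less.prems(1) principal_ultrafilter(1)[OF base]]) simp
      then show ?thesis
        by simp
    next
      case False
      then obtain a where a: "a \<in> trace \<alpha>" "\<And>b. b \<in> trace \<alpha> \<Longrightarrow> b \<le> a \<Longrightarrow> a = b"
        using finite_has_minimal[OF less.prems(2)] by blast
      then have "trace \<alpha> - {a} \<in> consistent_families away"
        by (intro consistent_families_remove[OF trace_consistent[OF less.prems]]) blast
      then obtain \<beta> where \<beta>: "wall_ultrafilter M \<D> \<beta>" "trace \<beta> = trace \<alpha> - {a}"
        using ultrafilter_of_family by blast
      have fin: "finite (trace \<beta>)"
        using less.prems(2) \<beta>(2) by simp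
      have "card (trace \<beta>) < card (trace \<alpha>)"
        unfolding \<beta>(2) by (rule card_Diff1_less[OF less.prems(2) a(1)])
      then have "(principal_ultrafilter M \<D> t\<^sub>0, \<beta>) \<in> ?R\<^sup>*"
        by (rule less.hyps[OF _ \<beta>(1) fin])
      moreover have "{\<alpha>, \<beta>} \<in> Z_edges M \<D>"
        by (rule edge_of_trace[OF Z_vertices_of_finite_trace[OF less.prems] Z_vertices_of_finite_trace[OF \<beta>(1) fin] a(1) \<beta>(2)])
      then have "(\<beta>, \<alpha>) \<in> ?R"
        by (simp add: insert_commute)
      ultimately show ?thesis
        by (rule rtrancl_into_rtrancl)
    qed
  qed
  then show "\<alpha> \<in> X_vertices M \<D>"
    unfolding X_vertices_def using \<alpha> base Z_vertices_of_finite_trace by blast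
qed

sublocale family_complex away "X_vertices M \<D>" trace
proof
  show "{} \<notin> away"
    using halfspace_subset(2) by (auto simp: away_iff)
  show "finite {b \<in> away. a \<subseteq> b}" if a: "a \<in> away" for a
  proof -
    \<comment> \<open>A triple inside \<open>a\<close> is separated from \<open>t\<^sub>0\<close> by
      every member of \<open>away\<close> that contains \<open>a\<close>.\<close>
    obtain t where t: "t \<in> a" "t \<in> T"
      using a halfspace_subset(1,2) unfolding away_iff by blast
    have "{b \<in> away. a \<subseteq> b} \<subseteq> {A \<in> \<H>. t \<in> A \<and> t\<^sub>0 \<notin> A}"
      using t(1) unfolding away_def by blast
    then show ?thesis
      by (rule finite_subset) (rule finite_separating[OF t(2) base])
  qed
  show "bij_betw trace (X_vertices M \<D>) (consistent_families away)"
    unfolding bij_betw_def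
  proof (intro conjI subset_antisym subsetI)
    show "inj_on trace (X_vertices M \<D>)"
      unfolding X_vertices_eq by (rule inj_onI) (use trace_inject in blast)
    show "\<sigma> \<in> consistent_families away" if "\<sigma> \<in> trace ` X_vertices M \<D>" for \<sigma>
      using that trace_consistent unfolding X_vertices_eq by blast
    show "\<sigma> \<in> trace ` X_vertices M \<D>" if \<sigma>: "\<sigma> \<in> consistent_families away" for \<sigma>
    proof -
      obtain \<alpha> where \<alpha>: "wall_ultrafilter M \<D> \<alpha>" "trace \<alpha> = \<sigma>"
        using ultrafilter_of_family[OF \<sigma>] by blast
      then have "\<alpha> \<in> X_vertices M \<D>"
        unfolding X_vertices_eq using consistent_familiesD(1)[OF \<sigma>] by simp
      then show ?thesis
        using \<alpha>(2) by blast
    qed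
  qed
qed

lemma Z_cube_map_iff:
  "cube_map (Z_vertices M \<D>) (Z_edges M \<D>) S f \<longleftrightarrow> finite S \<and> inj_on f (Pow S) \<and> f {} \<in> Z_vertices M \<D> \<and>
    (\<forall>A i. A \<subseteq> S \<and> i \<in> S - A \<longrightarrow> {f A, f (insert i A)} \<in> Z_edges M \<D>)"
proof (rule cube_map_iff)
  show "{\<alpha>, \<alpha>} \<notin> Z_edges M \<D>" for \<alpha>
    unfolding Z_edges_iff by blast
  show "\<Union>(Z_edges M \<D>) \<subseteq> Z_vertices M \<D>"
    unfolding Z_edges_def by blast
qed

lemma X_vertices_subset: "X_vertices M \<D> \<subseteq> Z_vertices M \<D>"
  unfolding X_vertices_def by blast

text \<open>Read through traces, an embedded cube graph flips one member per edge, so by rigidity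
  its vertex set is an interval of families. Conversely, a chart of an interval is such an
  embedding.\<close>

lemma dual_complex_eq_cells: "dual_complex M \<D> = cells"
proof (intro subset_antisym subsetI)
  fix Q
  assume "Q \<in> dual_complex M \<D>"
  then obtain S f where Q: "Q = f ` Pow S" "Q \<subseteq> X_vertices M \<D>"
    and map: "cube_map (Z_vertices M \<D>) (Z_edges M \<D>) S f"
    unfolding dual_complex_def Z_cubes_def by blast
  have S: "finite S" and inj: "inj_on f (Pow S)"
    and edges: "\<And>A i. A \<subseteq> S \<Longrightarrow> i \<in> S - A \<Longrightarrow> {f A, f (insert i A)} \<in> Z_edges M \<D>"
    using map unfolding Z_cube_map_iff by blast+
  have fX: "f A \<in> X_vertices M \<D>" if "A \<subseteq> S" for A
    using Q that by blast
  have inj': "inj_on (\<lambda>A. trace (f A)) (Pow S)"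
    using comp_inj_on[OF inj inj_on_subset[OF inj_s]] Q by (simp add: comp_def)
  have edges': "\<exists>a. trace (f (insert i A)) = sym_diff (trace (f A)) {a}" if "A \<subseteq> S" "i \<in> S - A" for A i
    using edges[OF that] unfolding Z_edges_iff by iprover
  obtain e where e: "inj_on e S" "\<And>A. A \<subseteq> S \<Longrightarrow> trace (f A) = sym_diff (trace (f {})) (e ` A)"
    using cube_rigid[OF S inj' edges'] by blast
  let ?L = "trace (f {}) - e ` S" and ?U = "trace (f {}) \<union> e ` S"
  have img: "trace ` Q = {?L..?U}"
  proof (intro subset_antisym subsetI)
    fix \<tau>
    assume "\<tau> \<in> trace ` Q"
    then obtain A where A: "A \<subseteq> S" "\<tau> = trace (f A)"
      unfolding Q(1) by blast
    have "e ` A \<subseteq> e ` S"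
      using A(1) by (rule image_mono)
    then show "\<tau> \<in> {?L..?U}"
      unfolding A(2) e(2)[OF A(1)] atLeastAtMost_iff by blast
  next
    fix \<tau>
    assume \<tau>: "\<tau> \<in> {?L..?U}"
    let ?A = "{i \<in> S. e i \<in> sym_diff (trace (f {})) \<tau>}"
    have "e ` ?A = e ` S \<inter> sym_diff (trace (f {})) \<tau>"
      by blast
    also have "\<dots> = sym_diff (trace (f {})) \<tau>"
      using \<tau> unfolding atLeastAtMost_iff by blast
    finally have "sym_diff (trace (f {})) (e ` ?A) = \<tau>"
      by blast
    then have "trace (f ?A) = \<tau>"
      using e(2)[of ?A] by simp
    moreover have "f ?A \<in> Q"
      unfolding Q(1) by blast
    ultimately show "\<tau> \<in> trace ` Q"
      by blast
  qed
  have "trace ` Q \<subseteq> consistent_families away"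
    using Q(2) s_in by blast
  then have span: "spans ?L ?U"
    unfolding spans_def img by blast
  show "Q \<in> cells"
    using eq_cellI[OF Q(2) span img] cell_in_cells[OF span] by simp
next
  fix Q
  assume "Q \<in> cells"
  then obtain L U where Q: "Q = cell L U" "spans L U"
    unfolding cells_def by blast
  obtain S f where chart: "cube_chart cells S f (cell L U)"
    using ex_chart[OF Q(2)] by blast
  obtain e \<sigma> where e: "bij_betw e S (U - L)" and sf: "\<And>A. A \<subseteq> S \<Longrightarrow> trace (f A) = sym_diff \<sigma> (e ` A)"
    using chart_coordinates[OF Q(2) chart] by metis
  have S: "finite S" and f: "bij_betw f (Pow S) (cell L U)"
    using chart unfolding cube_chart_def by iprover+
  have fZ: "f A \<in> Z_vertices M \<D>" if "A \<subseteq> S" for A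
    using bij_betwE[OF f] that cell_subset_V X_vertices_subset by blast
  have "{f A, f (insert i A)} \<in> Z_edges M \<D>" if A: "A \<subseteq> S" "i \<in> S - A" for A i
    unfolding Z_edges_iff
  proof (intro conjI exI)
    have "e i \<notin> e ` A"
      using A inj_on_image_mem_iff[OF bij_betw_imp_inj_on[OF e]] by auto
    moreover have "insert i A \<subseteq> S"
      using A by simp
    ultimately show "trace (f (insert i A)) = sym_diff (trace (f A)) {e i}"
      unfolding sf[OF A(1)] sf[OF \<open>insert i A \<subseteq> S\<close>] image_insert by (intro sym_diff_insert)
    show "f A \<in> Z_vertices M \<D>" "f (insert i A) \<in> Z_vertices M \<D>"
      using fZ A by simp_all
  qed
  then have "cube_map (Z_vertices M \<D>) (Z_edges M \<D>) S f"
    unfolding Z_cube_map_iff using S bij_betw_imp_inj_on[OF f] fZ[OF empty_subsetI] by blast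
  then show "Q \<in> dual_complex M \<D>"
    unfolding dual_complex_def Z_cubes_def Q(1) using bij_betw_imp_surj_on[OF f] cell_subset_V by blast
qed

end

section \<open>Symmetries of the dual complex\<close>

context wallspace begin

text \<open>A version of \<open>coord\<close> that also applies to halfspaces containing
  \<open>t\<^sub>0\<close>, as required for the images of halfspaces under maps that move the base
  triple.\<close>

definition mass :: "('a set set set \<Rightarrow> real) \<Rightarrow> 'a set set \<Rightarrow> real" where
  "mass w A = (\<Sum>x | w x \<noteq> 0 \<and> A \<in> x. w x)"

definition wall_hyperplane :: "'a set set \<Rightarrow> ('a set set set \<Rightarrow> real) set" where
  "wall_hyperplane A = {w \<in> realization (dual_complex M \<D>). mass w A = 1/2}"

lemma realization_support:
  assumes "w \<in> realization (dual_complex M \<D>)"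
  shows "finite {x. w x \<noteq> 0}" "w x \<noteq> 0 \<Longrightarrow> x \<in> X_vertices M \<D>" "(\<Sum>x | w x \<noteq> 0. w x) = 1"
proof -
  obtain L U y where y: "spans L U" "y \<in> coord_box L U" "w = weight y"
    using assms unfolding dual_complex_eq_cells by (elim realizationE)
  have sub: "{x. w x \<noteq> 0} \<subseteq> cell L U"
    using weight_box[OF y(1,2)] unfolding y(3) by auto
  show "finite {x. w x \<noteq> 0}"
    by (rule finite_subset[OF sub finite_cell[OF y(1)]])
  show "x \<in> X_vertices M \<D>" if "w x \<noteq> 0"
    using sub cell_subset_V that by blast
  show "(\<Sum>x | w x \<noteq> 0. w x) = 1"
    unfolding y(3) by (rule sum_weight[OF y(1,2)])
qed

lemma X_ultrafilter: "x \<in> X_vertices M \<D> \<Longrightarrow> wall_ultrafilter M \<D> x"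
  by (simp add: X_vertices_eq)

text \<open>The weights of a point sum to 1, and every vertex contains exactly one of the two
  halfspaces of a wall.\<close>

lemma mass_compl:
  assumes w: "w \<in> realization (dual_complex M \<D>)" and A: "A \<in> \<H>"
  shows "mass w (T - A) = 1 - mass w A"
proof -
  have "T - A \<in> x \<longleftrightarrow> A \<notin> x" if "w x \<noteq> 0" for x
    using ultrafilterD(2)[OF X_ultrafilter[OF realization_support(2)[OF w that]] A] .
  then have "{x. w x \<noteq> 0 \<and> T - A \<in> x} = {x. w x \<noteq> 0 \<and> A \<notin> x}"
    by (intro Collect_cong) blast
  moreover have "sum w {x. w x \<noteq> 0} = sum w ({x. w x \<noteq> 0} \<inter> {x. A \<in> x}) + sum w ({x. w x \<noteq> 0} - {x. A \<in> x})"
    by (rule sum.Int_Diff[OF realization_support(1)[OF w]])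
  moreover have "{x. w x \<noteq> 0} \<inter> {x. A \<in> x} = {x. w x \<noteq> 0 \<and> A \<in> x}"
    "{x. w x \<noteq> 0} - {x. A \<in> x} = {x. w x \<noteq> 0 \<and> A \<notin> x}"
    by blast+
  ultimately show ?thesis
    unfolding mass_def using realization_support(3)[OF w] by simp
qed

lemma wall_hyperplane_away: "t\<^sub>0 \<notin> A \<Longrightarrow> wall_hyperplane A = hyper A"
  unfolding wall_hyperplane_def hyper_def mass_def coord_def dual_complex_eq_cells by (simp add: trace_iff)

lemma wall_hyperplane_compl:
  assumes "A \<in> \<H>"
  shows "wall_hyperplane (T - A) = wall_hyperplane A"
  unfolding wall_hyperplane_def using mass_compl[OF _ assms] by auto

text \<open>Both sides of a wall give the same set, and exactly one of them misses
  \<open>t\<^sub>0\<close>; for these representatives \<open>hyper\<close> is injective.\<close>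

lemma wall_hyperplane_eq_iff:
  assumes A: "A \<in> \<H>" and B: "B \<in> \<H>"
  shows "wall_hyperplane A = wall_hyperplane B \<longleftrightarrow> B \<in> {A, T - A}"
proof
  have ex: "\<exists>C\<in>away. C \<in> {A, T - A} \<and> wall_hyperplane A = hyper C" if A: "A \<in> \<H>" for A
  proof (cases "t\<^sub>0 \<in> A")
    case True
    then have "t\<^sub>0 \<notin> T - A"
      by simp
    then have "wall_hyperplane A = hyper (T - A)"
      using wall_hyperplane_compl[OF A] wall_hyperplane_away[of "T - A"] by simp
    then show ?thesis
      using compl_away(1)[OF A True] by (intro bexI[of _ "T - A"] conjI) simp_all
  next
    case False
    then have "A \<in> away"
      using A by (simp add: away_iff)
    then show ?thesis
      using wall_hyperplane_away[OF False] by (intro bexI[of _ A] conjI) simp_all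
  qed
  obtain C where C: "C \<in> away" "C \<in> {A, T - A}" "wall_hyperplane A = hyper C"
    using ex[OF A] by (elim bexE conjE)
  obtain C' where C': "C' \<in> away" "C' \<in> {B, T - B}" "wall_hyperplane B = hyper C'"
    using ex[OF B] by (elim bexE conjE)
  assume "wall_hyperplane A = wall_hyperplane B"
  then have "C = C'"
    using hyper_inject[OF C(1), of C'] C(3) C'(3) by simp
  then show "B \<in> {A, T - A}"
  proof -
    have "B = C \<or> B = T - C" "C = A \<or> C = T - A"
      using C(2) C'(2) \<open>C = C'\<close> compl_compl[OF B] by (simp_all) metis
    then have "B = A \<or> B = T - A"
      using compl_compl[OF A] by metis
    then show ?thesis
      by simp
  qed
next
  assume "B \<in> {A, T - A}"
  then have "B = A \<or> B = T - A"
    by simp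
  then show "wall_hyperplane A = wall_hyperplane B"
    using wall_hyperplane_compl[OF A] by metis
qed

lemma hyperplane_dual_complex_iff: "hyperplane (dual_complex M \<D>) H \<longleftrightarrow> (\<exists>A\<in>\<H>. H = wall_hyperplane A)"
proof
  assume "hyperplane (dual_complex M \<D>) H"
  then obtain a where "a \<in> away" "H = hyper a"
    unfolding dual_complex_eq_cells hyperplane_cells_iff by (elim bexE)
  then show "\<exists>A\<in>\<H>. H = wall_hyperplane A"
    using wall_hyperplane_away[of a] by (intro bexI[of _ a]) (simp_all add: away_iff)
next
  assume "\<exists>A\<in>\<H>. H = wall_hyperplane A"
  then obtain A where A: "A \<in> \<H>" "H = wall_hyperplane A"
    by (elim bexE)
  have "\<exists>a\<in>away. H = hyper a"
  proof (cases "t\<^sub>0 \<in> A")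
    case True
    then have "t\<^sub>0 \<notin> T - A"
      by simp
    then have "H = hyper (T - A)"
      using A wall_hyperplane_compl[OF A(1)] wall_hyperplane_away by simp
    then show ?thesis
      using compl_away(1)[OF A(1) True] by (intro bexI)
  next
    case False
    then show ?thesis
      using A wall_hyperplane_away[OF False] False by (intro bexI[of _ A]) (simp_all add: away_iff)
  qed
  then show "hyperplane (dual_complex M \<D>) H"
    unfolding dual_complex_eq_cells hyperplane_cells_iff .
qed

end

definition lift_ultrafilter :: "('a \<Rightarrow> 'a) \<Rightarrow> 'a set set set \<Rightarrow> 'a set set set" where
  "lift_ultrafilter h \<alpha> = (\<lambda>A. (`) h ` A) ` \<alpha>"

text \<open>The assumptions are symmetric in \<open>h\<close> and its inverse \<open>k\<close>.
  Hence an inclusion proved for images under \<open>h\<close> yields the reverse inclusion when it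
  is applied to \<open>k\<close>, through \<open>swap\<close>.\<close>

locale wall_symmetry = wallspace M \<D> t\<^sub>0
  for M :: "'a topology" and \<D> :: "'a division set" and t\<^sub>0 :: "'a set" +
  fixes h k :: "'a \<Rightarrow> 'a"
  assumes into: "x \<in> topspace M \<Longrightarrow> h x \<in> topspace M" "x \<in> topspace M \<Longrightarrow> k x \<in> topspace M"
    and inverse: "x \<in> topspace M \<Longrightarrow> k (h x) = x" "x \<in> topspace M \<Longrightarrow> h (k x) = x"
    and invariant: "D \<in> \<D> \<Longrightarrow> (h ` fst D, (`) h ` snd D) \<in> \<D>" "D \<in> \<D> \<Longrightarrow> (k ` fst D, (`) k ` snd D) \<in> \<D>"
    and parts: "D \<in> \<D> \<Longrightarrow> fst D \<subseteq> topspace M" "D \<in> \<D> \<Longrightarrow> P \<in> snd D \<Longrightarrow> P \<subseteq> topspace M"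
begin

lemma swap: "wall_symmetry M \<D> t\<^sub>0 k h"
  by unfold_locales (fact into inverse invariant parts)+

abbreviation lift :: "'a set set \<Rightarrow> 'a set set" where
  "lift A \<equiv> (`) h ` A"

lemma image_inverse: "X \<subseteq> topspace M \<Longrightarrow> k ` h ` X = X"
  using inverse(1) by force

lemma inj_h: "inj_on h (topspace M)"
  by (rule inj_on_inverseI[of _ k]) (rule inverse(1))

lemma T_subset: "t \<in> T \<Longrightarrow> t \<subseteq> topspace M"
  unfolding triples_def by blast

lemma triple_avoids: "t \<in> T \<Longrightarrow> x \<in> t \<Longrightarrow> D \<in> \<D> \<Longrightarrow> x \<notin> fst D"
  unfolding triples_def by blast

lemma image_triple:
  assumes t: "t \<in> T"
  shows "h ` t \<in> T"
proof -
  have avoid: "h x \<notin> fst D" if x: "x \<in> t" and D: "D \<in> \<D>" for x D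
  proof
    assume "h x \<in> fst D"
    then have "k (h x) \<in> fst (k ` fst D, (`) k ` snd D)"
      by simp
    moreover have "k (h x) = x"
      using inverse(1) T_subset[OF t] x by blast
    ultimately show False
      using triple_avoids[OF t x invariant(2)[OF D]] by simp
  qed
  have "h ` t \<subseteq> topspace M - (\<Union>D\<in>\<D>. fst D)"
    using into(1) T_subset[OF t] avoid by blast
  moreover have "card (h ` t) = 3"
    using t card_image[OF inj_on_subset[OF inj_h T_subset[OF t]]] unfolding triples_def by simp
  ultimately show ?thesis
    unfolding triples_def by (intro CollectI conjI)
qed

lemma lift_halfspace_subset:
  assumes "P \<subseteq> topspace M"
  shows "lift (halfspace M \<D> P) \<subseteq> halfspace M \<D> (h ` P)"
proof (rule image_subsetI)
  fix t
  assume "t \<in> halfspace M \<D> P"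
  then have t: "t \<in> T" "card (t \<inter> P) \<ge> 2"
    unfolding halfspace_def by simp_all
  have "h ` t \<inter> h ` P = h ` (t \<inter> P)"
    by (rule inj_on_image_Int[symmetric, OF inj_h T_subset[OF t(1)] assms])
  moreover have "card (h ` (t \<inter> P)) = card (t \<inter> P)"
    by (rule card_image, rule inj_on_subset[OF inj_h]) (use assms in blast)
  ultimately show "h ` t \<in> halfspace M \<D> (h ` P)"
    unfolding halfspace_def using image_triple[OF t(1)] t(2) by simp
qed

lemma lift_inverse: "A \<subseteq> T \<Longrightarrow> (`) k ` lift A = A"
proof -
  assume "A \<subseteq> T"
  then have "k ` h ` t = t" if "t \<in> A" for t
    using image_inverse[OF T_subset] that by blast
  then show ?thesis
    unfolding image_image by simp
qed

lemma halfspace_subset_T: "halfspace M \<D> P \<subseteq> T"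
  unfolding halfspace_def by blast

lemma lift_halfspace:
  assumes P: "P \<subseteq> topspace M"
  shows "lift (halfspace M \<D> P) = halfspace M \<D> (h ` P)"
proof
  interpret inv: wall_symmetry M \<D> t\<^sub>0 k h
    by (rule swap)
  have "h ` P \<subseteq> topspace M"
    using P into(1) by blast
  from inv.lift_halfspace_subset[OF this]
  have "(`) k ` halfspace M \<D> (h ` P) \<subseteq> halfspace M \<D> P"
    unfolding image_inverse[OF P] .
  from image_mono[OF this, of "(`) h"] show "halfspace M \<D> (h ` P) \<subseteq> lift (halfspace M \<D> P)"
    unfolding inv.lift_inverse[OF halfspace_subset_T] .
qed (rule lift_halfspace_subset[OF P])

lemma wall_image:
  assumes "D \<in> \<D>"
  shows "wall M \<D> (h ` fst D, (`) h ` snd D) = lift ` wall M \<D> D"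
  unfolding wall_def snd_conv image_image using lift_halfspace[OF parts(2)[OF assms]] by (intro image_cong) simp_all

lemma lift_in: "A \<in> \<H> \<Longrightarrow> lift A \<in> \<H>"
proof -
  assume "A \<in> \<H>"
  then obtain D where D: "D \<in> \<D>" "A \<in> wall M \<D> D"
    unfolding halfspaces_def by blast
  then have "lift A \<in> wall M \<D> (h ` fst D, (`) h ` snd D)"
    unfolding wall_image[OF D(1)] by blast
  then show ?thesis
    unfolding halfspaces_def using invariant(1)[OF D(1)] by blast
qed

lemma lift_halfspace_inverse: "A \<in> \<H> \<Longrightarrow> (`) k ` lift A = A"
  by (rule lift_inverse[OF halfspace_subset(1)])

lemma lift_compl:
  assumes "A \<subseteq> T"
  shows "lift (T - A) = T - lift A"
proof -
  interpret inv: wall_symmetry M \<D> t\<^sub>0 k h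
    by (rule swap)
  have "inj_on ((`) h) T"
    by (rule inj_on_inverseI[of _ "(`) k"]) (rule image_inverse[OF T_subset])
  moreover have "lift T = T"
  proof
    show "lift T \<subseteq> T"
      using image_triple by blast
    have "(`) k ` T \<subseteq> T"
      using inv.image_triple by blast
    from image_mono[OF this, of "(`) h"] show "T \<subseteq> lift T"
      unfolding inv.lift_inverse[OF order_refl] .
  qed
  ultimately show ?thesis
    using inj_on_image_set_diff[of "(`) h" T T A] assms by auto
qed

lemma lift_ultrafilter_inverse:
  assumes "\<alpha> \<subseteq> \<H>"
  shows "lift_ultrafilter k (lift_ultrafilter h \<alpha>) = \<alpha>"
proof -
  have "(`) k ` lift A = A" if "A \<in> \<alpha>" for A
    using lift_halfspace_inverse assms that by blast
  then show ?thesis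
    unfolding lift_ultrafilter_def image_image[of "\<lambda>A. (`) k ` A"] by simp
qed

lemma lift_mem_iff:
  assumes "\<alpha> \<subseteq> \<H>" "A \<in> \<H>"
  shows "lift A \<in> lift_ultrafilter h \<alpha> \<longleftrightarrow> A \<in> \<alpha>"
proof
  assume "lift A \<in> lift_ultrafilter h \<alpha>"
  then obtain B where "B \<in> \<alpha>" "lift A = lift B"
    unfolding lift_ultrafilter_def by (elim imageE)
  then show "A \<in> \<alpha>"
    using lift_halfspace_inverse assms by (metis subsetD)
qed (simp add: lift_ultrafilter_def)

lemma lift_ultrafilter_subset: "\<alpha> \<subseteq> \<H> \<Longrightarrow> lift_ultrafilter h \<alpha> \<subseteq> \<H>"
  unfolding lift_ultrafilter_def using lift_in by blast

lemma lift_surj: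
  assumes "B \<in> \<H>"
  obtains A where "A \<in> \<H>" "B = lift A"
proof -
  interpret inv: wall_symmetry M \<D> t\<^sub>0 k h
    by (rule swap)
  show ?thesis
    using that[OF inv.lift_in[OF assms]] inv.lift_halfspace_inverse[OF assms] by simp
qed

lemma lift_subset_iff: "A \<in> \<H> \<Longrightarrow> B \<in> \<H> \<Longrightarrow> lift A \<subseteq> lift B \<longleftrightarrow> A \<subseteq> B"
  using lift_halfspace_inverse by (metis image_mono)

lemma lift_wall_ultrafilter:
  assumes \<alpha>: "wall_ultrafilter M \<D> \<alpha>"
  shows "wall_ultrafilter M \<D> (lift_ultrafilter h \<alpha>)"
  unfolding ultrafilter_iff
proof (intro conjI ballI impI)
  have sub: "\<alpha> \<subseteq> \<H>"
    using ultrafilterD(1)[OF \<alpha>] by blast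
  show "lift_ultrafilter h \<alpha> \<subseteq> \<H>"
    by (rule lift_ultrafilter_subset[OF sub])
  fix A
  show "T - A \<in> lift_ultrafilter h \<alpha> \<longleftrightarrow> A \<notin> lift_ultrafilter h \<alpha>" if A: "A \<in> \<H>"
  proof -
    obtain B where B: "B \<in> \<H>" "A = lift B"
      using A by (rule lift_surj)
    show ?thesis
      unfolding B(2) lift_compl[OF halfspace_subset(1)[OF B(1)], symmetric]
        lift_mem_iff[OF sub B(1)] lift_mem_iff[OF sub halfspace_compl[OF B(1)]]
      by (rule ultrafilterD(2)[OF \<alpha> B(1)])
  qed
  fix B
  assume A: "A \<in> lift_ultrafilter h \<alpha>" and B: "B \<in> \<H>" and AB: "A \<subseteq> B"
  obtain A' where A': "A' \<in> \<alpha>" "A = lift A'"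
    using A unfolding lift_ultrafilter_def by (elim imageE)
  obtain B' where B': "B' \<in> \<H>" "B = lift B'"
    using B by (rule lift_surj)
  have "A' \<subseteq> B'"
    using AB lift_subset_iff[OF ultrafilterD(1)[OF \<alpha> A'(1)] B'(1)] unfolding A'(2) B'(2) by simp
  then have "B' \<in> \<alpha>"
    by (rule ultrafilterD(3)[OF \<alpha> A'(1) B'(1)])
  then show "B \<in> lift_ultrafilter h \<alpha>"
    unfolding B'(2) lift_mem_iff[OF sub B'(1)] .
qed

lemma lift_dcc:
  assumes sub: "\<alpha> \<subseteq> \<H>" and dcc: "dcc \<alpha>"
  shows "dcc (lift_ultrafilter h \<alpha>)"
  unfolding dcc_def
proof (intro allI impI)
  fix A :: "nat \<Rightarrow> 'a set set"
  assume A: "\<forall>i. A i \<in> lift_ultrafilter h \<alpha> \<and> A (Suc i) \<subseteq> A i"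
  then have "\<forall>i. \<exists>B. B \<in> \<alpha> \<and> A i = lift B"
    unfolding lift_ultrafilter_def by blast
  then obtain B where B: "\<And>i. B i \<in> \<alpha>" "\<And>i. A i = lift (B i)"
    by metis
  have "B (Suc i) \<subseteq> B i" for i
    using A B lift_subset_iff sub by (metis subsetD)
  then obtain n where "\<forall>m\<ge>n. B m = B n"
    using dcc B(1) unfolding dcc_def by blast
  then show "\<exists>n. \<forall>m\<ge>n. A m = A n"
    unfolding B(2) by metis
qed

lemma Z_subset: "\<alpha> \<in> Z_vertices M \<D> \<Longrightarrow> \<alpha> \<subseteq> \<H>"
  unfolding Z_vertices_def using ultrafilterD(1) by blast

lemma lift_Z: "\<alpha> \<in> Z_vertices M \<D> \<Longrightarrow> lift_ultrafilter h \<alpha> \<in> Z_vertices M \<D>"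
  using lift_wall_ultrafilter lift_dcc Z_subset unfolding Z_vertices_def by blast

lemma inj_lift_Z: "inj_on (lift_ultrafilter h) (Z_vertices M \<D>)"
  by (rule inj_on_inverseI[of _ "lift_ultrafilter k"]) (rule lift_ultrafilter_inverse[OF Z_subset])

lemma lift_edge:
  assumes "{\<alpha>, \<beta>} \<in> Z_edges M \<D>"
  shows "{lift_ultrafilter h \<alpha>, lift_ultrafilter h \<beta>} \<in> Z_edges M \<D>"
proof -
  have flip: "{lift_ultrafilter h \<gamma>, lift_ultrafilter h ((\<gamma> - {A}) \<union> {T - A})} \<in> Z_edges M \<D>"
    if \<gamma>: "\<gamma> \<in> Z_vertices M \<D>" and \<gamma>': "(\<gamma> - {A}) \<union> {T - A} \<in> Z_vertices M \<D>"
      and A: "A \<in> \<gamma>" and min: "\<forall>B\<in>\<gamma>. B \<subseteq> A \<longrightarrow> B = A" for \<gamma> A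
  proof -
    have sub: "\<gamma> \<subseteq> \<H>"
      by (rule Z_subset[OF \<gamma>])
    have AH: "A \<in> \<H>"
      using A sub by blast
    have inj: "inj_on (\<lambda>A. lift A) \<H>"
      by (rule inj_on_inverseI[of _ "\<lambda>A. (`) k ` A"]) (rule lift_halfspace_inverse)
    have "(\<lambda>A. lift A) ` (\<gamma> - {A}) = (\<lambda>A. lift A) ` \<gamma> - (\<lambda>A. lift A) ` {A}"
      by (rule inj_on_image_set_diff[OF inj]) (use sub AH in auto)
    then have eq: "lift_ultrafilter h ((\<gamma> - {A}) \<union> {T - A}) = (lift_ultrafilter h \<gamma> - {lift A}) \<union> {T - lift A}"
      unfolding lift_ultrafilter_def image_Un lift_compl[OF halfspace_subset(1)[OF AH], symmetric] by simp
    have "B = lift A" if B: "B \<in> lift_ultrafilter h \<gamma>" "B \<subseteq> lift A" for B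
    proof -
      obtain B' where B': "B' \<in> \<gamma>" "B = lift B'"
        using B(1) unfolding lift_ultrafilter_def by (elim imageE)
      then have "B' \<subseteq> A"
        using B(2) lift_subset_iff[of B' A] sub AH by blast
      then show ?thesis
        using min B' by blast
    qed
    then have "\<exists>C\<in>lift_ultrafilter h \<gamma>. (\<forall>B\<in>lift_ultrafilter h \<gamma>. B \<subseteq> C \<longrightarrow> B = C) \<and>
        lift_ultrafilter h ((\<gamma> - {A}) \<union> {T - A}) = (lift_ultrafilter h \<gamma> - {C}) \<union> {T - C}"
      using eq A lift_mem_iff[OF sub AH] by (intro bexI[of _ "lift A"] conjI ballI impI) simp_all
    then show ?thesis
      unfolding Z_edges_def using lift_Z[OF \<gamma>] lift_Z[OF \<gamma>'] by (intro CollectI exI conjI) simp_all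
  qed
  obtain \<gamma> A where \<gamma>: "{\<alpha>, \<beta>} = {\<gamma>, (\<gamma> - {A}) \<union> {T - A}}" "\<gamma> \<in> Z_vertices M \<D>" "A \<in> \<gamma>"
    "(\<gamma> - {A}) \<union> {T - A} \<in> Z_vertices M \<D>" "\<forall>B\<in>\<gamma>. B \<subseteq> A \<longrightarrow> B = A"
    using assms unfolding Z_edges_def by blast
  have "{lift_ultrafilter h \<alpha>, lift_ultrafilter h \<beta>} = lift_ultrafilter h ` {\<alpha>, \<beta>}"
    by simp
  also have "\<dots> = {lift_ultrafilter h \<gamma>, lift_ultrafilter h ((\<gamma> - {A}) \<union> {T - A})}"
    unfolding \<gamma>(1) by simp
  finally show ?thesis
    using flip[OF \<gamma>(2,4,3,5)] by simp
qed

lemma lift_principal: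
  assumes t: "t \<in> T"
  shows "lift_ultrafilter h (principal_ultrafilter M \<D> t) = principal_ultrafilter M \<D> (h ` t)"
proof -
  have iff: "h ` t \<in> lift A \<longleftrightarrow> t \<in> A" if "A \<in> \<H>" for A
  proof
    assume "h ` t \<in> lift A"
    then obtain u where u: "u \<in> A" "h ` t = h ` u"
      by (elim imageE)
    have "u \<in> T"
      using halfspace_subset(1)[OF that] u(1) by blast
    then show "t \<in> A"
      using u image_inverse[OF T_subset] t by metis
  qed simp
  show ?thesis
  proof (intro subset_antisym subsetI)
    fix B
    assume "B \<in> lift_ultrafilter h (principal_ultrafilter M \<D> t)"
    then obtain A where A: "B = lift A" "A \<in> \<H>" "t \<in> A"
      unfolding lift_ultrafilter_def principal_ultrafilter_def by blast
    then show "B \<in> principal_ultrafilter M \<D> (h ` t)"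
      unfolding principal_ultrafilter_def using lift_in[OF A(2)] iff[OF A(2)] by simp
  next
    fix B
    assume B: "B \<in> principal_ultrafilter M \<D> (h ` t)"
    then have "B \<in> \<H>"
      unfolding principal_ultrafilter_def by simp
    then obtain A where A: "A \<in> \<H>" "B = lift A"
      by (rule lift_surj)
    then have "A \<in> principal_ultrafilter M \<D> t"
      using B iff[OF A(1)] unfolding principal_ultrafilter_def by simp
    then show "B \<in> lift_ultrafilter h (principal_ultrafilter M \<D> t)"
      unfolding lift_ultrafilter_def A(2) by (rule imageI)
  qed
qed

lemma lift_X:
  assumes "\<alpha> \<in> X_vertices M \<D>"
  shows "lift_ultrafilter h \<alpha> \<in> X_vertices M \<D>"
proof -
  let ?R = "{(\<beta>, \<gamma>). {\<beta>, \<gamma>} \<in> Z_edges M \<D>}"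
  obtain t where t: "t \<in> T" "(principal_ultrafilter M \<D> t, \<alpha>) \<in> ?R\<^sup>*" and Z: "\<alpha> \<in> Z_vertices M \<D>"
    using assms unfolding X_vertices_def by blast
  from t(2) have "(lift_ultrafilter h (principal_ultrafilter M \<D> t), lift_ultrafilter h \<alpha>) \<in> ?R\<^sup>*"
  proof (induction rule: rtrancl_induct)
    case (step \<beta> \<gamma>)
    then have "(lift_ultrafilter h \<beta>, lift_ultrafilter h \<gamma>) \<in> ?R"
      using lift_edge by simp
    with step.IH show ?case
      by (rule rtrancl_into_rtrancl)
  qed simp
  then show ?thesis
    unfolding X_vertices_def lift_principal[OF t(1)] using lift_Z[OF Z] image_triple[OF t(1)] by blast
qed

lemma lift_X_inverse: "\<alpha> \<in> X_vertices M \<D> \<Longrightarrow> lift_ultrafilter k (lift_ultrafilter h \<alpha>) = \<alpha>"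
  using lift_ultrafilter_inverse[OF Z_subset] X_vertices_subset by blast

lemma inj_lift_X: "inj_on (lift_ultrafilter h) (X_vertices M \<D>)"
  by (rule inj_on_subset[OF inj_lift_Z X_vertices_subset])

lemma lift_image_X: "lift_ultrafilter h ` X_vertices M \<D> = X_vertices M \<D>"
proof
  interpret inv: wall_symmetry M \<D> t\<^sub>0 k h
    by (rule swap)
  show "X_vertices M \<D> \<subseteq> lift_ultrafilter h ` X_vertices M \<D>"
  proof
    fix \<alpha>
    assume \<alpha>: "\<alpha> \<in> X_vertices M \<D>"
    show "\<alpha> \<in> lift_ultrafilter h ` X_vertices M \<D>"
      using imageI[OF inv.lift_X[OF \<alpha>], of "lift_ultrafilter h"] unfolding inv.lift_X_inverse[OF \<alpha>] .
  qed
qed (use lift_X in blast)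

lemma lift_cube:
  assumes "Q \<in> dual_complex M \<D>"
  shows "lift_ultrafilter h ` Q \<in> dual_complex M \<D>"
proof -
  obtain S f where Q: "Q = f ` Pow S" "Q \<subseteq> X_vertices M \<D>"
    and map: "cube_map (Z_vertices M \<D>) (Z_edges M \<D>) S f"
    using assms unfolding dual_complex_def Z_cubes_def by blast
  have fZ: "f ` Pow S \<subseteq> Z_vertices M \<D>"
    using Q X_vertices_subset by blast
  have f: "finite S" "inj_on f (Pow S)" "f {} \<in> Z_vertices M \<D>"
    "\<And>A i. A \<subseteq> S \<and> i \<in> S - A \<Longrightarrow> {f A, f (insert i A)} \<in> Z_edges M \<D>"
    using map unfolding Z_cube_map_iff by iprover+
  have inj: "inj_on (\<lambda>A. lift_ultrafilter h (f A)) (Pow S)"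
    using comp_inj_on[OF f(2) inj_on_subset[OF inj_lift_Z fZ]] by (simp add: comp_def)
  have "cube_map (Z_vertices M \<D>) (Z_edges M \<D>) S (\<lambda>A. lift_ultrafilter h (f A))"
    unfolding Z_cube_map_iff
    using f(1,4) inj lift_Z[OF f(3)] lift_edge by simp
  moreover have "lift_ultrafilter h ` Q = (\<lambda>A. lift_ultrafilter h (f A)) ` Pow S"
    unfolding Q(1) image_image ..
  moreover have "lift_ultrafilter h ` Q \<subseteq> X_vertices M \<D>"
    using Q(2) lift_X by blast
  ultimately show ?thesis
    unfolding dual_complex_def Z_cubes_def by blast
qed

section \<open>The induced map on the points of the realization\<close>

definition vertex_map :: "'a set set set \<Rightarrow> 'a set set set" where
  "vertex_map = restrict (lift_ultrafilter h) (X_vertices M \<D>)"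

lemma vertex_map: "x \<in> X_vertices M \<D> \<Longrightarrow> vertex_map x = lift_ultrafilter h x"
  by (simp add: vertex_map_def)

lemma vertex_map_in: "x \<in> X_vertices M \<D> \<Longrightarrow> vertex_map x \<in> X_vertices M \<D>"
  using lift_X by (simp add: vertex_map)

lemma vertex_map_inject:
  "x \<in> X_vertices M \<D> \<Longrightarrow> y \<in> X_vertices M \<D> \<Longrightarrow> vertex_map x = vertex_map y \<longleftrightarrow> x = y"
  using inj_on_eq_iff[OF inj_lift_X] by (simp add: vertex_map)

lemma vertex_map_surj:
  assumes "y \<in> X_vertices M \<D>"
  obtains x where "x \<in> X_vertices M \<D>" "y = vertex_map x"
  using assms lift_image_X vertex_map by (metis imageE)

lemma vertex_map_image: "Q \<subseteq> X_vertices M \<D> \<Longrightarrow> vertex_map ` Q = lift_ultrafilter h ` Q"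
  by (rule image_cong[OF refl]) (use vertex_map in blast)

lemma cube_subset_X: "Q \<in> dual_complex M \<D> \<Longrightarrow> Q \<subseteq> X_vertices M \<D>"
  unfolding dual_complex_def by blast

lemma vertex_map_cube: "Q \<in> dual_complex M \<D> \<Longrightarrow> vertex_map ` Q \<in> dual_complex M \<D>"
  using lift_cube vertex_map_image[OF cube_subset_X] by simp

text \<open>The vertex map is injective on the support of \<open>w\<close>, so the sum defining the
  pushed-forward weight has at most one term.\<close>

lemma point_map_at_image:
  assumes w: "\<And>u. w u \<noteq> 0 \<Longrightarrow> u \<in> X_vertices M \<D>" and x: "x \<in> X_vertices M \<D>"
  shows "point_map vertex_map w (vertex_map x) = w x"
proof -
  have "{u. w u \<noteq> 0 \<and> vertex_map u = vertex_map x} = (if w x \<noteq> 0 then {x} else {})"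
    using w x vertex_map_inject by auto
  then have "point_map vertex_map w (vertex_map x) = sum w (if w x \<noteq> 0 then {x} else {})"
    unfolding point_map_def by (rule arg_cong)
  then show ?thesis
    by (auto split: if_splits)
qed

lemma point_map_outside:
  assumes w: "\<And>u. w u \<noteq> 0 \<Longrightarrow> u \<in> X_vertices M \<D>" and x: "x \<notin> X_vertices M \<D>"
  shows "point_map vertex_map w x = 0"
proof -
  have "{u. w u \<noteq> 0 \<and> vertex_map u = x} = {}"
    using w x vertex_map_in by blast
  then show ?thesis
    unfolding point_map_def by (simp only: sum.empty)
qed

lemma point_map_cube_point:
  assumes f: "f ` Pow S \<subseteq> X_vertices M \<D>"
  shows "point_map vertex_map (cube_point S f t) = cube_point S (\<lambda>A. vertex_map (f A)) t"
proof
  fix y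
  have empty: "cube_point S f' t x = 0" if "\<And>A. A \<subseteq> S \<Longrightarrow> f' A \<noteq> x" for f' x
  proof -
    have "{A. A \<subseteq> S \<and> f' A = x} = {}"
      using that by blast
    then show ?thesis
      unfolding cube_point_def by (simp only: sum.empty)
  qed
  have supp: "u \<in> X_vertices M \<D>" if "cube_point S f t u \<noteq> 0" for u
    using empty[of f u] that f by blast
  show "point_map vertex_map (cube_point S f t) y = cube_point S (\<lambda>A. vertex_map (f A)) t y"
  proof (cases "y \<in> X_vertices M \<D>")
    case True
    then obtain x where x: "x \<in> X_vertices M \<D>" "y = vertex_map x"
      by (rule vertex_map_surj)
    have "vertex_map (f A) = vertex_map x \<longleftrightarrow> f A = x" if "A \<subseteq> S" for A
      using f that by (intro vertex_map_inject[OF _ x(1)]) blast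
    then have "{A. A \<subseteq> S \<and> vertex_map (f A) = vertex_map x} = {A. A \<subseteq> S \<and> f A = x}"
      by blast
    then have "cube_point S (\<lambda>A. vertex_map (f A)) t (vertex_map x) = cube_point S f t x"
      by (simp only: cube_point_def)
    moreover have "point_map vertex_map (cube_point S f t) (vertex_map x) = cube_point S f t x"
      by (rule point_map_at_image[OF _ x(1)]) (rule supp)
    ultimately show ?thesis
      unfolding x(2) by simp
  next
    case False
    then have "vertex_map (f A) \<noteq> y" if "A \<subseteq> S" for A
      using f that vertex_map_in by blast
    then show ?thesis
      using point_map_outside[OF supp False] empty[of "\<lambda>A. vertex_map (f A)" y] by simp
  qed
qed

text \<open>The symmetry carries faces to faces, and its inverse shows that every face of the image
  arises in this way.\<close>

lemma chart_image:
  assumes Q: "Q \<in> dual_complex M \<D>" and chart: "cube_chart (dual_complex M \<D>) S f Q"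
  shows "cube_chart (dual_complex M \<D>) S (\<lambda>A. vertex_map (f A)) (vertex_map ` Q)"
proof -
  interpret inv: wall_symmetry M \<D> t\<^sub>0 k h
    by (rule swap)
  have S: "finite S" and f: "bij_betw f (Pow S) Q"
    and faces: "{F \<in> dual_complex M \<D>. F \<subseteq> Q} = {f ` {A..B} | A B. A \<subseteq> B \<and> B \<subseteq> S}"
    using chart unfolding cube_chart_def by iprover+
  have QX: "Q \<subseteq> X_vertices M \<D>"
    by (rule cube_subset_X[OF Q])
  have "inj_on vertex_map Q"
    by (rule inj_onI) (use vertex_map_inject QX in blast)
  then have bij: "bij_betw (\<lambda>A. vertex_map (f A)) (Pow S) (vertex_map ` Q)"
    using bij_betw_trans[OF f inj_on_imp_bij_betw] by (simp add: comp_def)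
  have inverse: "inv.vertex_map ` vertex_map ` F = F" if "F \<subseteq> X_vertices M \<D>" for F
  proof -
    have "inv.vertex_map (vertex_map x) = x" if "x \<in> F" for x
      using that \<open>F \<subseteq> X_vertices M \<D>\<close> inv.vertex_map[OF vertex_map_in] vertex_map lift_X_inverse by auto
    then show ?thesis
      unfolding image_image by simp
  qed
  have inverse': "vertex_map ` inv.vertex_map ` F = F" if "F \<subseteq> X_vertices M \<D>" for F
  proof -
    have "vertex_map (inv.vertex_map x) = x" if "x \<in> F" for x
      using that \<open>F \<subseteq> X_vertices M \<D>\<close> vertex_map[OF inv.vertex_map_in] inv.vertex_map inv.lift_X_inverse by auto
    then show ?thesis
      unfolding image_image by simp
  qed
  have "{F \<in> dual_complex M \<D>. F \<subseteq> vertex_map ` Q} = (`) vertex_map ` {F \<in> dual_complex M \<D>. F \<subseteq> Q}"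
  proof (intro subset_antisym subsetI)
    fix F
    assume "F \<in> {F \<in> dual_complex M \<D>. F \<subseteq> vertex_map ` Q}"
    then have F: "F \<in> dual_complex M \<D>" "F \<subseteq> vertex_map ` Q"
      by simp_all
    have "inv.vertex_map ` F \<subseteq> Q"
      using image_mono[OF F(2), of inv.vertex_map] inverse[OF QX] by simp
    then have "inv.vertex_map ` F \<in> {F \<in> dual_complex M \<D>. F \<subseteq> Q}"
      using inv.vertex_map_cube[OF F(1)] by simp
    then have "vertex_map ` inv.vertex_map ` F \<in> (`) vertex_map ` {F \<in> dual_complex M \<D>. F \<subseteq> Q}"
      by (rule imageI)
    then show "F \<in> (`) vertex_map ` {F \<in> dual_complex M \<D>. F \<subseteq> Q}"
      unfolding inverse'[OF cube_subset_X[OF F(1)]] .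
  next
    fix F
    assume "F \<in> (`) vertex_map ` {F \<in> dual_complex M \<D>. F \<subseteq> Q}"
    then obtain F' where F': "F = vertex_map ` F'" "F' \<in> dual_complex M \<D>" "F' \<subseteq> Q"
      by blast
    then show "F \<in> {F \<in> dual_complex M \<D>. F \<subseteq> vertex_map ` Q}"
      using vertex_map_cube[OF F'(2)] image_mono[OF F'(3), of vertex_map] by simp
  qed
  also have "\<dots> = {(\<lambda>A. vertex_map (f A)) ` {A..B} | A B. A \<subseteq> B \<and> B \<subseteq> S}"
  proof -
    have "(`) vertex_map ` {f ` {A..B} | A B. A \<subseteq> B \<and> B \<subseteq> S} = {vertex_map ` f ` {A..B} | A B. A \<subseteq> B \<and> B \<subseteq> S}"
      by blast
    then show ?thesis
      unfolding faces image_image[of vertex_map f] .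
  qed
  finally show ?thesis
    unfolding cube_chart_def using S bij by iprover
qed

lemma point_map_realization:
  assumes "w \<in> realization (dual_complex M \<D>)"
  shows "point_map vertex_map w \<in> realization (dual_complex M \<D>)"
proof -
  obtain Q where Q: "Q \<in> dual_complex M \<D>" "w \<in> cube_points (dual_complex M \<D>) Q"
    using assms unfolding realization_def by blast
  obtain S f t where w: "w = cube_point S f t" and chart: "cube_chart (dual_complex M \<D>) S f Q"
    and t: "\<forall>i\<in>S. 0 \<le> t i \<and> t i \<le> 1"
    using Q(2) unfolding cube_points_def by blast
  have "f ` Pow S = Q"
    using chart unfolding cube_chart_def bij_betw_def by iprover
  then have "point_map vertex_map w = cube_point S (\<lambda>A. vertex_map (f A)) t"
    unfolding w using cube_subset_X[OF Q(1)] by (intro point_map_cube_point) simp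
  then have "point_map vertex_map w \<in> cube_points (dual_complex M \<D>) (vertex_map ` Q)"
    unfolding cube_points_def using chart_image[OF Q(1) chart] t by blast
  then show ?thesis
    unfolding realization_def using vertex_map_cube[OF Q(1)] by blast
qed

lemma mass_point_map:
  assumes w: "w \<in> realization (dual_complex M \<D>)" and A: "A \<in> \<H>"
  shows "mass (point_map vertex_map w) (lift A) = mass w A"
proof -
  note X = realization_support(2)[OF w]
  have sub: "x \<subseteq> \<H>" if "x \<in> X_vertices M \<D>" for x
    using Z_subset X_vertices_subset that by blast
  have "{y. point_map vertex_map w y \<noteq> 0 \<and> lift A \<in> y} = vertex_map ` {x. w x \<noteq> 0 \<and> A \<in> x}"
  proof (intro subset_antisym subsetI)
    fix y
    assume "y \<in> {y. point_map vertex_map w y \<noteq> 0 \<and> lift A \<in> y}"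
    then have y: "point_map vertex_map w y \<noteq> 0" "lift A \<in> y"
      by simp_all
    have "y \<in> X_vertices M \<D>"
      using point_map_outside[OF X] y(1) by blast
    then obtain x where x: "x \<in> X_vertices M \<D>" "y = vertex_map x"
      by (rule vertex_map_surj)
    have "w x \<noteq> 0"
      using y(1) point_map_at_image[OF X x(1)] unfolding x(2) by simp
    moreover have "A \<in> x"
      using y(2) lift_mem_iff[OF sub[OF x(1)] A] unfolding x(2) vertex_map[OF x(1)] by simp
    ultimately show "y \<in> vertex_map ` {x. w x \<noteq> 0 \<and> A \<in> x}"
      using x(2) by blast
  next
    fix y
    assume "y \<in> vertex_map ` {x. w x \<noteq> 0 \<and> A \<in> x}"
    then obtain x where x: "y = vertex_map x" "w x \<noteq> 0" "A \<in> x"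
      by blast
    then show "y \<in> {y. point_map vertex_map w y \<noteq> 0 \<and> lift A \<in> y}"
      using point_map_at_image[OF X X[OF x(2)]] lift_mem_iff[OF sub[OF X[OF x(2)]] A]
      by (simp add: vertex_map[OF X[OF x(2)]])
  qed
  moreover have "inj_on vertex_map {x. w x \<noteq> 0 \<and> A \<in> x}"
    by (rule inj_onI) (use vertex_map_inject X in blast)
  ultimately have "mass (point_map vertex_map w) (lift A) =
      (\<Sum>x | w x \<noteq> 0 \<and> A \<in> x. point_map vertex_map w (vertex_map x))"
    unfolding mass_def by (simp add: sum.reindex)
  also have "\<dots> = mass w A"
    unfolding mass_def by (rule sum.cong[OF refl]) (use point_map_at_image[OF X] X in blast)
  finally show ?thesis .
qed

lemma point_map_surj:
  assumes w: "w \<in> realization (dual_complex M \<D>)"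
  shows "\<exists>w'\<in>realization (dual_complex M \<D>). w = point_map vertex_map w'"
proof -
  interpret inv: wall_symmetry M \<D> t\<^sub>0 k h
    by (rule swap)
  let ?w = "point_map inv.vertex_map w"
  have w': "?w \<in> realization (dual_complex M \<D>)"
    by (rule inv.point_map_realization[OF w])
  have "point_map vertex_map ?w y = w y" for y
  proof (cases "y \<in> X_vertices M \<D>")
    case True
    let ?x = "inv.vertex_map y"
    have x: "?x \<in> X_vertices M \<D>"
      by (rule inv.vertex_map_in[OF True])
    have "vertex_map ?x = y"
      using vertex_map[OF x] inv.vertex_map[OF True] inv.lift_X_inverse[OF True] by simp
    then have "point_map vertex_map ?w y = ?w ?x"
      using point_map_at_image[OF realization_support(2)[OF w'] x] by simp
    also have "\<dots> = w y"
      by (rule inv.point_map_at_image[OF realization_support(2)[OF w] True])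
    finally show ?thesis .
  next
    case False
    then have "w y = 0"
      using realization_support(2)[OF w] by blast
    then show ?thesis
      using point_map_outside[OF realization_support(2)[OF w'] False] by simp
  qed
  then show ?thesis
    using w' by (intro bexI[of _ ?w]) auto
qed

lemma wall_hyperplane_image:
  assumes A: "A \<in> \<H>"
  shows "point_map vertex_map ` wall_hyperplane A = wall_hyperplane (lift A)"
proof (intro subset_antisym subsetI)
  fix w
  assume "w \<in> point_map vertex_map ` wall_hyperplane A"
  then obtain w' where w': "w = point_map vertex_map w'" "w' \<in> realization (dual_complex M \<D>)" "mass w' A = 1/2"
    unfolding wall_hyperplane_def by blast
  show "w \<in> wall_hyperplane (lift A)"
    unfolding wall_hyperplane_def w'(1)
    using point_map_realization[OF w'(2)] mass_point_map[OF w'(2) A] w'(3) by simp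
next
  fix w
  assume "w \<in> wall_hyperplane (lift A)"
  then have w: "w \<in> realization (dual_complex M \<D>)" "mass w (lift A) = 1/2"
    unfolding wall_hyperplane_def by simp_all
  obtain w' where w': "w' \<in> realization (dual_complex M \<D>)" "w = point_map vertex_map w'"
    using point_map_surj[OF w(1)] by (elim bexE)
  have "w' \<in> wall_hyperplane A"
    unfolding wall_hyperplane_def using w'(1) mass_point_map[OF w'(1) A] w(2) unfolding w'(2) by simp
  then show "w \<in> point_map vertex_map ` wall_hyperplane A"
    unfolding w'(2) by (rule imageI)
qed

end

section \<open>Stabilizers\<close>

locale wall_action = wallspace M \<D> t\<^sub>0 + group_action G "topspace M" \<phi>
  for M :: "'a topology" and \<D> :: "'a division set" and t\<^sub>0 :: "'a set"
    and G :: "('g, 'm) monoid_scheme" and \<phi> :: "'g \<Rightarrow> 'a \<Rightarrow> 'a" +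
  assumes act_in: "g \<in> carrier G \<Longrightarrow> D \<in> \<D> \<Longrightarrow> division_act \<phi> g D \<in> \<D>"
    and division_parts: "D \<in> \<D> \<Longrightarrow> fst D \<subseteq> topspace M" "D \<in> \<D> \<Longrightarrow> P \<in> snd D \<Longrightarrow> P \<subseteq> topspace M"
    and wall_inject: "inj_on (wall M \<D>) \<D>"
begin

lemma group_G: "group G"
  using group_hom by (simp add: group_hom_def)

lemma symmetry:
  assumes g: "g \<in> carrier G"
  shows "wall_symmetry M \<D> t\<^sub>0 (\<phi> g) (\<phi> (inv\<^bsub>G\<^esub> g))"
proof -
  have g': "inv\<^bsub>G\<^esub> g \<in> carrier G"
    using group.inv_closed[OF group_G g] .
  show ?thesis
  proof unfold_locales
    fix x
    assume x: "x \<in> topspace M"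
    show gx: "\<phi> g x \<in> topspace M" and g'x: "\<phi> (inv\<^bsub>G\<^esub> g) x \<in> topspace M"
      using element_image[OF g x] element_image[OF g' x] by simp_all
    show "\<phi> (inv\<^bsub>G\<^esub> g) (\<phi> g x) = x"
      by (rule orbit_sym_aux[OF g x refl])
    show "\<phi> g (\<phi> (inv\<^bsub>G\<^esub> g) x) = x"
      using orbit_sym_aux[OF g' x refl] group.inv_inv[OF group_G g] by simp
  next
    fix D
    assume D: "D \<in> \<D>"
    show "(\<phi> g ` fst D, (`) (\<phi> g) ` snd D) \<in> \<D>"
      using act_in[OF g D] unfolding division_act_def .
    show "(\<phi> (inv\<^bsub>G\<^esub> g) ` fst D, (`) (\<phi> (inv\<^bsub>G\<^esub> g)) ` snd D) \<in> \<D>"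
      using act_in[OF g' D] unfolding division_act_def .
  qed (fact division_parts)+
qed

lemma dual_action_eq:
  assumes "g \<in> carrier G"
  shows "dual_action M \<D> \<phi> g = wall_symmetry.vertex_map M \<D> (\<phi> g)"
proof -
  interpret wall_symmetry M \<D> t\<^sub>0 "\<phi> g" "\<phi> (inv\<^bsub>G\<^esub> g)"
    by (rule symmetry[OF assms])
  show ?thesis
    unfolding dual_action_def vertex_map_def lift_ultrafilter_def dual_complex_eq_cells Union_cells ..
qed

lemma lift_ultrafilter_mult:
  assumes g: "g \<in> carrier G" and h: "h \<in> carrier G" and \<alpha>: "\<alpha> \<subseteq> \<H>"
  shows "lift_ultrafilter (\<phi> (g \<otimes>\<^bsub>G\<^esub> h)) \<alpha> = lift_ultrafilter (\<phi> g) (lift_ultrafilter (\<phi> h) \<alpha>)"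
proof -
  have t: "\<phi> (g \<otimes>\<^bsub>G\<^esub> h) ` t = \<phi> g ` \<phi> h ` t" if "t \<in> T" for t
    unfolding image_image
    by (rule image_cong[OF refl]) (use composition_rule g h that in \<open>unfold triples_def, blast\<close>)
  have "(`) (\<phi> (g \<otimes>\<^bsub>G\<^esub> h)) ` A = (`) (\<phi> g) ` (`) (\<phi> h) ` A" if "A \<in> \<alpha>" for A
    unfolding image_image[of "(`) (\<phi> g)"]
    by (rule image_cong[OF refl]) (use t halfspace_subset(1) that \<alpha> in blast)
  then show ?thesis
    unfolding lift_ultrafilter_def image_image[of "\<lambda>A. (`) (\<phi> g) ` A"] by (rule image_cong[OF refl])
qed

lemma cubical_dual_action: "cubical_action G (dual_complex M \<D>) (dual_action M \<D> \<phi>)"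
  unfolding cubical_action_def
proof (intro conjI ballI)
  let ?V = "X_vertices M \<D>"
  have Union: "\<Union>(dual_complex M \<D>) = ?V"
    unfolding dual_complex_eq_cells by (rule Union_cells)
  have act: "dual_action M \<D> \<phi> g = restrict (lift_ultrafilter (\<phi> g)) ?V" for g
    unfolding dual_action_def lift_ultrafilter_def Union ..
  have Bij: "dual_action M \<D> \<phi> g \<in> Bij ?V" if g: "g \<in> carrier G" for g
  proof -
    interpret wall_symmetry M \<D> t\<^sub>0 "\<phi> g" "\<phi> (inv\<^bsub>G\<^esub> g)"
      by (rule symmetry[OF g])
    have "bij_betw (lift_ultrafilter (\<phi> g)) ?V ?V"
      unfolding bij_betw_def using inj_lift_X lift_image_X by (intro conjI)
    then show ?thesis
      unfolding act Bij_def by (simp add: bij_betw_restrict_eq)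
  qed
  have "dual_action M \<D> \<phi> (g \<otimes>\<^bsub>G\<^esub> h) = compose ?V (dual_action M \<D> \<phi> g) (dual_action M \<D> \<phi> h)"
    if g: "g \<in> carrier G" and h: "h \<in> carrier G" for g h
  proof
    fix \<alpha>
    interpret wall_symmetry M \<D> t\<^sub>0 "\<phi> h" "\<phi> (inv\<^bsub>G\<^esub> h)"
      by (rule symmetry[OF h])
    show "dual_action M \<D> \<phi> (g \<otimes>\<^bsub>G\<^esub> h) \<alpha> = compose ?V (dual_action M \<D> \<phi> g) (dual_action M \<D> \<phi> h) \<alpha>"
    proof (cases "\<alpha> \<in> ?V")
      case True
      then have "\<alpha> \<subseteq> \<H>"
        using Z_subset X_vertices_subset by blast
      then show ?thesis
        using True lift_X[OF True] lift_ultrafilter_mult[OF g h] by (simp add: act compose_def)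
    qed (simp add: act compose_def)
  qed
  then have "dual_action M \<D> \<phi> \<in> Group.hom G (BijGroup ?V)"
    using Bij by (intro homI) (simp_all add: BijGroup_def)
  then show "group_action G (\<Union>(dual_complex M \<D>)) (dual_action M \<D> \<phi>)"
    unfolding Union group_action_def group_hom_def group_hom_axioms_def
    using group_G group_BijGroup by blast
  fix g Q
  assume g: "g \<in> carrier G" and Q: "Q \<in> dual_complex M \<D>"
  interpret wall_symmetry M \<D> t\<^sub>0 "\<phi> g" "\<phi> (inv\<^bsub>G\<^esub> g)"
    by (rule symmetry[OF g])
  show "dual_action M \<D> \<phi> g ` Q \<in> dual_complex M \<D>"
    unfolding dual_action_eq[OF g] by (rule vertex_map_cube[OF Q])
qed

text \<open>An element preserves the hyperplane exactly if it sends \<open>A\<close> to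
  \<open>A\<close> or to its complement, that is, preserves the wall as an unordered pair. Since
  walls determine divisions, this means preserving the division, possibly with its sides
  exchanged.\<close>

lemma stabilizer_wall_hyperplane:
  assumes D: "D \<in> \<D>" and A: "A \<in> wall M \<D> D"
  shows "stabilizer G (hyperplane_act (dual_action M \<D> \<phi>)) (wall_hyperplane A) = stabilizer G (division_act \<phi>) D"
proof -
  have AH: "A \<in> \<H>"
    using D A unfolding halfspaces_def by blast
  obtain B where B: "wall M \<D> D = {B, T - B}" "B \<subseteq> T"
    using wall_pair[OF D] by (elim exE conjE)
  have "A = B \<or> A = T - B"
    using A unfolding B(1) by simp
  moreover have "T - (T - B) = B"
    using B(2) by blast
  ultimately have wall: "wall M \<D> D = {A, T - A}"
    unfolding B(1) by (elim disjE) (simp_all add: insert_commute)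
  have "hyperplane_act (dual_action M \<D> \<phi>) g (wall_hyperplane A) = wall_hyperplane A \<longleftrightarrow> division_act \<phi> g D = D"
    if g: "g \<in> carrier G" for g
  proof -
    interpret wall_symmetry M \<D> t\<^sub>0 "\<phi> g" "\<phi> (inv\<^bsub>G\<^esub> g)"
      by (rule symmetry[OF g])
    let ?gA = "(`) (\<phi> g) ` A"
    have compl: "(`) (\<phi> g) ` (T - A) = T - ?gA"
      by (rule lift_compl[OF halfspace_subset(1)[OF AH]])
    have "hyperplane_act (dual_action M \<D> \<phi>) g (wall_hyperplane A) = wall_hyperplane ?gA"
      unfolding hyperplane_act_def dual_action_eq[OF g] by (rule wall_hyperplane_image[OF AH])
    then have "hyperplane_act (dual_action M \<D> \<phi>) g (wall_hyperplane A) = wall_hyperplane A \<longleftrightarrow> ?gA \<in> {A, T - A}"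
      using wall_hyperplane_eq_iff[OF AH lift_in[OF AH]] by (simp only: eq_commute)
    also have "\<dots> \<longleftrightarrow> {?gA, T - ?gA} = {A, T - A}"
    proof
      assume "?gA \<in> {A, T - A}"
      then have "?gA = A \<or> ?gA = T - A"
        by simp
      then show "{?gA, T - ?gA} = {A, T - A}"
        using compl_compl[OF AH] by (elim disjE) (simp_all only: insert_commute)
    next
      assume "{?gA, T - ?gA} = {A, T - A}"
      then show "?gA \<in> {A, T - A}"
        using insertI1[of ?gA "{T - ?gA}"] by (simp only:)
    qed
    also have "{?gA, T - ?gA} = wall M \<D> (division_act \<phi> g D)"
      unfolding division_act_def wall_image[OF D] wall by (simp only: image_insert image_empty compl)
    also have "\<dots> = {A, T - A} \<longleftrightarrow> division_act \<phi> g D = D"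
      unfolding wall[symmetric] using inj_on_eq_iff[OF wall_inject act_in[OF g D] D] .
    finally show ?thesis .
  qed
  then show ?thesis
    unfolding stabilizer_def by blast
qed

lemma hyperplane_stabilizers:
  "{stabilizer G (hyperplane_act (dual_action M \<D> \<phi>)) H | H. hyperplane (dual_complex M \<D>) H}
    = {stabilizer G (division_act \<phi>) D | D. D \<in> \<D>}"
proof (intro subset_antisym subsetI)
  fix S
  assume "S \<in> {stabilizer G (hyperplane_act (dual_action M \<D> \<phi>)) H | H. hyperplane (dual_complex M \<D>) H}"
  then obtain H where H: "S = stabilizer G (hyperplane_act (dual_action M \<D> \<phi>)) H" "hyperplane (dual_complex M \<D>) H"
    by blast
  then obtain A where A: "A \<in> \<H>" "H = wall_hyperplane A"
    unfolding hyperplane_dual_complex_iff by (elim bexE)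
  obtain D where D: "D \<in> \<D>" "A \<in> wall M \<D> D"
    using A(1) unfolding halfspaces_def by blast
  show "S \<in> {stabilizer G (division_act \<phi>) D | D. D \<in> \<D>}"
    unfolding H(1) A(2) stabilizer_wall_hyperplane[OF D] using D(1) by blast
next
  fix S
  assume "S \<in> {stabilizer G (division_act \<phi>) D | D. D \<in> \<D>}"
  then obtain D where D: "D \<in> \<D>" "S = stabilizer G (division_act \<phi>) D"
    by blast
  obtain A where A: "A \<in> wall M \<D> D"
    using wall_pair[OF D(1)] by blast
  then have "hyperplane (dual_complex M \<D>) (wall_hyperplane A)"
    unfolding hyperplane_dual_complex_iff halfspaces_def using D(1) by blast
  then show "S \<in> {stabilizer G (hyperplane_act (dual_action M \<D> \<phi>)) H | H. hyperplane (dual_complex M \<D>) H}"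
    unfolding D(2) stabilizer_wall_hyperplane[OF D(1) A, symmetric] by blast
qed

lemma principal_vertex: "t \<in> T \<Longrightarrow> principal_ultrafilter M \<D> t \<in> \<Union>(dual_complex M \<D>)"
  using principal_ultrafilter X_vertices_eq Union_cells by (simp add: dual_complex_eq_cells)

end

section \<open>Divisions\<close>

lemma divisionE:
  assumes "division M D" "P \<in> snd D"
  obtains N where "snd D = {P, N}" "P \<noteq> {}" "N \<noteq> {}" "P \<inter> N = {}" "P \<union> N = topspace M - fst D"
    "openin M P" "openin M N" "M closure_of P = P \<union> fst D" "M closure_of N = N \<union> fst D"
proof -
  let ?R = "subtopology M (topspace M - fst D)"
  note * = assms(1)[unfolded division_def Let_def]
  have C: "closedin M (fst D)" and sides: "\<forall>Q\<in>snd D. closedin ?R Q \<and> openin ?R Q \<and> M closure_of Q = Q \<union> fst D"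
    and ex: "\<exists>P N. snd D = {P, N} \<and> P \<noteq> {} \<and> N \<noteq> {} \<and> P \<inter> N = {} \<and> P \<union> N = topspace M - fst D"
    using * [THEN conjunct1] * [THEN conjunct2, THEN conjunct2, THEN conjunct2]
      * [THEN conjunct2, THEN conjunct2, THEN conjunct1] .
  have op: "openin M (topspace M - fst D)"
    using C by (simp add: closedin_def)
  have sides': "openin M Q" "M closure_of Q = Q \<union> fst D" if "Q \<in> snd D" for Q
    using sides[rule_format, OF that] openin_trans_full[OF _ op] by iprover+
  obtain A B where AB: "snd D = {A, B}" "A \<noteq> {}" "B \<noteq> {}" "A \<inter> B = {}" "A \<union> B = topspace M - fst D"
    using ex by (elim exE conjE)
  have "P = A \<or> P = B"
    using assms(2) AB(1) by simp
  then show ?thesis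
  proof
    assume "P = A"
    then show ?thesis
      using that[of B] AB sides'[of A] sides'[of B] by simp
  next
    assume "P = B"
    then show ?thesis
      using that[of A] AB sides'[of A] sides'[of B] by (simp add: insert_commute Int_commute Un_commute)
  qed
qed

lemma division_closed: "division M D \<Longrightarrow> closedin M (fst D)"
  unfolding division_def Let_def by iprover

lemma division_nowhere_dense: "division M D \<Longrightarrow> M interior_of (M closure_of fst D) = {}"
  unfolding division_def Let_def by iprover

lemma division_sides:
  assumes "division M D"
  shows "\<exists>P. P \<in> snd D"
proof -
  obtain P N where "snd D = {P, N}"
    using assms[unfolded division_def Let_def, THEN conjunct2, THEN conjunct2, THEN conjunct1]
    by (elim exE conjE)
  then show ?thesis
    by (intro exI[of _ P]) simp
qed

lemma division_subset:
  assumes "division M D"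
  shows "fst D \<subseteq> topspace M" "P \<in> snd D \<Longrightarrow> P \<subseteq> topspace M"
proof -
  show "fst D \<subseteq> topspace M"
    using division_closed[OF assms] closedin_subset by blast
  show "P \<subseteq> topspace M" if "P \<in> snd D"
    using assms that by (rule divisionE) (rule openin_subset)
qed

text \<open>Walls see a side only through its points off the cut sets, so only its closure can be
  recovered from them. The closure suffices: its complement is the other side, and the two closures
  intersect in the cut set.\<close>

lemma division_of_closure:
  assumes "division M D" "P \<in> snd D"
  shows "D = (let Q = M closure_of P; N = topspace M - Q; C = Q \<inter> M closure_of N in (C, {Q - C, N}))"
proof -
  obtain N where N: "snd D = {P, N}" "P \<inter> N = {}" "P \<union> N = topspace M - fst D"
    "M closure_of P = P \<union> fst D" "M closure_of N = N \<union> fst D"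
    using assms by (rule divisionE)
  have "topspace M - (P \<union> fst D) = N"
    using N(2,3) by blast
  moreover have "(P \<union> fst D) \<inter> (N \<union> fst D) = fst D"
    using N(2) by blast
  moreover have "P \<union> fst D - fst D = P"
    using N(3) by blast
  ultimately show ?thesis
    unfolding Let_def N(4) using N(1,5) by (intro prod_eqI) simp_all
qed

section \<open>Paths crossing cut sets\<close>

lemma path_meets_division:
  assumes D: "division M D" "P \<in> snd D" and c: "pathin M c" "c 0 \<in> P" "c 1 \<in> topspace M - P - fst D"
  shows "\<exists>t\<in>{0..1}. c t \<in> fst D"
proof (rule ccontr)
  assume none: "\<not> (\<exists>t\<in>{0..1}. c t \<in> fst D)"
  obtain N where N: "P \<inter> N = {}" "P \<union> N = topspace M - fst D" "openin M P" "openin M N"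
    using D by (rule divisionE)
  have conn: "connectedin M (c ` {0..1})"
    by (rule connectedin_path_image[OF c(1)])
  then have "c ` {0..1} \<subseteq> topspace M"
    by (rule connectedin_subset_topspace)
  then have "c ` {0..1} \<subseteq> P \<union> N"
    unfolding N(2) using none by blast
  moreover have "P \<inter> N \<inter> c ` {0..1} = {}"
    using N(1) by blast
  moreover have "P \<inter> c ` {0..1} \<noteq> {}"
    using c(2) by force
  moreover have "c 1 \<in> N"
    using c(3) N(2) by blast
  then have "N \<inter> c ` {0..1} \<noteq> {}"
    by force
  ultimately show False
    using conn N(3,4) unfolding connectedin by blast
qed

text \<open>Compactness is taken from the parameter interval: the times at which the path meets the
  sets subconverge, and continuity carries the limit into \<open>M\<close>.\<close>

lemma path_meets_limit:
  assumes c: "pathin M c" and meets: "\<And>i. \<exists>t\<in>{0..1}. c t \<in> C i"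
  obtains r p where "strict_mono (r :: nat \<Rightarrow> nat)" "p \<in> c ` {0..1}" "p \<in> lim_sets M (C \<circ> r)"
proof -
  obtain \<tau> where \<tau>: "\<And>i. \<tau> i \<in> {0..1}" "\<And>i. c (\<tau> i) \<in> C i"
    using meets by metis
  obtain l r where r: "l \<in> {0..1}" "strict_mono r" "(\<tau> \<circ> r) \<longlonglongrightarrow> l"
    using compact_Icc[of "0::real" 1, unfolded compact_def] \<tau>(1) by metis
  have "limitin (top_of_set {0..1}) (\<tau> \<circ> r) l sequentially"
    unfolding limitin_subtopology using r \<tau>(1) by simp
  then have "limitin M (c \<circ> (\<tau> \<circ> r)) (c l) sequentially"
    by (rule continuous_map_limit[OF c[unfolded pathin_def]])
  then have "c l \<in> lim_sets M (C \<circ> r)"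
    unfolding lim_sets_def using \<tau>(2) by (intro CollectI exI[of _ "c \<circ> (\<tau> \<circ> r)"]) simp
  then show ?thesis
    using that r by blast
qed

lemma lim_sets_subseq:
  assumes "strict_mono r" "p \<in> lim_sets M C"
  shows "p \<in> lim_sets M (C \<circ> r)"
proof -
  obtain x where "\<And>i. x i \<in> C i" "limitin M x p sequentially"
    using assms(2) unfolding lim_sets_def by blast
  then show ?thesis
    unfolding lim_sets_def using limitin_subsequence[OF assms(1)]
    by (intro CollectI exI[of _ "x \<circ> r"]) simp
qed

text \<open>This is where triples are needed: the common limit point of the cut sets met by the paths may be an
  end point of a path, but each side contains two points, one of which avoids it.\<close>

lemma separating_sequence_impossible:
  fixes M :: "'a topology" and C :: "nat \<Rightarrow> 'a set"
  assumes no_cut: "\<nexists>p. path_cut_point M p" and conv: "point_convergent_sets M \<C>"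
    and path_connected: "path_connected_space M"
    and C: "inj C" "range C \<subseteq> \<C>"
    and XY: "2 \<le> card X" "2 \<le> card Y" "X \<subseteq> topspace M" "Y \<subseteq> topspace M"
    and sep: "\<And>i a b c. a \<in> X \<Longrightarrow> b \<in> Y \<Longrightarrow> pathin M c \<Longrightarrow> c 0 = a \<Longrightarrow> c 1 = b \<Longrightarrow> \<exists>t\<in>{0..1}. c t \<in> C i"
  shows False
proof -
  have avoid: "\<exists>x\<in>S. x \<noteq> p" if "2 \<le> card S" for S :: "'a set" and p
  proof (rule ccontr)
    assume "\<not> (\<exists>x\<in>S. x \<noteq> p)"
    then have "S \<subseteq> {p}"
      by blast
    then have "card S \<le> 1"
      using card_mono[of "{p}" S] by simp
    then show False
      using that by simp
  qed
  have "X \<noteq> {}" "Y \<noteq> {}"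
    using XY(1,2) by auto
  then obtain a b where ab: "a \<in> X" "b \<in> Y"
    by blast
  have "a \<in> topspace M" "b \<in> topspace M"
    using ab XY(3,4) by auto
  then obtain c where c: "pathin M c" "c 0 = a" "c 1 = b"
    using path_connected unfolding path_connected_space_def by blast
  obtain r p where r: "strict_mono r" and p: "p \<in> c ` {0..1}" "p \<in> lim_sets M (C \<circ> r)"
    by (rule path_meets_limit[OF c(1) sep[OF ab c]])
  have "p \<in> topspace M"
    using p(1) connectedin_subset_topspace[OF connectedin_path_image[OF c(1)]] by blast
  obtain a' b' where ab': "a' \<in> X" "a' \<noteq> p" "b' \<in> Y" "b' \<noteq> p"
    using avoid[OF XY(1)] avoid[OF XY(2)] by metis
  then have "a' \<in> topspace M - {p}" "b' \<in> topspace M - {p}"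
    using XY(3,4) by auto
  then obtain c' where c': "pathin M c'" "c' 0 = a'" "c' 1 = b'" "p \<notin> c' ` {0..1}"
    using no_cut \<open>p \<in> topspace M\<close> unfolding path_cut_point_def by blast
  have meets: "\<exists>t\<in>{0..1}. c' t \<in> (C \<circ> r) i" for i
    using sep[OF ab'(1,3) c'(1-3)] by simp
  \<comment> \<open>The point \<open>p\<close> remains a limit along the further subsequence, so
    \<open>p\<close> and \<open>q\<close> are limit points of one sequence of distinct cut sets.
    They differ because \<open>q\<close> lies on a path that avoids \<open>p\<close>.\<close>
  obtain r' q where r': "strict_mono r'" and q: "q \<in> c' ` {0..1}" "q \<in> lim_sets M (C \<circ> r \<circ> r')"
    by (rule path_meets_limit[OF c'(1) meets])
  have p': "p \<in> lim_sets M (C \<circ> r \<circ> r')"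
    by (rule lim_sets_subseq[OF r' p(2)])
  have "inj (C \<circ> r \<circ> r')"
    using C(1) strict_mono_imp_inj_on[OF r] strict_mono_imp_inj_on[OF r'] by (intro inj_compose)
  moreover have "range (C \<circ> r \<circ> r') \<subseteq> \<C>"
    using C(2) by auto
  ultimately have "p = q"
    using conv p' q(2) unfolding point_convergent_sets_def by blast
  then show False
    using c'(4) q(1) by simp
qed

section \<open>Halfspaces as majorities of triples off the cut sets\<close>

definition uncut :: "'a topology \<Rightarrow> 'a division set \<Rightarrow> 'a set" where
  "uncut M \<D> = topspace M - (\<Union>D\<in>\<D>. fst D)"

lemma triples_iff: "t \<in> triples M \<D> \<longleftrightarrow> t \<subseteq> uncut M \<D> \<and> card t = 3"
  unfolding triples_def uncut_def by simp

lemma insert_triple: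
  assumes "x \<in> uncut M \<D>" "y \<in> uncut M \<D>" "z \<in> uncut M \<D>" "x \<noteq> y" "x \<noteq> z" "y \<noteq> z"
  shows "{x, y, z} \<in> triples M \<D>"
  using assms unfolding triples_iff by simp

text \<open>From a point \<open>x\<close> in \<open>P\<close> but not in \<open>P'\<close> a triple
  is built that has two points in \<open>P\<close> and two outside \<open>P'\<close>, with
  \<open>x\<close> counted in both pairs. A second point \<open>y\<close> outside \<open>P'\<close>
  either lies in \<open>P\<close> itself or is complemented by a third point of
  \<open>P\<close>.\<close>

lemma halfspace_subset_imp:
  assumes P: "infinite (uncut M \<D> \<inter> P)" "infinite (uncut M \<D> - P)" and P': "infinite (uncut M \<D> - P')"
    and sub: "halfspace M \<D> P \<subseteq> halfspace M \<D> P'"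
  shows "uncut M \<D> \<inter> P \<subseteq> P'"
proof (rule ccontr)
  assume "\<not> uncut M \<D> \<inter> P \<subseteq> P'"
  then obtain x where x: "x \<in> uncut M \<D>" "x \<in> P" "x \<notin> P'"
    by blast
  have pick: "\<exists>y\<in>S. y \<notin> F" if "infinite S" "finite F" for S F :: "'a set"
    using finite_subset[of S F] that by (metis subsetI)
  have contra: False if y: "y \<in> uncut M \<D>" "z \<in> uncut M \<D>" "y \<noteq> x" "z \<noteq> x" "y \<noteq> z"
    and in_P: "y \<in> P" and out: "y \<notin> P' \<or> z \<notin> P'" for y z
  proof -
    have t: "{x, y, z} \<in> triples M \<D>"
      by (rule insert_triple) (use x y in auto)
    have "card {x, y} \<le> card ({x, y, z} \<inter> P)"
      by (rule card_mono) (use x in_P in auto)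
    then have "{x, y, z} \<in> halfspace M \<D> P"
      using t y(3) unfolding halfspace_def by simp
    then have two: "2 \<le> card ({x, y, z} \<inter> P')"
      using sub unfolding halfspace_def by blast
    have "\<exists>v. {x, y, z} \<inter> P' \<subseteq> {v}"
      using x(3) out by blast
    then obtain v where "{x, y, z} \<inter> P' \<subseteq> {v}"
      by blast
    then have "card ({x, y, z} \<inter> P') \<le> card {v}"
      by (intro card_mono) simp_all
    then show False
      using two by simp
  qed
  obtain y where y: "y \<in> uncut M \<D> - P'" "y \<notin> {x}"
    using pick[OF P'] by blast
  show False
  proof (cases "y \<in> P")
    case True
    obtain z where "z \<in> uncut M \<D> - P" "z \<notin> {x, y}"
      using pick[OF P(2), of "{x, y}"] by blast
    then show False
      using contra[of y z] y True by blast
  next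
    case False
    obtain z where "z \<in> uncut M \<D> \<inter> P" "z \<notin> {x, y}"
      using pick[OF P(1), of "{x, y}"] by blast
    then show False
      using contra[of z y] y by blast
  qed
qed

text \<open>Three points off the cut set are distributed over two sides, so exactly one side has the
  majority.\<close>

lemma halfspace_compl_eq:
  assumes "P \<inter> N = {}" "uncut M \<D> \<subseteq> P \<union> N"
  shows "halfspace M \<D> N = triples M \<D> - halfspace M \<D> P"
proof -
  have "card (t \<inter> P) + card (t \<inter> N) = 3" if t: "t \<in> triples M \<D>" for t
  proof -
    have "finite t"
      using t card.infinite unfolding triples_iff by force
    then have "card ((t \<inter> P) \<union> (t \<inter> N)) = card (t \<inter> P) + card (t \<inter> N)"
      using assms(1) by (intro card_Un_disjoint) auto
    moreover have "(t \<inter> P) \<union> (t \<inter> N) = t"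
      using assms(2) t unfolding triples_iff by blast
    ultimately show ?thesis
      using t unfolding triples_iff by simp
  qed
  then have "2 \<le> card (t \<inter> N) \<longleftrightarrow> \<not> 2 \<le> card (t \<inter> P)" if "t \<in> triples M \<D>" for t
    using that by force
  then show ?thesis
    unfolding halfspace_def by blast
qed

lemma infinite_obtain_triple:
  assumes "infinite S"
  obtains x y z where "x \<in> S" "y \<in> S" "z \<in> S" "x \<noteq> y" "x \<noteq> z" "y \<noteq> z"
proof -
  obtain T where T: "T \<subseteq> S" "card T = 3" "finite T"
    using infinite_arbitrarily_large[OF assms] by blast
  then obtain x y z where "T = {x, y, z}" "x \<noteq> y" "x \<noteq> z" "y \<noteq> z"
    by (auto simp: card_3_iff)
  then show ?thesis
    using that T(1) by blast
qed

locale division_system =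
  fixes M :: "'a topology" and \<D> :: "'a division set"
  assumes divisions: "D \<in> \<D> \<Longrightarrow> division M D"
    and dense: "openin M U \<Longrightarrow> U \<noteq> {} \<Longrightarrow> infinite (uncut M \<D> \<inter> U)"
begin

lemma uncut_subset_sides:
  assumes "D \<in> \<D>" "P \<union> N = topspace M - fst D"
  shows "uncut M \<D> \<subseteq> P \<union> N"
  using assms unfolding uncut_def by blast

lemma side_infinite:
  assumes D: "D \<in> \<D>" "P \<in> snd D"
  shows "infinite (uncut M \<D> \<inter> P)" "infinite (uncut M \<D> - P)"
proof -
  obtain N where N: "P \<noteq> {}" "N \<noteq> {}" "P \<inter> N = {}" "openin M P" "openin M N"
    using divisions[OF D(1)] D(2) by (rule divisionE)
  show "infinite (uncut M \<D> \<inter> P)"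
    by (rule dense[OF N(4,1)])
  have "uncut M \<D> \<inter> N \<subseteq> uncut M \<D> - P"
    using N(3) by blast
  then show "infinite (uncut M \<D> - P)"
    using dense[OF N(5,2)] infinite_super by blast
qed

lemma wall_pair:
  assumes D: "D \<in> \<D>"
  shows "\<exists>A. wall M \<D> D = {A, triples M \<D> - A} \<and> A \<subseteq> triples M \<D> \<and> A \<noteq> {} \<and> A \<noteq> triples M \<D>"
proof -
  obtain P where P: "P \<in> snd D"
    using division_sides[OF divisions[OF D]] by blast
  obtain N where N: "snd D = {P, N}" "P \<inter> N = {}" "P \<union> N = topspace M - fst D"
    using divisions[OF D] P by (rule divisionE)
  have compl: "halfspace M \<D> N = triples M \<D> - halfspace M \<D> P"
    by (rule halfspace_compl_eq[OF N(2) uncut_subset_sides[OF D N(3)]])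
  have nonempty: "halfspace M \<D> Q \<noteq> {}" if Q: "Q \<in> snd D" for Q
  proof -
    obtain x y z where xyz: "x \<in> uncut M \<D> \<inter> Q" "y \<in> uncut M \<D> \<inter> Q" "z \<in> uncut M \<D> \<inter> Q" "x \<noteq> y" "x \<noteq> z" "y \<noteq> z"
      using infinite_obtain_triple[OF side_infinite(1)[OF D Q]] by metis
    then have "{x, y, z} \<in> triples M \<D>" "{x, y, z} \<inter> Q = {x, y, z}"
      by (auto intro: insert_triple)
    then have "{x, y, z} \<in> halfspace M \<D> Q"
      using xyz(4-6) unfolding halfspace_def by simp
    then show ?thesis
      by blast
  qed
  have "halfspace M \<D> P \<subseteq> triples M \<D>"
    unfolding halfspace_def by blast
  moreover have "halfspace M \<D> P \<noteq> {}" "halfspace M \<D> N \<noteq> {}"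
    using nonempty N(1) by simp_all
  moreover have "wall M \<D> D = {halfspace M \<D> P, triples M \<D> - halfspace M \<D> P}"
    unfolding wall_def N(1) compl[symmetric] by simp
  ultimately show ?thesis
    unfolding compl by (intro exI[of _ "halfspace M \<D> P"]) auto
qed

text \<open>The points off the cut sets are dense, and intersecting a dense set with an open set
  preserves the closure of the latter.\<close>

lemma closure_uncut:
  assumes "openin M P"
  shows "M closure_of (uncut M \<D> \<inter> P) = M closure_of P"
proof -
  have "uncut M \<D> \<inter> U \<noteq> {}" if "openin M U" "U \<noteq> {}" for U
    using dense[OF that] by (metis finite.emptyI)
  then have "M closure_of (uncut M \<D>) = topspace M"
    unfolding dense_intersects_open by blast
  then have "M closure_of (P \<inter> topspace M) = M closure_of (P \<inter> uncut M \<D>)"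
    using closure_of_openin_Int_closure_of[OF assms, of "uncut M \<D>"] by simp
  then show ?thesis
    using openin_subset[OF assms] by (simp add: Int_absorb2 Int_commute)
qed

text \<open>Equal walls provide two sides with the same halfspace. These agree off the cut sets,
  hence have the same closure, which determines the division.\<close>

lemma wall_inject: "inj_on (wall M \<D>) \<D>"
proof (rule inj_onI)
  fix D E
  assume D: "D \<in> \<D>" and E: "E \<in> \<D>" and eq: "wall M \<D> D = wall M \<D> E"
  obtain P where P: "P \<in> snd D"
    using division_sides[OF divisions[OF D]] by blast
  have "halfspace M \<D> P \<in> wall M \<D> D"
    unfolding wall_def using P by (rule imageI)
  then obtain Q where Q: "Q \<in> snd E" "halfspace M \<D> P = halfspace M \<D> Q"
    unfolding eq unfolding wall_def by (elim imageE)
  have "uncut M \<D> \<inter> P \<subseteq> Q"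
    by (rule halfspace_subset_imp[OF side_infinite[OF D P] side_infinite(2)[OF E Q(1)]]) (simp add: Q(2))
  moreover have "uncut M \<D> \<inter> Q \<subseteq> P"
    by (rule halfspace_subset_imp[OF side_infinite[OF E Q(1)] side_infinite(2)[OF D P]]) (simp add: Q(2))
  ultimately have "uncut M \<D> \<inter> P = uncut M \<D> \<inter> Q"
    by blast
  moreover have "openin M P"
    using divisions[OF D] P by (rule divisionE)
  moreover have "openin M Q"
    using divisions[OF E] Q(1) by (rule divisionE)
  ultimately have "M closure_of P = M closure_of Q"
    using closure_uncut by metis
  then show "D = E"
    using division_of_closure[OF divisions[OF D] P] division_of_closure[OF divisions[OF E] Q(1)] by simp
qed

lemma finite_separating_halfspaces:
  assumes no_cut: "\<nexists>p. path_cut_point M p" and conv: "point_convergent_divisions M \<D>"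
    and path_connected: "path_connected_space M"
    and t: "t \<in> triples M \<D>" and u: "u \<in> triples M \<D>"
  shows "finite {A \<in> halfspaces M \<D>. t \<in> A \<and> u \<notin> A}"
proof -
  have fin: "finite t" "finite u"
    using t u card.infinite unfolding triples_iff by force+
  define S where "S = {D \<in> \<D>. \<exists>P\<in>snd D. t \<in> halfspace M \<D> P \<and> u \<notin> halfspace M \<D> P}"
  have "finite S"
  proof (rule ccontr)
    assume S: "infinite S"
    have "\<forall>D\<in>S. \<exists>P. P \<in> snd D \<and> t \<in> halfspace M \<D> P \<and> u \<notin> halfspace M \<D> P"
      unfolding S_def by blast
    then obtain P where P: "\<And>D. D \<in> S \<Longrightarrow> P D \<in> snd D \<and> t \<in> halfspace M \<D> (P D) \<and> u \<notin> halfspace M \<D> (P D)"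
      by metis
    \<comment> \<open>Infinitely many of the divisions distribute the points of \<open>t\<close> and
      \<open>u\<close> in the same way. This fixes the two sets of end points from which the
      separating-sequence argument may choose.\<close>
    have "finite ((\<lambda>D. (t \<inter> P D, u \<inter> P D)) ` S)"
      by (rule finite_subset[of _ "Pow t \<times> Pow u"]) (use fin in auto)
    then obtain D\<^sub>0 where D\<^sub>0: "D\<^sub>0 \<in> S" and inf: "infinite {D \<in> S. (t \<inter> P D, u \<inter> P D) = (t \<inter> P D\<^sub>0, u \<inter> P D\<^sub>0)}"
      using pigeonhole_infinite[OF S] by blast
    define S' where "S' = {D \<in> S. (t \<inter> P D, u \<inter> P D) = (t \<inter> P D\<^sub>0, u \<inter> P D\<^sub>0)}"
    have S': "D \<in> \<D>" "P D \<in> snd D" "t \<inter> P D = t \<inter> P D\<^sub>0" "u \<inter> P D = u \<inter> P D\<^sub>0" if "D \<in> S'" for D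
      using that P[of D] unfolding S'_def S_def by simp_all
    \<comment> \<open>Point convergence speaks of sequences of distinct cut sets; these exist
      because only finitely many divisions share one cut set.\<close>
    have "infinite (fst ` S')"
    proof
      assume "finite (fst ` S')"
      moreover have "finite {D \<in> \<D>. fst D = C}" for C
        using conv unfolding point_convergent_divisions_def by blast
      ultimately have "finite (\<Union>C\<in>fst ` S'. {D \<in> \<D>. fst D = C})"
        by blast
      moreover have "S' \<subseteq> (\<Union>C\<in>fst ` S'. {D \<in> \<D>. fst D = C})"
        using S'(1) by blast
      ultimately have "finite S'"
        by (rule rev_finite_subset)
      then show False
        using inf unfolding S'_def by simp
    qed
    then obtain C :: "nat \<Rightarrow> 'a set" where C: "inj C" "range C \<subseteq> fst ` S'"
      using infinite_countable_subset by metis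
    \<comment> \<open>Majorities give two points on each side: \<open>t\<close> has at least two
      points in the chosen side, and \<open>u\<close> has at most one there.\<close>
    let ?X = "t \<inter> P D\<^sub>0" and ?Y = "u - P D\<^sub>0"
    have X: "2 \<le> card ?X"
      using P[OF D\<^sub>0] unfolding halfspace_def by simp
    have "card (u \<inter> P D\<^sub>0) < 2"
      using P[OF D\<^sub>0] u unfolding halfspace_def by simp
    moreover have "card u = card (u \<inter> P D\<^sub>0) + card ?Y"
      using card_Int_Diff[OF fin(2)] .
    ultimately have Y: "2 \<le> card ?Y"
      using u unfolding triples_iff by simp
    show False
    proof (rule separating_sequence_impossible[OF no_cut _ path_connected C(1) _ X Y])
      show "point_convergent_sets M (fst ` \<D>)"
        using conv unfolding point_convergent_divisions_def by blast
      show "range C \<subseteq> fst ` \<D>"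
        using C(2) S'(1) by blast
      show "?X \<subseteq> topspace M" "?Y \<subseteq> topspace M"
        using t u unfolding triples_iff uncut_def by blast+
      fix i a b c
      assume ab: "a \<in> ?X" "b \<in> ?Y" and c: "pathin M c" "c 0 = a" "c 1 = b"
      obtain D where D: "D \<in> S'" "C i = fst D"
        using C(2) by blast
      have "a \<in> P D"
        using ab(1) S'(3)[OF D(1)] by blast
      moreover have "b \<in> topspace M - P D - fst D"
        using ab(2) S'(1,4)[OF D(1)] u unfolding triples_iff uncut_def by blast
      ultimately show "\<exists>t\<in>{0..1}. c t \<in> C i"
        unfolding D(2) using c
        by (intro path_meets_division[OF divisions[OF S'(1)[OF D(1)]] S'(2)[OF D(1)]]) simp_all
    qed
  qed
  moreover have "finite (wall M \<D> D)" if "D \<in> S" for D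
    using wall_pair[of D] that unfolding S_def by force
  ultimately have "finite (\<Union>D\<in>S. wall M \<D> D)"
    by blast
  moreover have "{A \<in> halfspaces M \<D>. t \<in> A \<and> u \<notin> A} \<subseteq> (\<Union>D\<in>S. wall M \<D> D)"
    unfolding halfspaces_def wall_def S_def by blast
  ultimately show ?thesis
    by (rule rev_finite_subset)
qed

end

section \<open>Abundance of points off the cut sets\<close>

lemma infinite_open:
  assumes "t1_space M" "connected_space M" and two: "\<exists>x\<in>topspace M. \<exists>y\<in>topspace M. x \<noteq> y"
    and U: "openin M U" "U \<noteq> {}"
  shows "infinite U"
proof
  assume fin: "finite U"
  obtain x where x: "x \<in> U"
    using U(2) by blast
  have UM: "U \<subseteq> topspace M"
    by (rule openin_subset[OF U(1)])
  \<comment> \<open>In a T1 space a finite open set has open points. Such a point is clopen, and by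
    connectedness it is the whole space.\<close>
  have "closedin M (U - {x})"
    using assms(1) fin UM unfolding t1_space_closedin_finite by auto
  then have "openin M (U - (U - {x}))"
    by (rule openin_diff[OF U(1)])
  moreover have "U - (U - {x}) = {x}"
    using x by blast
  moreover have "closedin M {x}"
    by (rule closedin_t1_singleton[OF assms(1)]) (use x UM in blast)
  ultimately have "topspace M = {x}"
    using assms(2) unfolding connected_space_clopen_in by force
  then show False
    using two by simp
qed

text \<open>The Baire property puts only one point off the cut sets into each nonempty open set. If
  \<open>U\<close> contained finitely many of them, removing these would leave an open set, still
  nonempty because \<open>U\<close> is infinite, without any such point.\<close>

lemma infinite_uncut:
  assumes t1: "t1_space M" and conn: "connected_space M" and two: "\<exists>x\<in>topspace M. \<exists>y\<in>topspace M. x \<noteq> y"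
    and baire: "baire_space M" and count: "countable \<D>" and divs: "\<And>D. D \<in> \<D> \<Longrightarrow> division M D"
    and U: "openin M U" "U \<noteq> {}"
  shows "infinite (uncut M \<D> \<inter> U)"
proof
  assume fin: "finite (uncut M \<D> \<inter> U)"
  let ?\<U> = "(\<lambda>D. topspace M - fst D) ` \<D>"
  have "openin M (topspace M - fst D) \<and> M closure_of (topspace M - fst D) = topspace M" if "D \<in> \<D>" for D
  proof
    show "openin M (topspace M - fst D)"
      using division_closed[OF divs[OF that]] by (simp add: closedin_def)
    have "M interior_of (fst D) \<subseteq> M interior_of (M closure_of fst D)"
      by (intro interior_of_mono closure_of_subset closedin_subset division_closed divs that)
    then show "M closure_of (topspace M - fst D) = topspace M"
      using division_nowhere_dense[OF divs[OF that]] unfolding closure_of_complement by simp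
  qed
  then have "countable ?\<U> \<and> (\<forall>U\<in>?\<U>. openin M U \<and> M closure_of U = topspace M)"
    using count by simp
  then have "M closure_of (topspace M \<inter> \<Inter>?\<U>) = topspace M"
    by (rule baire[unfolded baire_space_def, THEN spec, THEN mp])
  moreover have "topspace M \<inter> \<Inter>?\<U> = uncut M \<D>"
    unfolding uncut_def by blast
  ultimately have dense: "uncut M \<D> \<inter> V \<noteq> {}" if "openin M V" "V \<noteq> {}" for V
    using that dense_intersects_open[of M "uncut M \<D>"] by simp
  have "closedin M (uncut M \<D> \<inter> U)"
    using t1 fin openin_subset[OF U(1)] unfolding t1_space_closedin_finite by blast
  then have "openin M (U - uncut M \<D> \<inter> U)"
    by (rule openin_diff[OF U(1)])
  moreover have "infinite (U - uncut M \<D> \<inter> U)"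
    using infinite_open[OF t1 conn two U] fin by (rule Diff_infinite_finite[rotated])
  then have "U - uncut M \<D> \<inter> U \<noteq> {}"
    by force
  ultimately show False
    using dense by blast
qed

text \<open>The Baire property handles countably many cut sets; a countable group with finitely many
  orbits of divisions provides no more.\<close>

lemma countable_of_finite_orbits:
  assumes action: "group_action G (topspace M) \<phi>" and count: "countable (carrier G)"
    and fin: "finite (orbits G \<D> (division_act \<phi>))"
    and parts: "\<And>D. D \<in> \<D> \<Longrightarrow> fst D \<subseteq> topspace M" "\<And>D P. D \<in> \<D> \<Longrightarrow> P \<in> snd D \<Longrightarrow> P \<subseteq> topspace M"
  shows "countable \<D>"
proof -
  interpret group_action G "topspace M" \<phi>
    by (rule action)
  have group: "group G"
    using group_hom by (simp add: group_hom_def)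
  \<comment> \<open>The action is given by bijections of the space only, so the unit is known to act
    as the identity only on its subsets.\<close>
  have one: "\<phi> \<one>\<^bsub>G\<^esub> ` X = X" if "X \<subseteq> topspace M" for X
  proof -
    have "\<phi> \<one>\<^bsub>G\<^esub> x = x" if "x \<in> X" for x
      using that \<open>X \<subseteq> topspace M\<close> unfolding id_eq_one[symmetric] by auto
    then show ?thesis
      by simp
  qed
  have "D \<in> \<Union>(orbits G \<D> (division_act \<phi>))" if D: "D \<in> \<D>" for D
  proof -
    have "(`) (\<phi> \<one>\<^bsub>G\<^esub>) ` snd D = snd D"
      using one parts(2)[OF D] by simp
    then have "division_act \<phi> \<one>\<^bsub>G\<^esub> D = D"
      unfolding division_act_def using one[OF parts(1)[OF D]] by simp
    then have "D \<in> orbit G (division_act \<phi>) D"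
      unfolding orbit_def using monoid.one_closed[OF group.is_monoid[OF group]] by force
    then show ?thesis
      unfolding orbits_def using D by blast
  qed
  then have "\<D> \<subseteq> \<Union>(orbits G \<D> (division_act \<phi>))"
    by blast
  moreover have "countable O'" if O': "O' \<in> orbits G \<D> (division_act \<phi>)" for O'
  proof -
    obtain D where "O' = orbit G (division_act \<phi>) D"
      using O' unfolding orbits_def by blast
    then show ?thesis
      using count by (simp add: orbit_def setcompr_eq_image)
  qed
  then have "countable (\<Union>O'\<in>orbits G \<D> (division_act \<phi>). O')"
    by (rule countable_UN[OF countable_finite[OF fin]])
  then have "countable (\<Union>(orbits G \<D> (division_act \<phi>)))"
    by simp
  ultimately show ?thesis
    by (rule countable_subset)
qed

theorem theoremA:
  fixes M :: "'a topology"
    and G :: "('g, 'm) monoid_scheme"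
    and \<phi> :: "'g \<Rightarrow> 'a \<Rightarrow> 'a"
    and \<D> :: "'a division set"
  assumes nondegenerate: "\<exists>x\<in>topspace M. \<exists>y\<in>topspace M. x \<noteq> y"
    and path_connected: "path_connected_space M"
    and t1: "t1_space M"
    and baire: "baire_space M"
    and no_path_cut_point: "\<nexists>p. path_cut_point M p"
    and countable: "countable (carrier G)"
    and action: "group_action G (topspace M) \<phi>"
    and homeomorphisms: "\<forall>g\<in>carrier G. homeomorphic_map M M (\<phi> g)"
    and divisions: "\<forall>D\<in>\<D>. division M D"
    and G_full: "\<forall>D\<in>\<D>. full_division G \<phi> D"
    and G_finite: "finite_division_collection G \<phi> \<D>"
    and point_convergent: "point_convergent_divisions M \<D>"
  shows "cat0_cube_complex (dual_complex M \<D>)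
    \<and> (\<forall>t\<in>triples M \<D>. principal_ultrafilter M \<D> t \<in> \<Union>(dual_complex M \<D>))
    \<and> cubical_action G (dual_complex M \<D>) (dual_action M \<D> \<phi>)
    \<and> {stabilizer G (hyperplane_act (dual_action M \<D> \<phi>)) H | H. hyperplane (dual_complex M \<D>) H}
        = {stabilizer G (division_act \<phi>) D | D. D \<in> \<D>}"
proof -
  have div: "division M D" if "D \<in> \<D>" for D
    using divisions that by blast
  have count: "countable \<D>"
    by (rule countable_of_finite_orbits[OF action countable])
      (use G_finite division_subset div in \<open>unfold finite_division_collection_def, blast\<close>)+
  have uncut: "infinite (uncut M \<D> \<inter> U)" if U: "openin M U" "U \<noteq> {}" for U
    by (rule infinite_uncut[OF t1 path_connected_imp_connected_space[OF path_connected] nondegenerate baire count _ U])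
      (rule div)
  interpret division_system M \<D>
    using div uncut by (rule division_system.intro)
  have "topspace M \<noteq> {}"
    using nondegenerate by blast
  then have "infinite (uncut M \<D> \<inter> topspace M)"
    by (rule uncut[OF openin_topspace])
  then obtain x y z where xyz: "x \<in> uncut M \<D> \<inter> topspace M" "y \<in> uncut M \<D> \<inter> topspace M"
    "z \<in> uncut M \<D> \<inter> topspace M" "x \<noteq> y" "x \<noteq> z" "y \<noteq> z"
    by (rule infinite_obtain_triple)
  have "{x, y, z} \<in> triples M \<D>"
    by (rule insert_triple) (use xyz in simp_all)
  then interpret wallspace M \<D> "{x, y, z}"
    using wall_pair finite_separating_halfspaces[OF no_path_cut_point point_convergent path_connected]
    by (rule wallspace.intro)
  interpret wall_action M \<D> "{x, y, z}" G \<phi>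
  proof (rule wall_action.intro[OF wallspace_axioms action], unfold_locales)
    show "division_act \<phi> g D \<in> \<D>" if "g \<in> carrier G" "D \<in> \<D>" for g D
      using G_finite that unfolding finite_division_collection_def by blast
    show "fst D \<subseteq> topspace M" if "D \<in> \<D>" for D
      by (rule division_subset(1)[OF div[OF that]])
    show "P \<subseteq> topspace M" if "D \<in> \<D>" "P \<in> snd D" for D P
      by (rule division_subset(2)[OF div[OF that(1)] that(2)])
    show "inj_on (wall M \<D>) \<D>"
      by (rule wall_inject)
  qed
  have "cat0_cube_complex (dual_complex M \<D>)"
    unfolding dual_complex_eq_cells by (rule cat0_cells)
  then show ?thesis
    using principal_vertex cubical_dual_action hyperplane_stabilizers by (intro conjI ballI)
qed

end
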